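(* Let $b\ge 1$ and let $v=(v_{ij})_{i,j=1}^b\in M_b(U_b^{\mathrm{nc}})$ be the canonical Haar unitary matrix over the Brown algebra $U_b^{\mathrm{nc}}$, with transpose $v^t=(v_{ji})_{i,j=1}^b$ and diagonal decomposition $v^t=v_0+v_1+\cdots+v_{b-1}$. Then, in the non-commutative probability space $(M_b(U_b^{\mathrm{nc}}),\Phi)$ with $\Phi((a_{ij}))=\frac1b\sum_{i}\varphi(a_{ii})$, the elements $v_0,v_1,\dots,v_{b-1}$ are $R$-diagonal and $*$-free (over $\mathbb{C}$).
   Context: **Brown algebra.** Let $M_b(\mathbb{C})*C(\mathbb{T})$ be the (unital) free product $C^*$-algebra, with tracial state $\varphi_b$ equal to the free product of the normalized trace on $M_b(\mathbb{C})$ and integration against normalized Haar measure on $C(\mathbb{T})$. Let $\{e_{ij}\}$ be the matrix units of $M_b(\mathbb{C})$ and let $v\in C(\mathbb{T})$, $v(z)=z$ (a Haar unitary, $*$-free from the $e_{ij}$). Set $U_b^{\mathrm{nc}}=e_{11}(M_b(\mathbb{C})*C(\mathbb{T}))e_{11}$, $v_{ij}=e_{1i}\,v\,e_{j1}\in U_b^{\mathrm{nc}}$, and $\varphi(x)=b\,\varphi_b(x)$ for $x\in U_b^{\mathrm{nc}}$ (a tracial state). The algebra $M_b(\mathbb{C})*C(\mathbb{T})$ is identified with $M_b(U_b^{\mathrm{nc}})$ via $x\mapsto(e_{1i}xe_{j1})_{i,j}$, so that $v=(v_{ij})_{i,j=1}^b$ is a unitary matrix. **Diagonal decomposition.** All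 indices are taken modulo $b$ (in $\{1,\dots,b\}$). Let $s=(s_{ij})$ be the $b\times b$ cyclic permutation matrix with $s_{ij}=\delta_{i+1,j}$. For $0\le k\le b-1$ let $w_{1,k}=\mathrm{diag}(v_{k+1,1},v_{k+2,2},\dots,v_{k+b,b})$ and $v_k=w_{1,k}s^k$. Then $v^t=v_0+\cdots+v_{b-1}$. An element $x$ is $R$-diagonal if all free $*$-cumulants of $(x,x^* )$ vanish except possibly those of even order whose arguments alternate between $x$ and $x^*$. A family is $*$-free if the unital $*$-algebras generated by its members are free. *)

theory Defs
  imports
    "HOL-Analysis.Analysis"
    "HOL-Algebra.Algebraic_Closure_Type"
begin

section \<open>Unital *-algebras and C*-algebras\<close>

record 'a star_alg = "(complex, 'a) module" +
  star :: "'a \<Rightarrow> 'a"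

definition star_algebra :: "'a star_alg \<Rightarrow> bool" where
  "star_algebra A \<longleftrightarrow>
     Ring.ring A \<and> Module.module (ring_of_type_algebra :: complex ring) A \<and>
     (\<forall>c. \<forall>x\<in>carrier A. \<forall>y\<in>carrier A.
        (c \<odot>\<^bsub>A\<^esub> x) \<otimes>\<^bsub>A\<^esub> y = c \<odot>\<^bsub>A\<^esub> (x \<otimes>\<^bsub>A\<^esub> y) \<and>
        x \<otimes>\<^bsub>A\<^esub> (c \<odot>\<^bsub>A\<^esub> y) = c \<odot>\<^bsub>A\<^esub> (x \<otimes>\<^bsub>A\<^esub> y)) \<and>
     (\<forall>x\<in>carrier A. star A x \<in> carrier A \<and> star A (star A x) = x) \<and>
     (\<forall>x\<in>carrier A. \<forall>y\<in>carrier A.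
        star A (x \<oplus>\<^bsub>A\<^esub> y) = star A x \<oplus>\<^bsub>A\<^esub> star A y \<and>
        star A (x \<otimes>\<^bsub>A\<^esub> y) = star A y \<otimes>\<^bsub>A\<^esub> star A x) \<and>
     (\<forall>c. \<forall>x\<in>carrier A. star A (c \<odot>\<^bsub>A\<^esub> x) = cnj c \<odot>\<^bsub>A\<^esub> star A x)"

definition cstar_norm :: "'a star_alg \<Rightarrow> ('a \<Rightarrow> real) \<Rightarrow> bool" where
  "cstar_norm A N \<longleftrightarrow>
     (\<forall>x\<in>carrier A. 0 \<le> N x \<and> (N x = 0 \<longleftrightarrow> x = \<zero>\<^bsub>A\<^esub>)) \<and>
     (\<forall>c. \<forall>x\<in>carrier A. N (c \<odot>\<^bsub>A\<^esub> x) = cmod c * N x) \<and>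
     (\<forall>x\<in>carrier A. \<forall>y\<in>carrier A. N (x \<oplus>\<^bsub>A\<^esub> y) \<le> N x + N y) \<and>
     (\<forall>x\<in>carrier A. \<forall>y\<in>carrier A. N (x \<otimes>\<^bsub>A\<^esub> y) \<le> N x * N y) \<and>
     (\<forall>x\<in>carrier A. N (star A x \<otimes>\<^bsub>A\<^esub> x) = (N x)\<^sup>2) \<and>
     (\<forall>x :: nat \<Rightarrow> 'a. range x \<subseteq> carrier A \<longrightarrow>
        (\<forall>e>0. \<exists>M. \<forall>m\<ge>M. \<forall>n\<ge>M. N (x m \<ominus>\<^bsub>A\<^esub> x n) < e) \<longrightarrow>
        (\<exists>y\<in>carrier A. (\<lambda>n. N (x n \<ominus>\<^bsub>A\<^esub> y)) \<longlonglongrightarrow> 0))"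

text \<open>A *-algebra carries at most one complete C*-norm, and *-homomorphisms between
  C*-algebras are contractive; so the norm need not be part of the structure.\<close>

definition cstar_algebra :: "'a star_alg \<Rightarrow> bool" where
  "cstar_algebra A \<longleftrightarrow> star_algebra A \<and> (\<exists>N. cstar_norm A N)"

definition star_hom :: "'a star_alg \<Rightarrow> 'b star_alg \<Rightarrow> ('a \<Rightarrow> 'b) set" where
  "star_hom A B = {f \<in> ring_hom A B. \<forall>x\<in>carrier A.
     (\<forall>c. f (c \<odot>\<^bsub>A\<^esub> x) = c \<odot>\<^bsub>B\<^esub> f x) \<and> f (star A x) = star B (f x)}"

definition star_subalgebra :: "'a star_alg \<Rightarrow> 'a set \<Rightarrow> bool" where
  "star_subalgebra A S \<longleftrightarrow>
     S \<subseteq> carrier A \<and> \<one>\<^bsub>A\<^esub> \<in> S \<and>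
     (\<forall>c. \<forall>x\<in>S. c \<odot>\<^bsub>A\<^esub> x \<in> S) \<and>
     (\<forall>x\<in>S. \<forall>y\<in>S. x \<oplus>\<^bsub>A\<^esub> y \<in> S \<and> x \<otimes>\<^bsub>A\<^esub> y \<in> S) \<and>
     (\<forall>x\<in>S. star A x \<in> S)"

definition corner :: "'a star_alg \<Rightarrow> 'a \<Rightarrow> 'a star_alg" where
  "corner A e = A\<lparr>carrier := {e \<otimes>\<^bsub>A\<^esub> x \<otimes>\<^bsub>A\<^esub> e |x. x \<in> carrier A}, one := e\<rparr>"


section \<open>The algebras of scalars, matrices, and functions on the circle\<close>

definition complex_algebra :: "complex star_alg" where
  "complex_algebra =
     \<lparr>carrier = UNIV, monoid.mult = (*), one = 1, ring.zero = 0, add = (+),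
      smult = (*), star = cnj\<rparr>"

definition matrix_algebra :: "nat \<Rightarrow> 'a star_alg \<Rightarrow> (nat \<times> nat \<Rightarrow> 'a) star_alg" where
  "matrix_algebra b A =
     \<lparr>carrier = {1..b} \<times> {1..b} \<rightarrow>\<^sub>E carrier A,
      monoid.mult = (\<lambda>M N. \<lambda>(i, j)\<in>{1..b} \<times> {1..b}. \<Oplus>\<^bsub>A\<^esub>l\<in>{1..b}. M (i, l) \<otimes>\<^bsub>A\<^esub> N (l, j)),
      one = (\<lambda>(i, j)\<in>{1..b} \<times> {1..b}. if i = j then \<one>\<^bsub>A\<^esub> else \<zero>\<^bsub>A\<^esub>),
      ring.zero = (\<lambda>p\<in>{1..b} \<times> {1..b}. \<zero>\<^bsub>A\<^esub>),
      add = (\<lambda>M N. \<lambda>p\<in>{1..b} \<times> {1..b}. M p \<oplus>\<^bsub>A\<^esub> N p),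
      smult = (\<lambda>c M. \<lambda>p\<in>{1..b} \<times> {1..b}. c \<odot>\<^bsub>A\<^esub> M p),
      star = (\<lambda>M. \<lambda>(i, j)\<in>{1..b} \<times> {1..b}. star A (M (j, i)))\<rparr>"

definition matrix_unit :: "nat \<Rightarrow> nat \<Rightarrow> nat \<Rightarrow> nat \<times> nat \<Rightarrow> complex" where
  "matrix_unit b i j = (\<lambda>p\<in>{1..b} \<times> {1..b}. if p = (i, j) then 1 else 0)"

definition circle_algebra :: "(complex \<Rightarrow> complex) star_alg" where
  "circle_algebra =
     \<lparr>carrier = {f \<in> extensional (sphere 0 1). continuous_on (sphere 0 1) f},
      monoid.mult = (\<lambda>f g. \<lambda>z\<in>sphere 0 1. f z * g z),
      one = (\<lambda>z\<in>sphere 0 1. 1),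
      ring.zero = (\<lambda>z\<in>sphere 0 1. 0),
      add = (\<lambda>f g. \<lambda>z\<in>sphere 0 1. f z + g z),
      smult = (\<lambda>c f. \<lambda>z\<in>sphere 0 1. c * f z),
      star = (\<lambda>f. \<lambda>z\<in>sphere 0 1. cnj (f z))\<rparr>"

text \<open>Normalized Haar measure on the circle is the image of Lebesgue measure on
  \<open>[0, 1]\<close> under \<open>t \<mapsto> exp (2 \<pi> i t)\<close>.\<close>

definition haar_state :: "(complex \<Rightarrow> complex) \<Rightarrow> complex" where
  "haar_state f = integral {0..1} (\<lambda>t. f (cis (2 * pi * t)))"

text \<open>For \<open>\<phi> = id\<close> this is the normalized trace on complex matrices.\<close>

definition matrix_state :: "nat \<Rightarrow> ('a \<Rightarrow> complex) \<Rightarrow> (nat \<times> nat \<Rightarrow> 'a) \<Rightarrow> complex" where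
  "matrix_state b \<phi> M = (\<Sum>i=1..b. \<phi> (M (i, i))) / of_nat b"


section \<open>States and freeness\<close>

definition state :: "'a star_alg \<Rightarrow> ('a \<Rightarrow> complex) \<Rightarrow> bool" where
  "state A \<phi> \<longleftrightarrow>
     (\<forall>x\<in>carrier A. \<forall>y\<in>carrier A. \<phi> (x \<oplus>\<^bsub>A\<^esub> y) = \<phi> x + \<phi> y) \<and>
     (\<forall>c. \<forall>x\<in>carrier A. \<phi> (c \<odot>\<^bsub>A\<^esub> x) = c * \<phi> x) \<and>
     \<phi> \<one>\<^bsub>A\<^esub> = 1 \<and>
     (\<forall>x\<in>carrier A. \<phi> (star A x \<otimes>\<^bsub>A\<^esub> x) \<in> \<real>\<^sub>\<ge>\<^sub>0)"

definition tracial_state :: "'a star_alg \<Rightarrow> ('a \<Rightarrow> complex) \<Rightarrow> bool" where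
  "tracial_state A \<phi> \<longleftrightarrow> state A \<phi> \<and>
     (\<forall>x\<in>carrier A. \<forall>y\<in>carrier A. \<phi> (x \<otimes>\<^bsub>A\<^esub> y) = \<phi> (y \<otimes>\<^bsub>A\<^esub> x))"

definition list_prod :: "'a star_alg \<Rightarrow> 'a list \<Rightarrow> 'a" where
  "list_prod A xs = foldr (\<otimes>\<^bsub>A\<^esub>) xs \<one>\<^bsub>A\<^esub>"

definition free :: "'a star_alg \<Rightarrow> ('a \<Rightarrow> complex) \<Rightarrow> 'i set \<Rightarrow> ('i \<Rightarrow> 'a set) \<Rightarrow> bool" where
  "free A \<phi> I S \<longleftrightarrow>
     (\<forall>ws :: ('i \<times> 'a) list.
        ws \<noteq> [] \<and> distinct_adj (map fst ws) \<and>
        (\<forall>(i, a)\<in>set ws. i \<in> I \<and> a \<in> S i \<and> \<phi> a = 0) \<longrightarrow>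
        \<phi> (list_prod A (map snd ws)) = 0)"

definition star_free :: "'a star_alg \<Rightarrow> ('a \<Rightarrow> complex) \<Rightarrow> 'i set \<Rightarrow> ('i \<Rightarrow> 'a) \<Rightarrow> bool" where
  "star_free A \<phi> I x \<longleftrightarrow> free A \<phi> I (\<lambda>i. star_subalgebra A hull {x i})"

text \<open>The unital free product (coproduct of unital C*-algebras), characterized by its universal
  property. A C*-algebra generated by images of two separable algebras has at most the
  cardinality of the continuum. For separable \<open>A1\<close> and \<open>A2\<close> and nonzero \<open>A\<close>, target algebras
  carried by subsets of the type of \<open>A\<close> therefore suffice to obtain the universal property for
  targets of any size.\<close>

definition is_free_product ::
  "'b star_alg \<Rightarrow> 'c star_alg \<Rightarrow> 'a star_alg \<Rightarrow> ('b \<Rightarrow> 'a) \<Rightarrow> ('c \<Rightarrow> 'a) \<Rightarrow> bool" where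
  "is_free_product A1 A2 A \<iota>1 \<iota>2 \<longleftrightarrow>
     cstar_algebra A \<and> \<iota>1 \<in> star_hom A1 A \<and> \<iota>2 \<in> star_hom A2 A \<and>
     (\<forall>B :: 'a star_alg. cstar_algebra B \<longrightarrow>
        (\<forall>\<alpha>1\<in>star_hom A1 B. \<forall>\<alpha>2\<in>star_hom A2 B.
           \<exists>!\<alpha>. \<alpha> \<in> star_hom A B \<and> \<alpha> \<in> extensional (carrier A) \<and>
              (\<forall>x\<in>carrier A1. \<alpha> (\<iota>1 x) = \<alpha>1 x) \<and>
              (\<forall>x\<in>carrier A2. \<alpha> (\<iota>2 x) = \<alpha>2 x)))"

definition is_free_product_state ::
  "'b star_alg \<Rightarrow> ('b \<Rightarrow> complex) \<Rightarrow> 'c star_alg \<Rightarrow> ('c \<Rightarrow> complex) \<Rightarrow>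
   'a star_alg \<Rightarrow> ('b \<Rightarrow> 'a) \<Rightarrow> ('c \<Rightarrow> 'a) \<Rightarrow> ('a \<Rightarrow> complex) \<Rightarrow> bool" where
  "is_free_product_state A1 \<phi>1 A2 \<phi>2 A \<iota>1 \<iota>2 \<phi> \<longleftrightarrow>
     state A \<phi> \<and>
     (\<forall>x\<in>carrier A1. \<phi> (\<iota>1 x) = \<phi>1 x) \<and>
     (\<forall>x\<in>carrier A2. \<phi> (\<iota>2 x) = \<phi>2 x) \<and>
     free A \<phi> UNIV (case_bool (\<iota>1 ` carrier A1) (\<iota>2 ` carrier A2))"


section \<open>Free cumulants and R-diagonal elements\<close>

definition noncrossing_partition :: "nat \<Rightarrow> nat set set \<Rightarrow> bool" where
  "noncrossing_partition n P \<longleftrightarrow>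
     partition_on {..<n} P \<and>
     \<not> (\<exists>V\<in>P. \<exists>W\<in>P. \<exists>p q r s. V \<noteq> W \<and> p < q \<and> q < r \<and> r < s \<and>
          p \<in> V \<and> q \<in> W \<and> r \<in> V \<and> s \<in> W)"

text \<open>The moment-cumulant formula
  \<open>\<phi>(a\<^sub>1 \<cdots> a\<^sub>n) = (\<Sum>P\<in>NC(n). \<Prod>V\<in>P. \<kappa>(a\<^sub>i | i \<in> V))\<close>,
  solved for the term of the one-block partition. The value on the empty list is irrelevant.\<close>

function free_cumulant ::
    "'a star_alg \<Rightarrow> ('a \<Rightarrow> complex) \<Rightarrow> 'a list \<Rightarrow> complex" where
  "free_cumulant A \<phi> xs =
     \<phi> (list_prod A xs) -
     (\<Sum>P | noncrossing_partition (length xs) P \<and> P \<noteq> {{..<length xs}}.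
        \<Prod>V\<in>P. free_cumulant A \<phi> (nths xs V))"
  by pat_completeness auto

lemma length_nths_proper_block:
  assumes "noncrossing_partition (length xs) P" "P \<noteq> {{..<length xs}}" "V \<in> P"
  shows "length (nths xs V) < length xs"
proof -
  have P: "partition_on {..<length xs} P"
    using assms(1) by (simp add: noncrossing_partition_def)
  have sub: "V \<subseteq> {..<length xs}"
    using partition_onD1[OF P] assms(3) by blast
  have "V \<noteq> {..<length xs}"
  proof
    assume V: "V = {..<length xs}"
    have "W = V" if "W \<in> P" for W
    proof (rule ccontr)
      assume "W \<noteq> V"
      then have "W \<inter> V = {}"
        using disjointD[OF partition_onD2[OF P] that assms(3)] by simp
      moreover have "W \<subseteq> V" "W \<noteq> {}"
        using partition_onD1[OF P] partition_onD3[OF P] that V by blast+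
      ultimately show False by blast
    qed
    then have "P = {V}" using assms(3) by blast
    then show False using assms(2) V by simp
  qed
  then have "card V < length xs"
    using psubset_card_mono[of "{..<length xs}" V] sub by auto
  moreover have "{i. i < length xs \<and> i \<in> V} = V"
    using sub by auto
  ultimately show ?thesis by (simp add: length_nths)
qed

termination free_cumulant
  by (relation "Wellfounded.measure (\<lambda>(A, \<phi>, xs). length xs)")
    (auto intro: length_nths_proper_block)

declare free_cumulant.simps [simp del]

definition R_diagonal :: "'a star_alg \<Rightarrow> ('a \<Rightarrow> complex) \<Rightarrow> 'a \<Rightarrow> bool" where
  "R_diagonal A \<phi> x \<longleftrightarrow>
     (\<forall>\<epsilon> :: bool list. \<epsilon> \<noteq> [] \<and> \<not> (even (length \<epsilon>) \<and> distinct_adj \<epsilon>) \<longrightarrow>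
        free_cumulant A \<phi> (map (\<lambda>e. if e then star A x else x) \<epsilon>) = 0)"


section \<open>The Brown algebra and the diagonal decomposition\<close>

text \<open>In the following, \<open>\<iota>\<close> is the embedding of the complex \<open>b \<times> b\<close> matrices into \<open>A\<close>, and \<open>v\<close> is
  an element of \<open>A\<close>.\<close>

definition brown_algebra ::
  "nat \<Rightarrow> 'a star_alg \<Rightarrow> ((nat \<times> nat \<Rightarrow> complex) \<Rightarrow> 'a) \<Rightarrow> 'a star_alg" where
  "brown_algebra b A \<iota> = corner A (\<iota> (matrix_unit b 1 1))"

definition brown_matrix ::
  "nat \<Rightarrow> 'a star_alg \<Rightarrow> ((nat \<times> nat \<Rightarrow> complex) \<Rightarrow> 'a) \<Rightarrow> 'a \<Rightarrow> nat \<times> nat \<Rightarrow> 'a" where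
  "brown_matrix b A \<iota> v = (\<lambda>(i, j)\<in>{1..b} \<times> {1..b}.
     \<iota> (matrix_unit b 1 i) \<otimes>\<^bsub>A\<^esub> v \<otimes>\<^bsub>A\<^esub> \<iota> (matrix_unit b j 1))"

text \<open>The representative of \<open>n\<close> modulo \<open>b\<close> in \<open>{1..b}\<close>.\<close>

definition cyc :: "nat \<Rightarrow> nat \<Rightarrow> nat" where
  "cyc b n = (if n mod b = 0 then b else n mod b)"

definition cyclic_shift :: "nat \<Rightarrow> 'a star_alg \<Rightarrow> nat \<times> nat \<Rightarrow> 'a" where
  "cyclic_shift b U = (\<lambda>(i, j)\<in>{1..b} \<times> {1..b}. if j = cyc b (i + 1) then \<one>\<^bsub>U\<^esub> else \<zero>\<^bsub>U\<^esub>)"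

definition diagonal_matrix :: "nat \<Rightarrow> 'a star_alg \<Rightarrow> (nat \<Rightarrow> 'a) \<Rightarrow> nat \<times> nat \<Rightarrow> 'a" where
  "diagonal_matrix b U d = (\<lambda>(i, j)\<in>{1..b} \<times> {1..b}. if i = j then d i else \<zero>\<^bsub>U\<^esub>)"

definition diagonal_part ::
  "nat \<Rightarrow> 'a star_alg \<Rightarrow> (nat \<times> nat \<Rightarrow> 'a) \<Rightarrow> nat \<Rightarrow> nat \<times> nat \<Rightarrow> 'a" where
  "diagonal_part b U u k =
     diagonal_matrix b U (\<lambda>i. u (cyc b (k + i), i))
       \<otimes>\<^bsub>matrix_algebra b U\<^esub> (cyclic_shift b U [^]\<^bsub>matrix_algebra b U\<^esub> k)"

definition transpose_matrix :: "nat \<Rightarrow> (nat \<times> nat \<Rightarrow> 'a) \<Rightarrow> nat \<times> nat \<Rightarrow> 'a" where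
  "transpose_matrix b u = (\<lambda>(i, j)\<in>{1..b} \<times> {1..b}. u (j, i))"

lemma cyc_in: "b \<ge> 1 \<Longrightarrow> cyc b n \<in> {1..b}"
  using mod_less_divisor[of b n] by (auto simp: cyc_def simp del: mod_less_divisor)

lemma cyc_eq_iff: "b \<ge> 1 \<Longrightarrow> j \<in> {1..b} \<Longrightarrow> j = cyc b n \<longleftrightarrow> j mod b = n mod b"
  using mod_less_divisor[of b n] by (cases "j = b") (auto simp: cyc_def simp del: mod_less_divisor)

lemma cyc_mod: "cyc b n mod b = n mod b"
  by (simp add: cyc_def)

lemma cyc_add: "cyc b (cyc b m + n) = cyc b (m + n)"
proof -
  have "(cyc b m + n) mod b = (m + n) mod b"
    by (metis cyc_mod mod_add_left_eq)
  then show ?thesis by (simp add: cyc_def)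
qed

lemma abelian_monoid_matrix_algebra:
  assumes "Ring.ring U"
  shows "abelian_monoid (matrix_algebra b U)"
proof -
  interpret U: Ring.ring U by fact
  show ?thesis
  proof (rule abelian_monoidI)
    fix x y z
    assume "x \<in> carrier (matrix_algebra b U)" "y \<in> carrier (matrix_algebra b U)"
      "z \<in> carrier (matrix_algebra b U)"
    then show "x \<oplus>\<^bsub>matrix_algebra b U\<^esub> y \<oplus>\<^bsub>matrix_algebra b U\<^esub> z
        = x \<oplus>\<^bsub>matrix_algebra b U\<^esub> (y \<oplus>\<^bsub>matrix_algebra b U\<^esub> z)"
      by (auto simp: matrix_algebra_def U.a_assoc PiE_iff intro!: restrict_ext)
  next
    fix x y
    assume "x \<in> carrier (matrix_algebra b U)" "y \<in> carrier (matrix_algebra b U)"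
    then show "x \<oplus>\<^bsub>matrix_algebra b U\<^esub> y = y \<oplus>\<^bsub>matrix_algebra b U\<^esub> x"
      by (auto simp: matrix_algebra_def U.a_comm PiE_iff intro!: restrict_ext)
  next
    fix x
    assume x: "x \<in> carrier (matrix_algebra b U)"
    show "\<zero>\<^bsub>matrix_algebra b U\<^esub> \<oplus>\<^bsub>matrix_algebra b U\<^esub> x = x"
    proof
      fix p
      show "(\<zero>\<^bsub>matrix_algebra b U\<^esub> \<oplus>\<^bsub>matrix_algebra b U\<^esub> x) p = x p"
      proof (cases "p \<in> {1..b} \<times> {1..b}")
        case True
        then have "x p \<in> carrier U"
          using x by (auto simp: matrix_algebra_def)
        then show ?thesis using True by (simp add: matrix_algebra_def)
      next
        case False
        then have "x p = undefined"
          using x PiE_arb[of x "{1..b} \<times> {1..b}" "\<lambda>_. carrier U" p] by (simp add: matrix_algebra_def)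
        then show ?thesis using False by (simp add: matrix_algebra_def)
      qed
    qed
  qed (auto simp: matrix_algebra_def PiE_iff)
qed

lemma finsum_matrix_algebra:
  assumes "Ring.ring U" "finite K" "f \<in> K \<rightarrow> carrier (matrix_algebra b U)"
  shows "(\<Oplus>\<^bsub>matrix_algebra b U\<^esub>k\<in>K. f k) = (\<lambda>p\<in>{1..b} \<times> {1..b}. \<Oplus>\<^bsub>U\<^esub>k\<in>K. f k p)"
proof -
  interpret U: Ring.ring U by fact
  interpret M: abelian_monoid "matrix_algebra b U"
    using assms(1) by (rule abelian_monoid_matrix_algebra)
  show ?thesis
    using assms(2,3)
  proof (induction K rule: finite_induct)
    case empty
    have "(\<Oplus>\<^bsub>matrix_algebra b U\<^esub>k\<in>{}. f k) = \<zero>\<^bsub>matrix_algebra b U\<^esub>"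
      by (rule M.finsum_empty)
    then show ?case unfolding U.finsum_empty by (simp add: matrix_algebra_def)
  next
    case (insert k K)
    have f: "f l p \<in> carrier U" if "l \<in> insert k K" "p \<in> {1..b} \<times> {1..b}" for l p
    proof -
      have "f l \<in> {1..b} \<times> {1..b} \<rightarrow>\<^sub>E carrier U"
        using insert.prems that(1) by (auto simp: matrix_algebra_def)
      then show ?thesis using that(2) by blast
    qed
    have "(\<Oplus>\<^bsub>matrix_algebra b U\<^esub>l\<in>insert k K. f l)
        = f k \<oplus>\<^bsub>matrix_algebra b U\<^esub> (\<Oplus>\<^bsub>matrix_algebra b U\<^esub>l\<in>K. f l)"
      using insert by (intro M.finsum_insert) auto
    also have "\<dots> = f k \<oplus>\<^bsub>matrix_algebra b U\<^esub> (\<lambda>p\<in>{1..b} \<times> {1..b}. \<Oplus>\<^bsub>U\<^esub>l\<in>K. f l p)"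
    proof -
      have "f \<in> K \<rightarrow> carrier (matrix_algebra b U)" using insert.prems by blast
      then show ?thesis by (simp only: insert.IH)
    qed
    also have "\<dots> = (\<lambda>p\<in>{1..b} \<times> {1..b}. f k p \<oplus>\<^bsub>U\<^esub> (\<Oplus>\<^bsub>U\<^esub>l\<in>K. f l p))"
      by (auto simp: matrix_algebra_def intro!: restrict_ext)
    also have "\<dots> = (\<lambda>p\<in>{1..b} \<times> {1..b}. \<Oplus>\<^bsub>U\<^esub>l\<in>insert k K. f l p)"
    proof (rule restrict_ext)
      fix p assume p: "p \<in> {1..b} \<times> {1..b}"
      show "f k p \<oplus>\<^bsub>U\<^esub> (\<Oplus>\<^bsub>U\<^esub>l\<in>K. f l p) = (\<Oplus>\<^bsub>U\<^esub>l\<in>insert k K. f l p)"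
        using insert(1,2) f p by (intro U.finsum_insert[symmetric]) auto
    qed
    finally show ?case .
  qed
qed

lemma cyclic_shift_pow:
  assumes "Ring.ring U" "b \<ge> 1"
  shows "cyclic_shift b U [^]\<^bsub>matrix_algebra b U\<^esub> k =
    (\<lambda>(i, j)\<in>{1..b} \<times> {1..b}. if j = cyc b (i + k) then \<one>\<^bsub>U\<^esub> else \<zero>\<^bsub>U\<^esub>)"
proof -
  interpret U: Ring.ring U by fact
  show ?thesis
  proof (induction k)
    case 0
    have "i = j \<longleftrightarrow> j = cyc b i" if "i \<in> {1..b}" "j \<in> {1..b}" for i j
      using that by (cases "i = b") (auto simp: cyc_def)
    then show ?case
      by (auto simp: matrix_algebra_def nat_pow_def intro!: restrict_ext)
  next
    case (Suc k)
    have entry: "(\<Oplus>\<^bsub>U\<^esub>l\<in>{1..b}. (if l = cyc b (i + k) then \<one>\<^bsub>U\<^esub> else \<zero>\<^bsub>U\<^esub>) \<otimes>\<^bsub>U\<^esub>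
          (if j = cyc b (l + 1) then \<one>\<^bsub>U\<^esub> else \<zero>\<^bsub>U\<^esub>))
        = (if j = cyc b (i + Suc k) then \<one>\<^bsub>U\<^esub> else \<zero>\<^bsub>U\<^esub>)" for i j
    proof -
      have "(\<Oplus>\<^bsub>U\<^esub>l\<in>{1..b}. (if l = cyc b (i + k) then \<one>\<^bsub>U\<^esub> else \<zero>\<^bsub>U\<^esub>) \<otimes>\<^bsub>U\<^esub>
            (if j = cyc b (l + 1) then \<one>\<^bsub>U\<^esub> else \<zero>\<^bsub>U\<^esub>))
          = (\<Oplus>\<^bsub>U\<^esub>l\<in>{1..b}. if cyc b (i + k) = l
              then (if j = cyc b (l + 1) then \<one>\<^bsub>U\<^esub> else \<zero>\<^bsub>U\<^esub>) else \<zero>\<^bsub>U\<^esub>)"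
        by (rule U.finsum_cong') auto
      also have "\<dots> = (if j = cyc b (cyc b (i + k) + 1) then \<one>\<^bsub>U\<^esub> else \<zero>\<^bsub>U\<^esub>)"
        using cyc_in[OF assms(2)] by (intro U.finsum_singleton) auto
      also have "cyc b (cyc b (i + k) + 1) = cyc b (i + Suc k)"
        using cyc_add[of b "i + k" 1] by simp
      finally show ?thesis .
    qed
    have "cyclic_shift b U [^]\<^bsub>matrix_algebra b U\<^esub> Suc k =
      (\<lambda>(i, j)\<in>{1..b} \<times> {1..b}. if j = cyc b (i + k) then \<one>\<^bsub>U\<^esub> else \<zero>\<^bsub>U\<^esub>)
        \<otimes>\<^bsub>matrix_algebra b U\<^esub> cyclic_shift b U"
      unfolding Suc[symmetric] by (simp add: nat_pow_def)
    also have "\<dots> = (\<lambda>(i, j)\<in>{1..b} \<times> {1..b}.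
       \<Oplus>\<^bsub>U\<^esub>l\<in>{1..b}. (if l = cyc b (i + k) then \<one>\<^bsub>U\<^esub> else \<zero>\<^bsub>U\<^esub>) \<otimes>\<^bsub>U\<^esub>
          (if j = cyc b (l + 1) then \<one>\<^bsub>U\<^esub> else \<zero>\<^bsub>U\<^esub>))"
      unfolding matrix_algebra_def cyclic_shift_def
      by (auto intro!: restrict_ext U.finsum_cong')
    finally show ?case by (simp only: entry)
  qed
qed

lemma diagonal_part_eq:
  assumes "Ring.ring U" "b \<ge> 1" "u \<in> carrier (matrix_algebra b U)"
  shows "diagonal_part b U u k =
    (\<lambda>(i, j)\<in>{1..b} \<times> {1..b}. if j = cyc b (i + k) then u (j, i) else \<zero>\<^bsub>U\<^esub>)"
proof -
  interpret U: Ring.ring U by fact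
  have u: "u (cyc b n, i) \<in> carrier U" if "i \<in> {1..b}" for n i
  proof -
    have "u \<in> {1..b} \<times> {1..b} \<rightarrow>\<^sub>E carrier U"
      using assms(3) by (simp add: matrix_algebra_def)
    then show ?thesis using that cyc_in[OF assms(2)] by blast
  qed
  have "diagonal_part b U u k = (\<lambda>(i, j)\<in>{1..b} \<times> {1..b}.
      \<Oplus>\<^bsub>U\<^esub>l\<in>{1..b}. if i = l then u (cyc b (k + i), i) \<otimes>\<^bsub>U\<^esub>
        (if j = cyc b (l + k) then \<one>\<^bsub>U\<^esub> else \<zero>\<^bsub>U\<^esub>) else \<zero>\<^bsub>U\<^esub>)"
    unfolding diagonal_part_def cyclic_shift_pow[OF assms(1,2)]
    unfolding matrix_algebra_def diagonal_matrix_def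
    by (auto intro!: restrict_ext U.finsum_cong' simp: u)
  also have "\<dots> = (\<lambda>(i, j)\<in>{1..b} \<times> {1..b}. u (cyc b (k + i), i) \<otimes>\<^bsub>U\<^esub>
        (if j = cyc b (i + k) then \<one>\<^bsub>U\<^esub> else \<zero>\<^bsub>U\<^esub>))"
  proof (rule restrict_ext, clarify)
    fix i j assume i: "i \<in> {1..b}"
    show "(\<Oplus>\<^bsub>U\<^esub>l\<in>{1..b}. if i = l then u (cyc b (k + i), i) \<otimes>\<^bsub>U\<^esub>
        (if j = cyc b (l + k) then \<one>\<^bsub>U\<^esub> else \<zero>\<^bsub>U\<^esub>) else \<zero>\<^bsub>U\<^esub>)
      = u (cyc b (k + i), i) \<otimes>\<^bsub>U\<^esub> (if j = cyc b (i + k) then \<one>\<^bsub>U\<^esub> else \<zero>\<^bsub>U\<^esub>)"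
      using i u[OF i] by (intro U.finsum_singleton) auto
  qed
  also have "\<dots> = (\<lambda>(i, j)\<in>{1..b} \<times> {1..b}. if j = cyc b (i + k) then u (j, i) else \<zero>\<^bsub>U\<^esub>)"
    using u by (auto intro!: restrict_ext simp: add.commute)
  finally show ?thesis .
qed

lemma transpose_eq_sum_diagonal_parts:
  assumes "Ring.ring U" "b \<ge> 1" "u \<in> carrier (matrix_algebra b U)"
  shows "transpose_matrix b u = (\<Oplus>\<^bsub>matrix_algebra b U\<^esub>k\<in>{..<b}. diagonal_part b U u k)"
proof -
  interpret U: Ring.ring U by fact
  have u: "u (j, i) \<in> carrier U" if "i \<in> {1..b}" "j \<in> {1..b}" for i j
  proof -
    have "u \<in> {1..b} \<times> {1..b} \<rightarrow>\<^sub>E carrier U"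
      using assms(3) by (simp add: matrix_algebra_def)
    then show ?thesis using that by blast
  qed
  have "diagonal_part b U u k \<in> carrier (matrix_algebra b U)" for k
    unfolding diagonal_part_eq[OF assms] by (auto simp: matrix_algebra_def u)
  then have "(\<Oplus>\<^bsub>matrix_algebra b U\<^esub>k\<in>{..<b}. diagonal_part b U u k)
      = (\<lambda>p\<in>{1..b} \<times> {1..b}. \<Oplus>\<^bsub>U\<^esub>k\<in>{..<b}. diagonal_part b U u k p)"
    by (intro finsum_matrix_algebra[OF assms(1)]) auto
  also have "\<dots> = transpose_matrix b u"
    unfolding transpose_matrix_def
  proof (rule restrict_ext, clarify)
    fix i j assume i: "i \<in> {1..b}" and j: "j \<in> {1..b}"
    define k where "k = (j + (b - i)) mod b"
    have k: "k < b" using assms(2) by (simp add: k_def)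
    have *: "j = cyc b (i + l) \<longleftrightarrow> k = l" if l: "l < b" for l
    proof -
      have "k = l \<longleftrightarrow> (j + (b - i)) mod b = l mod b" using l by (simp add: k_def)
      also have "\<dots> \<longleftrightarrow> (int j + (int b - int i)) mod int b = int l mod int b"
        using i by (metis (no_types, lifting) atLeastAtMost_iff of_nat_add of_nat_diff of_nat_eq_iff zmod_int)
      also have "\<dots> \<longleftrightarrow> int j mod int b = (int i + int l) mod int b"
        by (simp add: mod_eq_dvd_iff algebra_simps)
           (metis (no_types, lifting) add.commute add_diff_eq diff_diff_eq2 dvd_add_triv_right_iff)
      also have "\<dots> \<longleftrightarrow> j mod b = (i + l) mod b"
        by (metis of_nat_add of_nat_eq_iff zmod_int)
      finally show ?thesis using cyc_eq_iff[OF assms(2) j] by simp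
    qed
    have "(\<Oplus>\<^bsub>U\<^esub>l\<in>{..<b}. diagonal_part b U u l (i, j))
        = (\<Oplus>\<^bsub>U\<^esub>l\<in>{..<b}. if k = l then u (j, i) else \<zero>\<^bsub>U\<^esub>)"
      unfolding diagonal_part_eq[OF assms] using i j u * by (intro U.finsum_cong') auto
    also have "\<dots> = u (j, i)"
      using k u[OF i j] by (intro U.finsum_singleton) auto
    finally show "(\<Oplus>\<^bsub>U\<^esub>l\<in>{..<b}. diagonal_part b U u l (i, j)) = u (j, i)" .
  qed
  finally show ?thesis by simp
qed

end

theory Submission
  imports Defs
begin

text \<open>Under the identification of \<open>M\<^sub>b(U)\<close> with the free product \<open>A\<close>, the \<open>k\<close>-th diagonal part of \<open>v\<^sup>t\<close> is
  \<open>x = \<Sum>\<^sub>i e\<^bsub>i,i+k\<^esub> v e\<^bsub>i,i+k\<^esub>\<close>. Expanding a word in \<open>x, x\<^sup>*\<close> and splitting the diagonal matrix units between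
  \<open>v\<close> and \<open>v\<^sup>*\<close> into a trace-zero part and a multiple of \<open>1\<close> (after which \<open>v v\<^sup>* = 1\<close> cancels) writes it
  as a combination of elements \<open>Y\<^sub>s\<close> (\<open>stack_sum\<close> below), sums of reduced words of the free product indexed by a stack
  \<open>s\<close> of signs. Between factors belonging to different \<open>k\<close> only off-diagonal matrix units appear next
  to a sign change, and these are trace-zero already; this gives *-freeness.

  Multiplication of \<open>Y\<^sub>s\<close> by a letter pushes it on the stack, plus, if it is opposite to the top,
  \<open>\<lambda> = 1/b\<close> or \<open>\<lambda>(1 - \<lambda>)\<close> times the popped stack. So the *-moments of \<open>x\<close> are sums over weighted
  excursions. The functional with alternating cumulants \<open>\<alpha>\<^sub>m\<close>, \<open>\<alpha>(t) = \<lambda> - \<lambda> t \<alpha>(t)\<^sup>2\<close>, and no others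
  obeys the same push-pop recursion, by comparing generating series over the words in two
  noncommuting letters; hence these are the free cumulants of \<open>x\<close>.\<close>

section \<open>Sums over noncrossing partitions\<close>

text \<open>As \<open>free_cumulant\<close> is recursive, the unwanted cumulants cannot be seen to
  vanish word by word: all cumulants are guessed, and the moment-cumulant formula is checked on
  every word (\<open>free_cumulant_eq\<close>). The guess is
  \<open>\<alpha>_m = (-1)^m C_m \<lambda>^(2m+1)\<close> with the Catalan numbers
  \<open>C_m\<close>. For \<open>\<lambda> = 1\<close> these are the cumulants of a Haar unitary,
  which is \<open>x\<close> itself if \<open>b = 1\<close>. They alternate in sign while the weights
  of the excursions are nonnegative, so the two sums do not match term by term; hence the comparison
  of series. Splitting off the block of the first letter gives one equation between the moment
  series and the excursion series, the equation of \<open>\<alpha>\<close> gives a second, and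
  eliminating the moment series leaves the first-step equation of the stack walk. The factor
  \<open>1 - \<lambda>\<close> appears when the popped letter was separated from the one below by a
  centered diagonal unit: \<open>(e_jj - \<lambda>) e_jl = (1 - \<lambda>) e_jl\<close>. The moments
  do not depend on \<open>k\<close>; freeness depends only on \<open>k - l\<close> being nonzero
  modulo \<open>b\<close>.\<close>

definition NC :: "nat set \<Rightarrow> nat set set set" where
  "NC S = {P. partition_on S P \<and>
     \<not> (\<exists>V\<in>P. \<exists>W\<in>P. \<exists>p q r s. V \<noteq> W \<and> p < q \<and> q < r \<and> r < s \<and>
          p \<in> V \<and> q \<in> W \<and> r \<in> V \<and> s \<in> W)}"

definition ncsum :: "(nat set \<Rightarrow> complex) \<Rightarrow> nat set \<Rightarrow> complex" where
  "ncsum f S = (\<Sum>P\<in>NC S. \<Prod>V\<in>P. f V)"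

text \<open>The partitions with a block containing \<open>V\<close>. With \<open>V\<close> to the left of \<open>R\<close>, this is a block under
  construction while the elements of \<open>R\<close> are still to be distributed.\<close>

definition NC_above :: "nat set \<Rightarrow> nat set \<Rightarrow> nat set set set" where
  "NC_above V R = {P \<in> NC (V \<union> R). \<exists>B\<in>P. V \<subseteq> B}"

lemma NC_partition: "P \<in> NC S \<Longrightarrow> partition_on S P"
  by (simp add: NC_def)

lemma NC_subset: "P \<in> NC S \<Longrightarrow> W \<in> P \<Longrightarrow> W \<subseteq> S"
  using partition_onD1[OF NC_partition] by blast

lemma NC_nonempty: "P \<in> NC S \<Longrightarrow> W \<in> P \<Longrightarrow> W \<noteq> {}"
  using partition_onD3[OF NC_partition] by blast

lemma NC_eqI: "P \<in> NC S \<Longrightarrow> V \<in> P \<Longrightarrow> W \<in> P \<Longrightarrow> x \<in> V \<Longrightarrow> x \<in> W \<Longrightarrow> V = W"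
  using disjointD[OF partition_onD2[OF NC_partition]] by blast

lemma finite_NC: "finite S \<Longrightarrow> finite (NC S)"
  by (rule finite_subset[of _ "Pow (Pow S)"]) (auto dest: NC_subset)

lemma finite_NC_elem: "finite S \<Longrightarrow> P \<in> NC S \<Longrightarrow> finite P"
  by (rule finite_subset[of _ "Pow S"]) (auto dest: NC_subset)

lemma NC_crossingD:
  assumes "P \<in> NC S" "V \<in> P" "W \<in> P" "p \<in> V" "q \<in> W" "r \<in> V" "s \<in> W" "p < q" "q < r" "r < s"
  shows "V = W"
  using assms unfolding NC_def by blast

lemma NC_I:
  assumes "partition_on S P"
    and "\<And>V W p q r s. V \<in> P \<Longrightarrow> W \<in> P \<Longrightarrow> p \<in> V \<Longrightarrow> q \<in> W \<Longrightarrow> r \<in> V \<Longrightarrow> s \<in> W \<Longrightarrow>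
      p < q \<Longrightarrow> q < r \<Longrightarrow> r < s \<Longrightarrow> V = W"
  shows "P \<in> NC S"
  unfolding NC_def using assms by blast

lemma NC_Un:
  assumes "S1 \<inter> S2 = {}" and convex: "\<forall>a\<in>S1. \<forall>c\<in>S1. \<forall>x\<in>S2. \<not> (a < x \<and> x < c)"
    and P1: "P1 \<in> NC S1" and P2: "P2 \<in> NC S2"
  shows "P1 \<union> P2 \<in> NC (S1 \<union> S2)"
proof (rule NC_I)
  show "partition_on (S1 \<union> S2) (P1 \<union> P2)"
  proof (rule partition_onI)
    show "\<Union> (P1 \<union> P2) = S1 \<union> S2"
      using partition_onD1[OF NC_partition[OF P1]] partition_onD1[OF NC_partition[OF P2]] by blast
    show "{} \<notin> P1 \<union> P2"
      using NC_nonempty[OF P1] NC_nonempty[OF P2] by blast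
    show "disjnt p q" if "p \<in> P1 \<union> P2" "q \<in> P1 \<union> P2" "p \<noteq> q" for p q
      using that NC_eqI[OF P1, of p q] NC_eqI[OF P2, of p q] NC_subset[OF P1] NC_subset[OF P2] assms(1)
      unfolding disjnt_def by blast
  qed
next
  fix V W p q r s
  assume VW: "V \<in> P1 \<union> P2" "W \<in> P1 \<union> P2"
    and el: "p \<in> V" "q \<in> W" "r \<in> V" "s \<in> W" "p < q" "q < r" "r < s"
  consider "V \<in> P1" "W \<in> P1" | "V \<in> P2" "W \<in> P2" | "V \<in> P1" "W \<in> P2" | "V \<in> P2" "W \<in> P1"
    using VW by blast
  then show "V = W"
  proof cases
    case 1
    then show ?thesis using NC_crossingD[OF P1] el by blast
  next
    case 2
    then show ?thesis using NC_crossingD[OF P2] el by blast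
  next
    case 3
    then show ?thesis using convex NC_subset[OF P1] NC_subset[OF P2] el by blast
  next
    case 4
    then show ?thesis using convex NC_subset[OF P1] NC_subset[OF P2] el by blast
  qed
qed

lemma NC_restrict:
  assumes P: "P \<in> NC (S1 \<union> S2)" and "S1 \<inter> S2 = {}" and "\<And>W. W \<in> P \<Longrightarrow> W \<subseteq> S1 \<or> W \<subseteq> S2"
  shows "{W \<in> P. W \<subseteq> S1} \<in> NC S1"
proof (rule NC_I)
  have *: "x \<in> \<Union> {W \<in> P. W \<subseteq> S1}" if x: "x \<in> S1" for x
  proof -
    obtain W where W: "W \<in> P" "x \<in> W"
      using partition_onD1[OF NC_partition[OF P]] x by blast
    then have "W \<subseteq> S1" using assms(2,3) x by blast
    then show ?thesis using W by blast
  qed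
  show "partition_on S1 {W \<in> P. W \<subseteq> S1}"
  proof (rule partition_onI)
    show "\<Union> {W \<in> P. W \<subseteq> S1} = S1" using * by blast
    show "disjnt p q" if "p \<in> {W \<in> P. W \<subseteq> S1}" "q \<in> {W \<in> P. W \<subseteq> S1}" "p \<noteq> q" for p q
      using that NC_eqI[OF P] by (auto simp: disjnt_def)
    show "{} \<notin> {W \<in> P. W \<subseteq> S1}"
      using NC_nonempty[OF P] by auto
  qed
next
  fix V W p q r s
  assume "V \<in> {W \<in> P. W \<subseteq> S1}" "W \<in> {W \<in> P. W \<subseteq> S1}"
    and el: "p \<in> V" "q \<in> W" "r \<in> V" "s \<in> W" "p < q" "q < r" "r < s"
  then show "V = W" using NC_crossingD[OF P] by blast
qed

text \<open>No point of \<open>S2\<close> separates two points of \<open>S1\<close>, so partitions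
  of the two sets combine without crossing, and a partition of the union that contains one of
  \<open>S2\<close> restricts to \<open>S1\<close>. The family \<open>G\<close> is general because
  it serves both for \<open>{{V}}\<close> and for \<open>NC_above\<close>.\<close>

lemma sum_NC_split:
  assumes fin: "finite S1" "finite S2" and dis: "S1 \<inter> S2 = {}"
    and convex: "\<forall>a\<in>S1. \<forall>c\<in>S1. \<forall>x\<in>S2. \<not> (a < x \<and> x < c)"
    and G: "G \<subseteq> NC S2"
  shows "(\<Sum>P | P \<in> NC (S1 \<union> S2) \<and> (\<exists>P2\<in>G. P2 \<subseteq> P). \<Prod>V\<in>P. f V)
    = ncsum f S1 * (\<Sum>P\<in>G. \<Prod>V\<in>P. f V)"
proof -
  have sub: "W \<subseteq> S1" if "P1 \<in> NC S1" "W \<in> P1" for P1 W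
    using NC_subset that by blast
  have sub2: "W \<subseteq> S2" "W \<noteq> {}" if "P2 \<in> G" "W \<in> P2" for P2 W
    using NC_subset NC_nonempty G that by blast+
  have not2: "\<not> W \<subseteq> S1" if "P2 \<in> G" "W \<in> P2" for P2 W
    using sub2[OF that] dis by blast
  have disj: "P1 \<inter> P2 = {}" if "P1 \<in> NC S1" "P2 \<in> G" for P1 P2
    using sub[OF that(1)] not2[OF that(2)] by blast
  have "inj_on (\<lambda>(P1, P2). P1 \<union> P2) (NC S1 \<times> G)"
  proof (rule inj_onI)
    fix p q
    assume pq: "p \<in> NC S1 \<times> G" "q \<in> NC S1 \<times> G"
      "(\<lambda>(P1, P2). P1 \<union> P2) p = (\<lambda>(P1, P2). P1 \<union> P2) q"
    obtain P1 P2 Q1 Q2 where p: "p = (P1, P2)" and q: "q = (Q1, Q2)"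
      by (cases p, cases q) simp
    have a: "P1 \<in> NC S1" "P2 \<in> G" "Q1 \<in> NC S1" "Q2 \<in> G" and e: "P1 \<union> P2 = Q1 \<union> Q2"
      using pq by (simp_all add: p q)
    have "P1 \<inter> Q2 = {}" "Q1 \<inter> P2 = {}" "P1 \<inter> P2 = {}" "Q1 \<inter> Q2 = {}"
      using disj a by simp_all
    then have "P1 = Q1" "P2 = Q2" using e by blast+
    then show "p = q" by (simp add: p q)
  qed
  moreover have "(\<lambda>(P1, P2). P1 \<union> P2) ` (NC S1 \<times> G) =
      {P. P \<in> NC (S1 \<union> S2) \<and> (\<exists>P2\<in>G. P2 \<subseteq> P)}"
  proof (intro equalityI subsetI)
    fix P assume "P \<in> (\<lambda>(P1, P2). P1 \<union> P2) ` (NC S1 \<times> G)"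
    then obtain P1 P2 where P: "P1 \<in> NC S1" "P2 \<in> G" "P = P1 \<union> P2" by auto
    then have "P \<in> NC (S1 \<union> S2)"
      using NC_Un[OF dis convex P(1) subsetD[OF G P(2)]] by blast
    then show "P \<in> {P. P \<in> NC (S1 \<union> S2) \<and> (\<exists>P2\<in>G. P2 \<subseteq> P)}" using P by blast
  next
    fix P assume "P \<in> {P. P \<in> NC (S1 \<union> S2) \<and> (\<exists>P2\<in>G. P2 \<subseteq> P)}"
    then obtain P2 where P: "P \<in> NC (S1 \<union> S2)" "P2 \<in> G" "P2 \<subseteq> P" by blast
    have U2: "\<Union>P2 = S2"
      using P(2) G NC_partition[of P2 S2] partition_onD1 by blast
    have blocks: "W \<subseteq> S1" if "W \<in> P" "W \<notin> P2" for W
    proof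
      fix x assume x: "x \<in> W"
      have "x \<notin> S2"
      proof
        assume "x \<in> S2"
        then obtain W' where "W' \<in> P2" "x \<in> W'" using U2 by blast
        then have "W' = W" using NC_eqI[OF P(1)] x that(1) P(3) by blast
        then show False using \<open>W' \<in> P2\<close> that(2) by simp
      qed
      then show "x \<in> S1" using NC_subset[OF P(1) that(1)] x by blast
    qed
    have "{W \<in> P. W \<subseteq> S1} \<in> NC S1"
      by (rule NC_restrict[OF P(1) dis]) (use blocks sub2[OF P(2)] in blast)
    moreover have "P = {W \<in> P. W \<subseteq> S1} \<union> P2"
      using blocks P(3) by blast
    ultimately show "P \<in> (\<lambda>(P1, P2). P1 \<union> P2) ` (NC S1 \<times> G)" using P(2) by blast
  qed
  ultimately have bij: "bij_betw (\<lambda>(P1, P2). P1 \<union> P2) (NC S1 \<times> G)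
      {P. P \<in> NC (S1 \<union> S2) \<and> (\<exists>P2\<in>G. P2 \<subseteq> P)}"
    by (simp add: bij_betw_def)
  have "(\<Sum>P | P \<in> NC (S1 \<union> S2) \<and> (\<exists>P2\<in>G. P2 \<subseteq> P). \<Prod>V\<in>P. f V)
      = (\<Sum>(P1, P2)\<in>NC S1 \<times> G. \<Prod>V\<in>P1 \<union> P2. f V)"
    by (subst sum.reindex_bij_betw[OF bij, symmetric]) (simp add: case_prod_unfold)
  also have "\<dots> = (\<Sum>(P1, P2)\<in>NC S1 \<times> G. (\<Prod>V\<in>P1. f V) * (\<Prod>V\<in>P2. f V))"
  proof (rule sum.cong[OF refl])
    fix p assume "p \<in> NC S1 \<times> G"
    then obtain P1 P2 where p: "p = (P1, P2)" and a: "P1 \<in> NC S1" "P2 \<in> G" by blast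
    then have "(\<Prod>V\<in>P1 \<union> P2. f V) = (\<Prod>V\<in>P1. f V) * (\<Prod>V\<in>P2. f V)"
      using G by (intro prod.union_disjoint disj finite_NC_elem[OF fin(1)] finite_NC_elem[OF fin(2)]) auto
    then show "(case p of (P1, P2) \<Rightarrow> \<Prod>V\<in>P1 \<union> P2. f V) =
        (case p of (P1, P2) \<Rightarrow> (\<Prod>V\<in>P1. f V) * (\<Prod>V\<in>P2. f V))"
      by (simp add: p)
  qed
  also have "\<dots> = ncsum f S1 * (\<Sum>P\<in>G. \<Prod>V\<in>P. f V)"
    by (simp add: ncsum_def sum_product sum.cartesian_product)
  finally show ?thesis .
qed

text \<open>The block over \<open>V\<close> either stops or has a next element \<open>j\<close>. In
  the second case the points of \<open>R\<close> below \<open>j\<close> lie under the arc from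
  \<open>V\<close> to \<open>j\<close>, cannot reach past it, and decouple. By this recursion blocks
  are built one letter at a time.\<close>

lemma sum_NC_above:
  assumes fin: "finite V" "finite R" and V: "V \<noteq> {}" and less: "\<And>v r. v \<in> V \<Longrightarrow> r \<in> R \<Longrightarrow> v < r"
  shows "(\<Sum>P\<in>NC_above V R. \<Prod>B\<in>P. f B) = f V * ncsum f R +
    (\<Sum>j\<in>R. ncsum f {r \<in> R. r < j} * (\<Sum>P\<in>NC_above (insert j V) {r \<in> R. j < r}. \<Prod>B\<in>P. f B))"
proof -
  define G where "G j = {P \<in> NC (V \<union> R). \<exists>P2\<in>NC_above (insert j V) {r \<in> R. j < r}. P2 \<subseteq> P}" for j
  define G0 where "G0 = {P \<in> NC (V \<union> R). V \<in> P}"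
  have dis: "R \<inter> V = {}" using less by blast
  have finU: "finite (V \<union> R)" using fin by simp
  have Xblock: "\<exists>B\<in>P. insert j V \<subseteq> B \<and> (\<forall>r\<in>R. r < j \<longrightarrow> r \<notin> B)" if P: "P \<in> G j" "j \<in> R" for P j
  proof -
    obtain P2 B where B: "P2 \<in> NC (insert j V \<union> {r \<in> R. j < r})" "P2 \<subseteq> P" "B \<in> P2" "insert j V \<subseteq> B"
      using P(1) unfolding G_def NC_above_def by blast
    have "B \<subseteq> insert j V \<union> {r \<in> R. j < r}" using NC_subset[OF B(1,3)] .
    then have "\<forall>r\<in>R. r < j \<longrightarrow> r \<notin> B" using less by fastforce
    then show ?thesis using B by blast
  qed
  have XNC: "P \<in> NC (V \<union> R)" if "P \<in> G j" for P j using that by (simp add: G_def)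
  have Vin: "\<exists>v. v \<in> V" using V by blast
  have disj: "G j \<inter> G k = {}" if jk: "j \<in> R" "k \<in> R" "j \<noteq> k" for j k
  proof (rule ccontr)
    assume "G j \<inter> G k \<noteq> {}"
    then obtain P where P: "P \<in> G j" "P \<in> G k" by blast
    obtain B where B: "B \<in> P" "insert j V \<subseteq> B" "\<forall>r\<in>R. r < j \<longrightarrow> r \<notin> B" using Xblock[OF P(1) jk(1)] by blast
    obtain C where C: "C \<in> P" "insert k V \<subseteq> C" "\<forall>r\<in>R. r < k \<longrightarrow> r \<notin> C" using Xblock[OF P(2) jk(2)] by blast
    have "B = C" using NC_eqI[OF XNC[OF P(1)] B(1) C(1)] Vin B(2) C(2) by blast
    then show False using B C jk by (metis insert_subset linorder_neqE_nat)
  qed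
  have disj0: "G0 \<inter> (\<Union>j\<in>R. G j) = {}"
  proof (rule ccontr)
    assume "G0 \<inter> (\<Union>j\<in>R. G j) \<noteq> {}"
    then obtain P j where P: "P \<in> G0" "P \<in> G j" "j \<in> R" by blast
    obtain B where B: "B \<in> P" "insert j V \<subseteq> B" using Xblock[OF P(2,3)] by blast
    have "B = V" using NC_eqI[OF XNC[OF P(2)] B(1), of V] P(1) Vin B(2) by (auto simp: G0_def)
    then show False using B(2) P(3) less by blast
  qed
  have split: "NC_above V R = G0 \<union> (\<Union>j\<in>R. G j)"
  proof (intro equalityI subsetI)
    fix P assume "P \<in> NC_above V R"
    then obtain B where P: "P \<in> NC (V \<union> R)" and B: "B \<in> P" "V \<subseteq> B" by (auto simp: NC_above_def)
    have BU: "B \<subseteq> V \<union> R" using NC_subset[OF P B(1)] .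
    show "P \<in> G0 \<union> (\<Union>j\<in>R. G j)"
    proof (cases "B \<inter> R = {}")
      case True
      then have "B = V" using B(2) BU by blast
      then show ?thesis using P B(1) by (simp add: G0_def)
    next
      case False
      define j where "j = Min (B \<inter> R)"
      have j: "j \<in> B" "j \<in> R" and jmin: "\<And>r. r \<in> B \<Longrightarrow> r \<in> R \<Longrightarrow> j \<le> r"
        using Min_in[of "B \<inter> R"] False fin(2) Min_le[of "B \<inter> R"] by (auto simp: j_def)
      let ?S1 = "{r \<in> R. r < j}" and ?S2 = "insert j V \<union> {r \<in> R. j < r}"
      have U: "V \<union> R = ?S2 \<union> ?S1" using j by auto
      have dd: "?S2 \<inter> ?S1 = {}" using less by auto
      have blocks: "W \<subseteq> ?S2 \<or> W \<subseteq> ?S1" if W: "W \<in> P" for W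
      proof (cases "W = B")
        case True
        then have "W \<subseteq> ?S2" using BU jmin by fastforce
        then show ?thesis by blast
      next
        case False
        have WB: "W \<inter> B = {}" using NC_eqI[OF P W B(1)] False by blast
        have "W \<subseteq> ?S1" if x: "x \<in> W" "x \<in> ?S1" for x
        proof
          fix y assume y: "y \<in> W"
          have "y \<in> R" "y \<noteq> j" using NC_subset[OF P W] y B(2) j(1) WB by blast+
          moreover have "\<not> j < y"
          proof
            assume "j < y"
            \<comment> \<open>A block that meets the gap and also reaches beyond \<open>j\<close>
              would cross \<open>B\<close> at \<open>v < x < j < y\<close>.\<close>
            obtain v where v: "v \<in> V" using V by blast
            then have "v < x" using less x(2) by blast
            then show False
              using NC_crossingD[OF P B(1) W, of v x j y] v B(2) x y j(1) \<open>j < y\<close> False by auto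
          qed
          ultimately show "y \<in> ?S1" by auto
        qed
        then show ?thesis using NC_subset[OF P W] U by blast
      qed
      have "{W \<in> P. W \<subseteq> ?S2} \<in> NC ?S2"
        using NC_restrict[of P ?S2 ?S1] P U dd blocks by auto
      moreover have "B \<in> {W \<in> P. W \<subseteq> ?S2}"
        using B(1) blocks[OF B(1)] j(1) by auto
      ultimately have "{W \<in> P. W \<subseteq> ?S2} \<in> NC_above (insert j V) {r \<in> R. j < r}"
        using B(2) j(1) unfolding NC_above_def by blast
      then have "P \<in> G j"
        unfolding G_def using P by (intro CollectI conjI bexI[of _ "{W \<in> P. W \<subseteq> ?S2}"]) auto
      then show ?thesis using j by blast
    qed
  next
    fix P assume "P \<in> G0 \<union> (\<Union>j\<in>R. G j)"
    then show "P \<in> NC_above V R"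
    proof
      assume "P \<in> G0"
      then show ?thesis by (auto simp: NC_above_def G0_def)
    next
      assume "P \<in> (\<Union>j\<in>R. G j)"
      then obtain j where j: "j \<in> R" "P \<in> G j" by blast
      obtain B where "B \<in> P" "V \<subseteq> B" using Xblock[OF j(2,1)] by blast
      then show ?thesis using XNC[OF j(2)] by (auto simp: NC_above_def)
    qed
  qed
  have f0: "finite G0" "\<And>j. finite (G j)"
    using finite_NC[OF finU] by (simp_all add: G0_def G_def)
  have S0: "(\<Sum>P\<in>G0. \<Prod>B\<in>P. f B) = f V * ncsum f R"
  proof -
    have "partition_on V {V}" using V by (auto intro!: partition_onI)
    then have "{{V}} \<subseteq> NC V" by (auto intro: NC_I)
    moreover have "\<forall>a\<in>R. \<forall>c\<in>R. \<forall>x\<in>V. \<not> (a < x \<and> x < c)"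
      using less by (meson order.asym)
    ultimately have "(\<Sum>P | P \<in> NC (R \<union> V) \<and> (\<exists>P2\<in>{{V}}. P2 \<subseteq> P). \<Prod>V\<in>P. f V)
        = ncsum f R * (\<Sum>P\<in>{{V}}. \<Prod>V\<in>P. f V)"
      by (intro sum_NC_split fin dis)
    then show ?thesis by (simp add: G0_def Un_commute mult.commute)
  qed
  have Sj: "(\<Sum>P\<in>G j. \<Prod>B\<in>P. f B) =
      ncsum f {r \<in> R. r < j} * (\<Sum>P\<in>NC_above (insert j V) {r \<in> R. j < r}. \<Prod>B\<in>P. f B)"
    if j: "j \<in> R" for j
  proof -
    let ?S1 = "{r \<in> R. r < j}" and ?S2 = "insert j V \<union> {r \<in> R. j < r}"
    have U: "V \<union> R = ?S1 \<union> ?S2" using j by auto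
    have dd: "?S1 \<inter> ?S2 = {}" using less by auto
    have cv: "\<forall>a\<in>?S1. \<forall>c\<in>?S1. \<forall>x\<in>?S2. \<not> (a < x \<and> x < c)"
      using less by fastforce
    have sub: "NC_above (insert j V) {r \<in> R. j < r} \<subseteq> NC ?S2"
      by (auto simp: NC_above_def)
    show ?thesis
      unfolding G_def U
      by (rule sum_NC_split[OF _ _ dd cv sub]) (use fin in auto)
  qed
  show ?thesis
    unfolding split
    by (subst sum.union_disjoint[OF f0(1) _ disj0])
      (simp_all add: f0 fin S0 sum.UNION_disjoint[OF fin(2)] disj Sj)
qed

lemma ncsum_empty [simp]: "ncsum f {} = 1"
proof -
  have "NC {} = {{}}"
    by (auto simp: NC_def partition_on_def)
  then show ?thesis by (simp add: ncsum_def)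
qed

lemma ncsum_insert_least:
  assumes "\<And>r. r \<in> R \<Longrightarrow> i < r"
  shows "ncsum f (insert i R) = (\<Sum>P\<in>NC_above {i} R. \<Prod>B\<in>P. f B)"
proof -
  have "\<exists>B\<in>P. i \<in> B" if "P \<in> NC (insert i R)" for P
    using partition_onD1[OF NC_partition[OF that]] by blast
  then have "NC_above {i} R = NC (insert i R)"
    by (auto simp: NC_above_def)
  then show ?thesis by (simp add: ncsum_def)
qed

section \<open>The incidence algebra\<close>

text \<open>The incidence algebra of intervals stands in for noncommutative power series: for a fixed word \<open>w\<close>,
  the entry \<open>(i, j)\<close> is the coefficient of the subword \<open>w\<^sub>i \<dots> w\<^bsub>j-1\<^esub>\<close>.\<close>

typedef incidence = "{K :: nat \<Rightarrow> nat \<Rightarrow> complex. \<forall>i j. j < i \<longrightarrow> K i j = 0}"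
  morphisms entry Incidence
  by (rule exI[of _ "\<lambda>_ _. 0"]) simp

setup_lifting type_definition_incidence

lemma entry_eq_0: "j < i \<Longrightarrow> entry K i j = 0"
  by transfer simp

lemma incidence_eqI: "(\<And>i j. i \<le> j \<Longrightarrow> entry K i j = entry L i j) \<Longrightarrow> K = L"
  by transfer (metis leI ext)

instantiation incidence :: ring_1
begin

lift_definition zero_incidence :: incidence is "\<lambda>_ _. 0" by simp
lift_definition one_incidence :: incidence is "\<lambda>i j. of_bool (i = j)" by simp
lift_definition plus_incidence :: "incidence \<Rightarrow> incidence \<Rightarrow> incidence" is "\<lambda>K L i j. K i j + L i j" by simp
lift_definition minus_incidence :: "incidence \<Rightarrow> incidence \<Rightarrow> incidence" is "\<lambda>K L i j. K i j - L i j" by simp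
lift_definition uminus_incidence :: "incidence \<Rightarrow> incidence" is "\<lambda>K i j. - K i j" by simp
lift_definition times_incidence :: "incidence \<Rightarrow> incidence \<Rightarrow> incidence"
  is "\<lambda>K L i j. \<Sum>k\<le>j. K i k * L k j"
  by (auto intro!: sum.neutral)

instance
proof
  fix K L M :: incidence
  show "K * L * M = K * (L * M)"
  proof (transfer, intro ext)
    fix K L M :: "nat \<Rightarrow> nat \<Rightarrow> complex" and i j
    assume L: "\<forall>i j. j < i \<longrightarrow> L i j = 0"
    have "(\<Sum>k\<le>j. (\<Sum>l\<le>k. K i l * L l k) * M k j) = (\<Sum>k\<le>j. \<Sum>l\<le>j. K i l * L l k * M k j)"
      unfolding sum_distrib_right using L
      by (intro sum.cong refl sum.mono_neutral_left) auto
    also have "\<dots> = (\<Sum>k\<le>j. K i k * (\<Sum>l\<le>j. L k l * M l j))"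
      unfolding sum_distrib_left by (subst sum.swap) (simp add: mult.assoc)
    finally show "(\<Sum>k\<le>j. (\<Sum>l\<le>k. K i l * L l k) * M k j) = (\<Sum>k\<le>j. K i k * (\<Sum>l\<le>j. L k l * M l j))" .
  qed
  show "1 * K = K"
    by transfer (auto simp: fun_eq_iff of_bool_def if_distrib[of "\<lambda>x. x * _"] cong: if_cong)
  show "K * 1 = K"
    by transfer (auto simp: fun_eq_iff of_bool_def if_distrib[of "(*) _"] cong: if_cong)
  show "K + L + M = K + (L + M)" "K + L = L + K" "0 + K = K" "- K + K = 0" "K - L = K + - L"
    by (transfer; simp add: algebra_simps)+
  show "(K + L) * M = K * M + L * M" "K * (L + M) = K * L + K * M"
    by (transfer; simp add: algebra_simps sum.distrib)+
  show "(0::incidence) \<noteq> 1"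
    by transfer (auto simp: fun_eq_iff)
qed

end

lemma entry_simps [simp]:
  "entry 0 i j = 0" "entry 1 i j = of_bool (i = j)" "entry (K + L) i j = entry K i j + entry L i j"
  "entry (K - L) i j = entry K i j - entry L i j" "entry (- K) i j = - entry K i j"
  by (transfer; simp)+

lemma entry_mult: "entry (K * L) i j = (\<Sum>k\<le>j. entry K i k * entry L k j)"
  by transfer simp

lift_definition scalar :: "complex \<Rightarrow> incidence" is "\<lambda>c i j. if i = j then c else 0" by simp

lemma entry_scalar_mult [simp]: "entry (scalar c * K) i j = c * entry K i j"
  by (cases "i \<le> j")
    (auto simp: entry_mult scalar.rep_eq if_distrib[of "\<lambda>x. x * _"] entry_eq_0 cong: if_cong)

lemma entry_mult_scalar [simp]: "entry (K * scalar c) i j = entry K i j * c"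
  by (auto simp: entry_mult scalar.rep_eq if_distrib[of "(*) _"] cong: if_cong)

lemma scalar_commute: "K * scalar c = scalar c * K"
  by (rule incidence_eqI) simp

lemma scalar_left_commute: "K * (scalar c * L) = scalar c * (K * L)"
  by (metis scalar_commute mult.assoc)

text \<open>One of the two noncommuting indeterminates: it consumes a single position of the fixed
  word and demands the letter \<open>d\<close> there.\<close>

lift_definition letter :: "(nat \<Rightarrow> bool) \<Rightarrow> bool \<Rightarrow> incidence"
  is "\<lambda>w d i j. of_bool (j = Suc i \<and> w i = d)" by simp

lemma entry_mult_letter_mult:
  "entry (K * letter w d * L) i j = (\<Sum>k\<in>{i..<j}. entry K i k * of_bool (w k = d) * entry L (Suc k) j)"
proof -
  have *: "entry (K * letter w d) i k = (case k of 0 \<Rightarrow> 0 | Suc l \<Rightarrow> entry K i l * of_bool (w l = d))" for k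
  proof (cases k)
    case 0
    then show ?thesis by (simp add: entry_mult letter.rep_eq)
  next
    case (Suc l)
    have "entry (K * letter w d) i k = (\<Sum>m\<le>Suc l. if m = l then entry K i l * of_bool (w l = d) else 0)"
      unfolding entry_mult Suc by (intro sum.cong) (auto simp: letter.rep_eq)
    then show ?thesis by (simp add: Suc)
  qed
  have "entry (K * letter w d * L) i j = (\<Sum>k\<le>j. (case k of 0 \<Rightarrow> 0 | Suc l \<Rightarrow> entry K i l * of_bool (w l = d)) * entry L k j)"
    by (simp add: entry_mult[of "K * letter w d"] *)
  also have "\<dots> = (\<Sum>k\<in>Suc ` {..<j}. (case k of 0 \<Rightarrow> 0 | Suc l \<Rightarrow> entry K i l * of_bool (w l = d)) * entry L k j)"
  proof (rule sum.mono_neutral_right)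
    show "\<forall>k\<in>{..j} - Suc ` {..<j}. (case k of 0 \<Rightarrow> 0 | Suc l \<Rightarrow> entry K i l * of_bool (w l = d)) * entry L k j = 0"
    proof
      fix k assume "k \<in> {..j} - Suc ` {..<j}"
      then have "k = 0" by (cases k) auto
      then show "(case k of 0 \<Rightarrow> 0 | Suc l \<Rightarrow> entry K i l * of_bool (w l = d)) * entry L k j = 0" by simp
    qed
  qed auto
  also have "\<dots> = (\<Sum>k<j. entry K i k * of_bool (w k = d) * entry L (Suc k) j)"
    by (subst sum.reindex) auto
  also have "\<dots> = (\<Sum>k\<in>{i..<j}. entry K i k * of_bool (w k = d) * entry L (Suc k) j)"
    by (rule sum.mono_neutral_right) (auto simp: entry_eq_0)
  finally show ?thesis .
qed

lemma entry_letter_mult: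
  "entry (letter w d * L) i j = (if i < j \<and> w i = d then entry L (Suc i) j else 0)"
proof -
  have "entry (letter w d * L) i j = (\<Sum>k\<in>{i..<j}. entry 1 i k * of_bool (w k = d) * entry L (Suc k) j)"
    using entry_mult_letter_mult[of 1 w d L i j] by simp
  also have "\<dots> = (\<Sum>k\<in>{i..<j}. if k = i then of_bool (w i = d) * entry L (Suc i) j else 0)"
    by (intro sum.cong) auto
  finally show ?thesis by simp
qed

section \<open>Substitution of series without constant term into power series\<close>

definition strict :: "incidence \<Rightarrow> bool" where
  "strict K \<longleftrightarrow> (\<forall>i. entry K i i = 0)"

lemma strict_mult: "strict K \<Longrightarrow> strict (K * L)" "strict L \<Longrightarrow> strict (K * L)"
proof -
  have "entry (K * L) i i = entry K i i * entry L i i" for i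
  proof -
    have "entry (K * L) i i = (\<Sum>k\<le>i. if k = i then entry K i i * entry L i i else 0)"
      unfolding entry_mult by (intro sum.cong) (auto simp: entry_eq_0)
    then show ?thesis by simp
  qed
  then show "strict K \<Longrightarrow> strict (K * L)" "strict L \<Longrightarrow> strict (K * L)"
    by (simp_all add: strict_def)
qed

lemma strict_letter: "strict (letter w d)"
  by (simp add: strict_def letter.rep_eq)

lemma entry_power_eq_0:
  assumes "strict Q" "j < i + m"
  shows "entry (Q ^ m) i j = 0"
  using assms(2)
proof (induction m arbitrary: i)
  case 0
  then show ?case by (simp add: entry_eq_0)
next
  case (Suc m)
  have "entry Q i k * entry (Q ^ m) k j = 0" for k
  proof (cases "k \<le> i")
    case True
    then show ?thesis using assms(1) by (cases "k = i") (auto simp: strict_def entry_eq_0)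
  next
    case False
    then show ?thesis using Suc by simp
  qed
  then show ?case unfolding power_Suc entry_mult by (intro sum.neutral ballI)
qed

text \<open>The composition \<open>f(Q)\<close>. For strict \<open>Q\<close> the powers beyond
  \<open>j - i\<close> vanish on the entry, so every larger cutoff gives the same value; the cutoff
  \<open>j\<close> is independent of \<open>i\<close> and can be made common to both factors of a
  product.\<close>

lift_definition fps_eval :: "incidence \<Rightarrow> complex fps \<Rightarrow> incidence"
  is "\<lambda>Q f i j. if i \<le> j then \<Sum>m\<le>j. fps_nth f m * entry (Q ^ m) i j else 0"
  by simp

lemma entry_fps_eval:
  assumes "strict Q" "j \<le> N"
  shows "entry (fps_eval Q f) i j = (\<Sum>m\<le>N. fps_nth f m * entry (Q ^ m) i j)"
proof (cases "i \<le> j")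
  case True
  then show ?thesis
    unfolding fps_eval.rep_eq using assms
    by (auto intro!: sum.mono_neutral_left entry_power_eq_0)
next
  case False
  then show ?thesis by (simp add: fps_eval.rep_eq entry_eq_0)
qed

lemma fps_eval_mult:
  assumes "strict Q"
  shows "fps_eval Q (f * g) = fps_eval Q f * fps_eval Q g"
proof (rule incidence_eqI)
  fix i j :: nat
  have "entry (fps_eval Q f * fps_eval Q g) i j
      = (\<Sum>k\<le>j. (\<Sum>m\<le>j. fps_nth f m * entry (Q ^ m) i k) * (\<Sum>n\<le>j. fps_nth g n * entry (Q ^ n) k j))"
    unfolding entry_mult by (intro sum.cong) (simp_all add: entry_fps_eval[OF assms, of _ j])
  also have "\<dots> = (\<Sum>k\<le>j. \<Sum>m\<le>j. \<Sum>n\<le>j. fps_nth f m * fps_nth g n * (entry (Q ^ m) i k * entry (Q ^ n) k j))"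
    unfolding sum_product by (simp add: mult_ac)
  also have "\<dots> = (\<Sum>m\<le>j. \<Sum>k\<le>j. \<Sum>n\<le>j. fps_nth f m * fps_nth g n * (entry (Q ^ m) i k * entry (Q ^ n) k j))"
    by (rule sum.swap)
  also have "\<dots> = (\<Sum>m\<le>j. \<Sum>n\<le>j. \<Sum>k\<le>j. fps_nth f m * fps_nth g n * (entry (Q ^ m) i k * entry (Q ^ n) k j))"
    by (intro sum.cong refl sum.swap)
  also have "\<dots> = (\<Sum>m\<le>j. \<Sum>n\<le>j. fps_nth f m * fps_nth g n * entry (Q ^ (m + n)) i j)"
    unfolding power_add entry_mult sum_distrib_left ..
  \<comment> \<open>Powers beyond \<open>j\<close> vanish on this entry, so the square of exponents
    shrinks to the triangle of the Cauchy product.\<close>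
  also have "\<dots> = (\<Sum>(m, n) | m + n \<le> j. fps_nth f m * fps_nth g n * entry (Q ^ (m + n)) i j)"
    unfolding sum.cartesian_product
    by (rule sum.mono_neutral_right) (auto intro!: entry_power_eq_0[OF assms])
  also have "{(m, n). m + n \<le> j} = (\<lambda>(l, m). (m, l - m)) ` (SIGMA l:{..j}. {..l})"
    by (auto simp: image_iff) (metis add_diff_cancel_left' atMost_iff le_add1)
  also have "(\<Sum>(m, n)\<in>\<dots>. fps_nth f m * fps_nth g n * entry (Q ^ (m + n)) i j)
      = (\<Sum>(l, m)\<in>(SIGMA l:{..j}. {..l}). fps_nth f m * fps_nth g (l - m) * entry (Q ^ l) i j)"
    by (subst sum.reindex) (auto intro!: inj_onI sum.cong simp: case_prod_unfold)
  also have "\<dots> = (\<Sum>l\<le>j. \<Sum>m\<le>l. fps_nth f m * fps_nth g (l - m) * entry (Q ^ l) i j)"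
    by (subst sum.Sigma) auto
  also have "\<dots> = entry (fps_eval Q (f * g)) i j"
    by (simp add: entry_fps_eval[OF assms order_refl] fps_mult_nth sum_distrib_right atLeast0AtMost)
  finally show "entry (fps_eval Q (f * g)) i j = entry (fps_eval Q f * fps_eval Q g) i j" by simp
qed

lemma fps_eval_add: "fps_eval Q (f + g) = fps_eval Q f + fps_eval Q g"
  by (rule incidence_eqI) (simp add: fps_eval.rep_eq algebra_simps sum.distrib)

lemma fps_eval_diff: "fps_eval Q (f - g) = fps_eval Q f - fps_eval Q g"
  by (rule incidence_eqI) (simp add: fps_eval.rep_eq algebra_simps sum_subtractf)

lemma fps_eval_const: "fps_eval Q (fps_const c) = scalar c"
proof (rule incidence_eqI)
  fix i j :: nat
  assume "i \<le> j"
  have "(\<Sum>m\<le>j. fps_nth (fps_const c) m * entry (Q ^ m) i j)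
      = (\<Sum>m\<le>j. if m = 0 then c * entry (Q ^ 0) i j else 0)"
    by (intro sum.cong) auto
  then show "entry (fps_eval Q (fps_const c)) i j = entry (scalar c) i j"
    using \<open>i \<le> j\<close> by (simp add: fps_eval.rep_eq scalar.rep_eq)
qed

lemma fps_eval_X:
  assumes "strict Q"
  shows "fps_eval Q fps_X = Q"
proof (rule incidence_eqI)
  fix i j :: nat
  have "entry (fps_eval Q fps_X) i j = (\<Sum>m\<le>Suc j. if m = 1 then entry (Q ^ 1) i j else 0)"
    unfolding entry_fps_eval[OF assms le_SucI[OF order_refl]]
    by (intro sum.cong) (auto simp: fps_X_nth)
  then show "entry (fps_eval Q fps_X) i j = entry Q i j" by simp
qed

text \<open>The relation passes to all powers, hence to all series. It is what moves a letter past a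
  series in a cyclically rotated word.\<close>

lemma fps_eval_intertwine:
  assumes "strict Q" "strict Q'" "Y * Q' = Q * Y"
  shows "Y * fps_eval Q' f = fps_eval Q f * Y"
proof (rule incidence_eqI)
  have pow: "Y * Q' ^ m = Q ^ m * Y" for m
  proof (induction m)
    case (Suc m)
    have "Y * Q' ^ Suc m = (Y * Q') * Q' ^ m" by (simp add: mult.assoc)
    also have "\<dots> = Q * (Y * Q' ^ m)" by (simp add: assms(3) mult.assoc)
    also have "\<dots> = Q ^ Suc m * Y" by (simp add: Suc mult.assoc)
    finally show ?case .
  qed simp
  fix i j :: nat
  have "entry (Y * fps_eval Q' f) i j = (\<Sum>m\<le>j. fps_nth f m * entry (Y * Q' ^ m) i j)"
    unfolding entry_mult entry_fps_eval[OF assms(2) order_refl] sum_distrib_left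
    by (subst sum.swap) (simp add: mult_ac)
  also have "\<dots> = (\<Sum>m\<le>j. fps_nth f m * entry (Q ^ m * Y) i j)"
    by (simp only: pow)
  also have "\<dots> = entry (fps_eval Q f * Y) i j"
    unfolding entry_mult sum_distrib_left
    by (subst sum.swap)
      (auto simp: entry_fps_eval[OF assms(1), of _ j] sum_distrib_left sum_distrib_right mult_ac intro!: sum.cong)
  finally show "entry (Y * fps_eval Q' f) i j = entry (fps_eval Q f * Y) i j" .
qed

section \<open>Moments of R-diagonal elements\<close>

text \<open>The value at \<open>m\<close> is the cumulant of the alternating words of length \<open>2(m + 1)\<close>. In words, \<open>True\<close>
  stands for the adjoint.\<close>

fun alternating_cumulant :: "complex \<Rightarrow> nat \<Rightarrow> complex" where
  "alternating_cumulant c 0 = c"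
| "alternating_cumulant c (Suc m) = - c * (\<Sum>i\<le>m. alternating_cumulant c i * alternating_cumulant c (m - i))"

definition alternating_fps :: "complex \<Rightarrow> complex fps" where
  "alternating_fps c = Abs_fps (alternating_cumulant c)"

lemma alternating_fps_eq:
  "alternating_fps c = fps_const c - fps_const c * (fps_X * alternating_fps c * alternating_fps c)"
proof (rule fps_ext)
  fix n
  show "fps_nth (alternating_fps c) n
      = fps_nth (fps_const c - fps_const c * (fps_X * alternating_fps c * alternating_fps c)) n"
    by (cases n) (simp_all add: alternating_fps_def mult.assoc[of fps_X] fps_X_mult_nth fps_mult_nth[of "Abs_fps _"] atLeast0AtMost)
qed

definition word_cumulant :: "complex \<Rightarrow> bool list \<Rightarrow> complex" where
  "word_cumulant c v = (if v \<noteq> [] \<and> even (length v) \<and> distinct_adj v then alternating_cumulant c (length v div 2 - 1) else 0)"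

definition pop_weight :: "complex \<Rightarrow> bool list \<Rightarrow> bool \<Rightarrow> complex" where
  "pop_weight c s d = (if s = [] \<or> hd s = d then 1 else 1 - c)"

text \<open>Popping \<open>d\<close> costs \<open>c\<close> if it lies at the bottom or on a letter equal to it, and \<open>c(1 - c)\<close> otherwise.\<close>

fun stack_moment :: "complex \<Rightarrow> bool list \<Rightarrow> bool list \<Rightarrow> complex" where
  "stack_moment c s [] = of_bool (s = [])"
| "stack_moment c s (d # v) = stack_moment c (d # s) v +
     (case s of [] \<Rightarrow> 0 | e # s' \<Rightarrow> if e = d then 0 else c * pop_weight c s' e * stack_moment c s' v)"

lemma last_distinct_adj_bool:
  fixes v :: "bool list"
  assumes "distinct_adj v" "v \<noteq> []"
  shows "last v = (if even (length v) then \<not> hd v else hd v)"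
  using assms
proof (induction v rule: rev_induct)
  case (snoc x v)
  then show ?case by (cases "v = []") (auto simp: distinct_adj_append_iff)
qed simp

lemma sorted_list_of_set_insert_greatest:
  fixes V :: "nat set"
  assumes "finite V" "\<And>v. v \<in> V \<Longrightarrow> v < k"
  shows "sorted_list_of_set (insert k V) = sorted_list_of_set V @ [k]"
proof (rule sorted_distinct_set_unique)
  show "sorted (sorted_list_of_set V @ [k])" "distinct (sorted_list_of_set V @ [k])"
    using assms by (auto simp: sorted_append intro: less_imp_le simp del: sorted_list_of_set_insert_remove)
  have "finite (insert k V)" using assms by simp
  then show "set (sorted_list_of_set (insert k V)) = set (sorted_list_of_set V @ [k])"
    using assms by (simp only: set_sorted_list_of_set set_append) auto
qed (simp_all del: sorted_list_of_set_insert_remove)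

section \<open>The moment series for the prescribed cumulants, and walks on stacks\<close>

context
  fixes w :: "nat \<Rightarrow> bool" and c :: complex
begin

definition weight :: "nat set \<Rightarrow> complex" where
  "weight V = word_cumulant c (map w (sorted_list_of_set V))"

text \<open>The moment series of the functional whose free cumulants are prescribed by
  \<open>word_cumulant\<close>.\<close>

lift_definition moments :: incidence is "\<lambda>i j. if i \<le> j then ncsum weight {i..<j} else 0"
  by simp

abbreviation ltr :: "bool \<Rightarrow> incidence" where "ltr \<equiv> letter w"

text \<open>\<open>block_tail d r\<close> is the series of completions of a partial block that consists of \<open>r\<close> alternating
  letters beginning with \<open>d\<close>, and \<open>excursion d\<close> that of the words between a letter \<open>d\<close> pushed on the
  stack and its removal.\<close>

definition loop :: "bool \<Rightarrow> incidence" where "loop d = ltr (\<not> d) * moments * ltr d * moments"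
definition loop' :: "bool \<Rightarrow> incidence" where "loop' d = moments * ltr d * moments * ltr (\<not> d)"
text \<open>A block that already has \<open>2 * (m + 1)\<close> letters may close with the cumulant
  of index \<open>m\<close>, hence the shift. Each factor \<open>loop' d\<close> adds two letters to
  the block, with moments in the gaps; the last \<open>moments\<close> covers what follows the
  block.\<close>

definition even_tail :: "bool \<Rightarrow> nat \<Rightarrow> incidence" where
  "even_tail d m = fps_eval (loop' d) (fps_shift m (alternating_fps c)) * moments"
definition block_tail :: "bool \<Rightarrow> nat \<Rightarrow> incidence" where
  "block_tail d r = (if even r then even_tail d (r div 2 - 1) else moments * ltr (\<not> d) * even_tail d (r div 2))"
definition excursion :: "bool \<Rightarrow> incidence" where "excursion d = moments * fps_eval (loop d) (alternating_fps c)"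

lemma strict_loop: "strict (loop d)"
  by (simp add: loop_def mult.assoc strict_mult strict_letter)

lemma strict_loop': "strict (loop' d)"
  by (simp add: loop'_def strict_mult strict_letter)

lemma even_tail_rec: "even_tail d m = scalar (alternating_cumulant c m) * moments + moments * ltr d * (moments * ltr (\<not> d) * even_tail d (Suc m))"
proof -
  have "fps_shift m (alternating_fps c) = fps_const (alternating_cumulant c m) + fps_X * fps_shift (Suc m) (alternating_fps c)"
  proof (rule fps_ext)
    fix n
    show "fps_nth (fps_shift m (alternating_fps c)) n =
        fps_nth (fps_const (alternating_cumulant c m) + fps_X * fps_shift (Suc m) (alternating_fps c)) n"
      by (cases n) (simp_all add: alternating_fps_def)
  qed
  then have "fps_eval (loop' d) (fps_shift m (alternating_fps c)) =
      scalar (alternating_cumulant c m) + loop' d * fps_eval (loop' d) (fps_shift (Suc m) (alternating_fps c))"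
    by (simp only: fps_eval_add fps_eval_const fps_eval_mult[OF strict_loop'] fps_eval_X[OF strict_loop'])
  then show ?thesis by (simp add: even_tail_def loop'_def algebra_simps)
qed

text \<open>Mirrors \<open>sum_NC_above\<close>: the block closes, which only an even one can do, or
  after a gap it takes the next letter, which parity forces.\<close>

lemma block_tail_rec:
  assumes "r \<ge> 1"
  shows "block_tail d r = scalar (if even r then alternating_cumulant c (r div 2 - 1) else 0) * moments +
    moments * ltr (if even r then d else \<not> d) * block_tail d (Suc r)"
proof (cases "even r")
  case True
  then obtain m where m: "r = 2 * Suc m" using assms
    by (metis One_nat_def Suc_1 dvd_def mult_is_0 not0_implies_Suc not_one_le_zero)
  show ?thesis using even_tail_rec[of d m] by (simp add: block_tail_def m)
next
  case False
  have "scalar 0 * moments = 0" by (rule incidence_eqI) simp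
  then show ?thesis using False by (simp add: block_tail_def)
qed

text \<open>Both sides obey the same recursion, \<open>sum_NC_above\<close> on one side and
  \<open>block_tail_rec\<close> on the other. A block that has stopped alternating cannot be
  completed to one of nonzero weight and contributes 0.\<close>

lemma sum_NC_above_weight:
  assumes "finite V" "V \<noteq> {}" "\<And>v. v \<in> V \<Longrightarrow> v < i" "i \<le> j"
  defines "acc \<equiv> map w (sorted_list_of_set V)"
  shows "(\<Sum>P\<in>NC_above V {i..<j}. \<Prod>B\<in>P. weight B) =
    (if distinct_adj acc then entry (block_tail (hd acc) (length acc)) i j else 0)"
  using assms(1-4) unfolding acc_def
proof (induction "j - i" arbitrary: V i rule: less_induct)
  case less
  define acc where "acc = map w (sorted_list_of_set V)"
  have acc: "acc \<noteq> []" using less.prems by (simp add: acc_def)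
  have r: "length acc \<ge> 1" using acc by (cases acc) auto
  have step: "(\<Sum>P\<in>NC_above (insert k V) {k<..<j}. \<Prod>B\<in>P. weight B) =
      (if distinct_adj acc \<and> last acc \<noteq> w k then entry (block_tail (hd acc) (Suc (length acc))) (Suc k) j else 0)"
    if k: "k \<in> {i..<j}" for k
  proof -
    have V: "\<And>v. v \<in> V \<Longrightarrow> v < k" using less.prems(3) k by fastforce
    have l: "map w (sorted_list_of_set (insert k V)) = acc @ [w k]"
      unfolding acc_def by (subst sorted_list_of_set_insert_greatest[OF less.prems(1) V]) auto
    have "(\<Sum>P\<in>NC_above (insert k V) {Suc k..<j}. \<Prod>B\<in>P. weight B) =
        (if distinct_adj (acc @ [w k]) then entry (block_tail (hd (acc @ [w k])) (length (acc @ [w k]))) (Suc k) j else 0)"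
      unfolding l[symmetric]
    proof (rule less.hyps)
      show "v < Suc k" if "v \<in> insert k V" for v using that V by fastforce
    qed (use less.prems k in auto)
    moreover have "{Suc k..<j} = {k<..<j}" by auto
    ultimately show ?thesis using acc by (simp add: distinct_adj_append_iff)
  qed
  have "(\<Sum>P\<in>NC_above V {i..<j}. \<Prod>B\<in>P. weight B) = weight V * ncsum weight {i..<j} +
      (\<Sum>k\<in>{i..<j}. ncsum weight {r\<in>{i..<j}. r < k} * (\<Sum>P\<in>NC_above (insert k V) {r\<in>{i..<j}. k < r}. \<Prod>B\<in>P. weight B))"
    using less.prems by (intro sum_NC_above) fastforce+
  also have "\<dots> = weight V * entry moments i j + (\<Sum>k\<in>{i..<j}. entry moments i k *
      (if distinct_adj acc \<and> last acc \<noteq> w k then entry (block_tail (hd acc) (Suc (length acc))) (Suc k) j else 0))"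
  proof (rule arg_cong2[where f = "(+)"], goal_cases)
    case 1
    then show ?case using less.prems by (simp add: moments.rep_eq)
  next
    case 2
    show ?case
    proof (rule sum.cong[OF refl])
      fix k assume k: "k \<in> {i..<j}"
      have "{r\<in>{i..<j}. r < k} = {i..<k}" "{r\<in>{i..<j}. k < r} = {k<..<j}" using k by auto
      then show "ncsum weight {r\<in>{i..<j}. r < k} * (\<Sum>P\<in>NC_above (insert k V) {r\<in>{i..<j}. k < r}. \<Prod>B\<in>P. weight B) =
         entry moments i k * (if distinct_adj acc \<and> last acc \<noteq> w k then entry (block_tail (hd acc) (Suc (length acc))) (Suc k) j else 0)"
        using k by (simp only: step) (simp add: moments.rep_eq)
    qed
  qed
  also have "\<dots> = (if distinct_adj acc then entry (block_tail (hd acc) (length acc)) i j else 0)"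
  proof (cases "distinct_adj acc")
    case True
    have w: "weight V = (if even (length acc) then alternating_cumulant c (length acc div 2 - 1) else 0)"
      using True acc by (simp add: weight_def word_cumulant_def acc_def)
    \<comment> \<open>With two letters only, the first letter and the parity of the length determine
      which letter may come next.\<close>
    have l: "distinct_adj acc \<and> last acc \<noteq> x \<longleftrightarrow> x = (if even (length acc) then hd acc else \<not> hd acc)" for x
      using last_distinct_adj_bool[OF True acc] True by auto
    have "entry (block_tail (hd acc) (length acc)) i j = weight V * entry moments i j +
      (\<Sum>k\<in>{i..<j}. entry moments i k * of_bool (w k = (if even (length acc) then hd acc else \<not> hd acc)) *
        entry (block_tail (hd acc) (Suc (length acc))) (Suc k) j)"
      unfolding block_tail_rec[OF r] w entry_simps entry_mult_letter_mult entry_scalar_mult ..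
    moreover have "(\<Sum>k\<in>{i..<j}. entry moments i k * of_bool (w k = (if even (length acc) then hd acc else \<not> hd acc)) *
        entry (block_tail (hd acc) (Suc (length acc))) (Suc k) j) = (\<Sum>k\<in>{i..<j}. entry moments i k *
        (if distinct_adj acc \<and> last acc \<noteq> w k then entry (block_tail (hd acc) (Suc (length acc))) (Suc k) j else 0))"
      unfolding l by (intro sum.cong) simp_all
    ultimately show ?thesis using True by simp
  next
    case False
    then show ?thesis by (simp add: weight_def word_cumulant_def acc_def)
  qed
  finally show ?case by (simp add: acc_def)
qed

text \<open>Rotating the series past \<open>\<not> d\<close> brings the last letter of the block
  opened by \<open>d\<close> to the right end. In the stack walk this letter plays the role of the
  removal of \<open>d\<close>.\<close>

lemma block_tail_one: "block_tail d 1 = excursion d * ltr (\<not> d) * moments"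
proof -
  have "ltr (\<not> d) * fps_eval (loop' d) (alternating_fps c) = fps_eval (loop d) (alternating_fps c) * ltr (\<not> d)"
    by (rule fps_eval_intertwine[OF strict_loop strict_loop']) (simp add: loop_def loop'_def mult.assoc)
  then show ?thesis by (simp add: block_tail_def even_tail_def excursion_def mult.assoc flip: mult.assoc[of "ltr (\<not> d)" "fps_eval _ _"])
qed

text \<open>Decomposition by the block of the first letter: it ends with the opposite letter, and
  what follows its last letter is unrestricted.\<close>

lemma moments_eq: "moments = 1 + ltr d * excursion d * ltr (\<not> d) * moments + ltr (\<not> d) * excursion (\<not> d) * ltr d * moments"
proof (rule incidence_eqI)
  fix i j :: nat
  assume ij: "i \<le> j"
  have "entry moments i j = of_bool (i = j) + (if i < j then entry (block_tail (w i) 1) (Suc i) j else 0)"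
  proof (cases "i = j")
    case False
    then have "{i..<j} = insert i {Suc i..<j}" using ij by auto
    then have "entry moments i j = (\<Sum>P\<in>NC_above {i} {Suc i..<j}. \<Prod>B\<in>P. weight B)"
      using ij ncsum_insert_least[of "{Suc i..<j}" i weight] by (simp add: moments.rep_eq)
    also have "\<dots> = entry (block_tail (w i) 1) (Suc i) j"
      using False ij by (subst sum_NC_above_weight) auto
    finally show ?thesis using False ij by simp
  qed (simp add: moments.rep_eq)
  moreover have "entry (1 + ltr d * block_tail d 1 + ltr (\<not> d) * block_tail (\<not> d) 1) i j =
      of_bool (i = j) + (if i < j then entry (block_tail (w i) 1) (Suc i) j else 0)"
    by (simp add: entry_letter_mult)
  ultimately show "entry moments i j = entry (1 + ltr d * excursion d * ltr (\<not> d) * moments + ltr (\<not> d) * excursion (\<not> d) * ltr d * moments) i j"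
    unfolding block_tail_one by (simp add: mult.assoc)
qed

text \<open>This is \<open>\<alpha>(t) = c - c t \<alpha>(t)^2\<close> at \<open>t = loop d\<close>,
  multiplied by \<open>moments\<close>. Intertwining moves one of the two factors
  \<open>\<alpha>\<close> next to another \<open>moments\<close>, so that the quadratic term becomes
  a product of two excursions.\<close>

lemma excursion_eq_moments: "excursion d = scalar c * moments - scalar c * (moments * ltr (\<not> d) * excursion (\<not> d) * ltr d * excursion d)"
proof -
  have 1: "ltr d * moments * fps_eval (loop d) (alternating_fps c) = fps_eval (loop (\<not> d)) (alternating_fps c) * (ltr d * moments)"
    by (rule fps_eval_intertwine[OF strict_loop strict_loop]) (simp add: loop_def mult.assoc)
  have "moments * ltr (\<not> d) * excursion (\<not> d) * ltr d * excursion d =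
      moments * ltr (\<not> d) * moments * (fps_eval (loop (\<not> d)) (alternating_fps c) * (ltr d * moments)) * fps_eval (loop d) (alternating_fps c)"
    by (simp add: excursion_def mult.assoc)
  also have "\<dots> = moments * (loop d * fps_eval (loop d) (alternating_fps c) * fps_eval (loop d) (alternating_fps c))"
    unfolding 1[symmetric] by (simp add: loop_def mult.assoc)
  also have "loop d * fps_eval (loop d) (alternating_fps c) * fps_eval (loop d) (alternating_fps c) =
      fps_eval (loop d) (fps_X * alternating_fps c * alternating_fps c)"
    by (simp add: fps_eval_mult[OF strict_loop] fps_eval_X[OF strict_loop])
  finally have 2: "moments * ltr (\<not> d) * excursion (\<not> d) * ltr d * excursion d = moments * fps_eval (loop d) (fps_X * alternating_fps c * alternating_fps c)" .
  have "fps_eval (loop d) (alternating_fps c) = scalar c - scalar c * fps_eval (loop d) (fps_X * alternating_fps c * alternating_fps c)"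
    by (subst alternating_fps_eq) (simp only: fps_eval_diff fps_eval_const fps_eval_mult[OF strict_loop])
  then have "excursion d = moments * scalar c - moments * (scalar c * fps_eval (loop d) (fps_X * alternating_fps c * alternating_fps c))"
    by (metis excursion_def right_diff_distrib)
  then show ?thesis unfolding 2 by (simp add: scalar_left_commute[of moments] scalar_commute[of moments])
qed

text \<open>Eliminating \<open>moments\<close> gives the first-step decomposition of the walk above
  a letter \<open>d\<close>: \<open>d\<close> is removed at once, or another \<open>d\<close> is
  pushed on it, or \<open>\<not> d\<close> is. The coefficient \<open>1 - c\<close> is the 1 of
  \<open>moments_eq\<close> minus the \<open>c\<close> of the equation for \<open>\<alpha>\<close>;
  it is the \<open>pop_weight\<close> of unequal neighbours.\<close>

lemma excursion_eq: "excursion d = scalar c + ltr d * excursion d * ltr (\<not> d) * excursion d + scalar (1 - c) * (ltr (\<not> d) * excursion (\<not> d) * ltr d * excursion d)"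
proof -
  \<comment> \<open>By \<open>moments_eq\<close>, \<open>D\<close> is a left inverse of
    \<open>moments\<close>.\<close>
  define D where "D = 1 - ltr d * excursion d * ltr (\<not> d) - ltr (\<not> d) * excursion (\<not> d) * ltr d"
  have DS: "D * moments = 1"
    using moments_eq[of d] by (simp add: D_def algebra_simps)
  have "D * excursion d = scalar c * (D * moments) - scalar c * (D * moments * ltr (\<not> d) * excursion (\<not> d) * ltr d * excursion d)"
    by (subst excursion_eq_moments) (simp add: right_diff_distrib scalar_left_commute[of D] mult.assoc)
  then have 1: "D * excursion d = scalar c - scalar c * (ltr (\<not> d) * excursion (\<not> d) * ltr d * excursion d)"
    by (simp add: DS)
  have 2: "scalar (1 - c) * Z = Z - scalar c * Z" for Z
    by (rule incidence_eqI) (simp add: algebra_simps)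
  show ?thesis using 1 unfolding 2 by (simp add: D_def algebra_simps)
qed

text \<open>The series of weighted words that lead from the stack \<open>s\<close> to the empty one:
  for each letter an excursion, then its removal by the opposite letter. The factor \<open>c\<close>
  of a removal is already contained in \<open>excursion\<close>, so only \<open>pop_weight\<close>
  is written.\<close>

fun stack_kernel :: "bool list \<Rightarrow> incidence" where
  "stack_kernel [] = moments"
| "stack_kernel (d # s) = scalar (pop_weight c s d) * (excursion d * ltr (\<not> d) * stack_kernel s)"

text \<open>The recursion of \<open>stack_moment\<close> at the level of series. The two quadratic
  terms of \<open>excursion_eq\<close> are the two pushes, its constant term is the pop.\<close>

lemma stack_kernel_eq: "stack_kernel s = of_bool (s = []) + ltr True * stack_kernel (True # s) + ltr False * stack_kernel (False # s) +
   (case s of [] \<Rightarrow> 0 | d # s' \<Rightarrow> scalar (c * pop_weight c s' d) * (ltr (\<not> d) * stack_kernel s'))"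
proof (cases s)
  case Nil
  have "scalar 1 = 1" by (rule incidence_eqI) (simp add: scalar.rep_eq)
  then show ?thesis using moments_eq[of True] by (simp add: Nil pop_weight_def mult.assoc)
next
  case (Cons d s')
  define M where "M = scalar (pop_weight c s' d) * (ltr (\<not> d) * stack_kernel s')"
  have one: "scalar 1 = 1" by (rule incidence_eqI) (simp add: scalar.rep_eq)
  have sc: "scalar (x * y) * N = scalar x * (scalar y * N)" for x y N
    by (rule incidence_eqI) simp
  have Ks: "stack_kernel s = excursion d * M"
    by (simp add: Cons M_def scalar_left_commute[of "excursion d"] mult.assoc)
  have "ltr True * stack_kernel (True # s) + ltr False * stack_kernel (False # s) = ltr d * stack_kernel (d # s) + ltr (\<not> d) * stack_kernel ((\<not> d) # s)"
    by (cases d) (simp_all add: add.commute)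
  also have "\<dots> = (ltr d * excursion d * ltr (\<not> d) * excursion d + scalar (1 - c) * (ltr (\<not> d) * excursion (\<not> d) * ltr d * excursion d)) * M"
    unfolding stack_kernel.simps(2)[of _ s] Ks
    by (simp add: Cons pop_weight_def one scalar_left_commute[of "letter _ _"] distrib_right mult.assoc)
  also have "ltr d * excursion d * ltr (\<not> d) * excursion d + scalar (1 - c) * (ltr (\<not> d) * excursion (\<not> d) * ltr d * excursion d) = excursion d - scalar c"
    using excursion_eq[of d] by (simp add: algebra_simps)
  finally have 1: "ltr True * stack_kernel (True # s) + ltr False * stack_kernel (False # s) = stack_kernel s - scalar c * M"
    unfolding Ks by (simp only: left_diff_distrib)
  show ?thesis
    using 1 by (simp add: Cons sc M_def algebra_simps)
qed

lemma stack_moment_eq_entry: "stack_moment c s (map w [i..<n]) = entry (stack_kernel s) i n" if "i \<le> n"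
  using that
proof (induction "n - i" arbitrary: i s)
  case 0
  then show ?case
    by (subst stack_kernel_eq) (auto simp: entry_letter_mult split: list.splits)
next
  case (Suc k)
  have "i < n" and IH: "stack_moment c s (map w [Suc i..<n]) = entry (stack_kernel s) (Suc i) n" for s
    using Suc by auto
  then show ?case
    by (subst stack_kernel_eq) (auto simp: upt_conv_Cons entry_letter_mult IH split: list.splits)
qed

lemma stack_moment_eq_ncsum: "stack_moment c [] (map w [0..<n]) = ncsum weight {..<n}"
  by (simp add: stack_moment_eq_entry moments.rep_eq atLeast0LessThan)

end

lemma nths_eq_map_sorted_list_of_set:
  assumes "V \<subseteq> {..<length xs}"
  shows "nths xs V = map ((!) xs) (sorted_list_of_set V)"
proof -
  have z: "zip xs [0..<length xs] = map (\<lambda>i. (xs ! i, i)) [0..<length xs]"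
    by (rule nth_equalityI) auto
  have "nths xs V = map ((!) xs) (filter (\<lambda>i. i \<in> V) [0..<length xs])"
    unfolding nths_def z by (simp add: filter_map comp_def)
  moreover have "finite V" using assms finite_subset by blast
  then have "filter (\<lambda>i. i \<in> V) [0..<length xs] = sorted_list_of_set V"
    using assms by (intro sorted_distinct_set_unique) (auto intro: sorted_wrt_filter)
  ultimately show ?thesis by simp
qed

text \<open>The moment-cumulant formula has only one solution: by induction on the length the terms
  of all other partitions agree, and the one-block term remains.\<close>

lemma free_cumulant_eq:
  assumes "\<And>w. \<phi> (list_prod A (map f w)) = (\<Sum>P\<in>NC {..<length w}. \<Prod>V\<in>P. g (nths w V))"
  shows "w \<noteq> [] \<Longrightarrow> free_cumulant A \<phi> (map f w) = g w"
proof (induction "length w" arbitrary: w rule: less_induct)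
  case less
  let ?n = "length w"
  have nc: "noncrossing_partition ?n P \<longleftrightarrow> P \<in> NC {..<?n}" for P
    by (auto simp: noncrossing_partition_def NC_def)
  have "partition_on {..<?n} {{..<?n}}"
    using less.prems by (intro partition_on_space) auto
  then have one: "{{..<?n}} \<in> NC {..<?n}"
    by (rule NC_I) auto
  have block: "free_cumulant A \<phi> (nths (map f w) V) = g (nths w V)"
    if P: "P \<in> NC {..<?n}" "P \<noteq> {{..<?n}}" "V \<in> P" for P V
  proof -
    have "nths w V \<noteq> []"
      using NC_subset[OF P(1,3)] NC_nonempty[OF P(1,3)] set_nths[of w V] by force
    moreover have "length (nths w V) < ?n"
      using length_nths_proper_block[of w P V] P nc by auto
    ultimately show ?thesis using less.hyps by (simp add: nths_map)
  qed
  have "free_cumulant A \<phi> (map f w) = \<phi> (list_prod A (map f w)) -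
      (\<Sum>P\<in>NC {..<?n} - {{{..<?n}}}. \<Prod>V\<in>P. free_cumulant A \<phi> (nths (map f w) V))"
    by (subst free_cumulant.simps) (simp add: nc set_diff_eq)
  also have "(\<Sum>P\<in>NC {..<?n} - {{{..<?n}}}. \<Prod>V\<in>P. free_cumulant A \<phi> (nths (map f w) V)) =
      (\<Sum>P\<in>NC {..<?n} - {{{..<?n}}}. \<Prod>V\<in>P. g (nths w V))"
    using block by (intro sum.cong prod.cong refl) auto
  also have "\<phi> (list_prod A (map f w)) =
      g (nths w {..<?n}) + (\<Sum>P\<in>NC {..<?n} - {{{..<?n}}}. \<Prod>V\<in>P. g (nths w V))"
    unfolding assms by (subst sum.remove[OF finite_NC one]) auto
  finally show ?case by simp
qed

lemma free_cumulant_eq_word_cumulant: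
  assumes "\<And>w. \<phi> (list_prod A (map f w)) = stack_moment c [] w" "w \<noteq> []"
  shows "free_cumulant A \<phi> (map f w) = word_cumulant c w"
proof (rule free_cumulant_eq[OF _ assms(2)])
  fix w :: "bool list"
  have "stack_moment c [] w = stack_moment c [] (map ((!) w) [0..<length w])"
    by (simp add: map_nth)
  also have "\<dots> = ncsum (weight ((!) w) c) {..<length w}"
    by (rule stack_moment_eq_ncsum)
  also have "\<dots> = (\<Sum>P\<in>NC {..<length w}. \<Prod>V\<in>P. word_cumulant c (nths w V))"
    unfolding ncsum_def weight_def
    by (intro sum.cong prod.cong refl) (simp add: nths_eq_map_sorted_list_of_set NC_subset)
  finally show "\<phi> (list_prod A (map f w)) = (\<Sum>P\<in>NC {..<length w}. \<Prod>V\<in>P. word_cumulant c (nths w V))"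
    using assms(1) by simp
qed

section \<open>Reduced words in a free product\<close>

locale star_algebra_ring = Ring.ring A for A :: "'a star_alg" (structure) +
  assumes star_algebra: "star_algebra A"

lemma star_algebra_ring: "star_algebra A \<Longrightarrow> star_algebra_ring A"
  by (simp add: star_algebra_ring_def star_algebra_ring_axioms_def) (simp add: star_algebra_def)

context star_algebra_ring
begin

lemma smult_module: "Module.module (ring_of_type_algebra :: complex ring) A"
  using star_algebra by (simp add: star_algebra_def)

lemma smult_closed [simp, intro]: "x \<in> carrier A \<Longrightarrow> c \<odot> x \<in> carrier A"
  using module.smult_closed[OF smult_module, of c x] by (simp add: ring_of_type_algebra_def)

lemma smult_l_distr: "x \<in> carrier A \<Longrightarrow> (c + d) \<odot> x = c \<odot> x \<oplus> d \<odot> x"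
  using module.smult_l_distr[OF smult_module, of c d x] by (simp add: ring_of_type_algebra_def)

lemma smult_r_distr: "x \<in> carrier A \<Longrightarrow> y \<in> carrier A \<Longrightarrow> c \<odot> (x \<oplus> y) = c \<odot> x \<oplus> c \<odot> y"
  using module.smult_r_distr[OF smult_module, of c x y] by (simp add: ring_of_type_algebra_def)

lemma smult_smult: "x \<in> carrier A \<Longrightarrow> c \<odot> (d \<odot> x) = (c * d) \<odot> x"
  using module.smult_assoc1[OF smult_module, of c d x] by (simp add: ring_of_type_algebra_def)

lemma smult_one [simp]: "x \<in> carrier A \<Longrightarrow> 1 \<odot> x = x"
  using module.smult_one[OF smult_module, of x] by (simp add: ring_of_type_algebra_def)

lemma smult_zero [simp]: "x \<in> carrier A \<Longrightarrow> 0 \<odot> x = \<zero>"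
  using module.smult_l_null[OF smult_module, of x] by (simp add: ring_of_type_algebra_def)

lemma smult_r_zero [simp]: "c \<odot> \<zero> = \<zero>"
  using module.smult_r_null[OF smult_module, of c] by (simp add: ring_of_type_algebra_def)

lemma smult_mult_l: "x \<in> carrier A \<Longrightarrow> y \<in> carrier A \<Longrightarrow> (c \<odot> x) \<otimes> y = c \<odot> (x \<otimes> y)"
  using star_algebra by (simp add: star_algebra_def)

lemma smult_mult_r: "x \<in> carrier A \<Longrightarrow> y \<in> carrier A \<Longrightarrow> x \<otimes> (c \<odot> y) = c \<odot> (x \<otimes> y)"
  using star_algebra by (simp add: star_algebra_def)

lemma star_closed [simp, intro]: "x \<in> carrier A \<Longrightarrow> star A x \<in> carrier A"
  using star_algebra by (simp add: star_algebra_def)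

lemma star_star [simp]: "x \<in> carrier A \<Longrightarrow> star A (star A x) = x"
  using star_algebra by (simp add: star_algebra_def)

lemma star_add: "x \<in> carrier A \<Longrightarrow> y \<in> carrier A \<Longrightarrow> star A (x \<oplus> y) = star A x \<oplus> star A y"
  using star_algebra by (simp add: star_algebra_def)

lemma star_mult: "x \<in> carrier A \<Longrightarrow> y \<in> carrier A \<Longrightarrow> star A (x \<otimes> y) = star A y \<otimes> star A x"
  using star_algebra by (simp add: star_algebra_def)

lemma star_smult: "x \<in> carrier A \<Longrightarrow> star A (c \<odot> x) = cnj c \<odot> star A x"
  using star_algebra by (simp add: star_algebra_def)

lemma star_zero [simp]: "star A \<zero> = \<zero>"
  using star_smult[of \<zero> 0] by simp

lemma star_one [simp]: "star A \<one> = \<one>"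
proof -
  have "star A \<one> \<otimes> \<one> = \<one>" using star_mult[of "star A \<one>" \<one>] by simp
  then show ?thesis by simp
qed

lemma star_finsum:
  assumes "finite I" "f \<in> I \<rightarrow> carrier A"
  shows "star A (\<Oplus>i\<in>I. f i) = (\<Oplus>i\<in>I. star A (f i))"
  using assms
proof (induction I rule: finite_induct)
  case (insert i I)
  then show ?case by (simp add: Pi_iff star_add finsum_closed)
qed simp

lemma list_prod_Nil [simp]: "list_prod A [] = \<one>"
  by (simp add: list_prod_def)

lemma list_prod_Cons [simp]: "list_prod A (x # xs) = x \<otimes> list_prod A xs"
  by (simp add: list_prod_def)

lemma list_prod_closed [simp, intro]: "set xs \<subseteq> carrier A \<Longrightarrow> list_prod A xs \<in> carrier A"
  by (induction xs) auto

lemma list_prod_append: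
  "set xs \<subseteq> carrier A \<Longrightarrow> set ys \<subseteq> carrier A \<Longrightarrow> list_prod A (xs @ ys) = list_prod A xs \<otimes> list_prod A ys"
  by (induction xs) (auto simp: m_assoc)

inductive_set lspan :: "'a set \<Rightarrow> 'a set" for G :: "'a set" where
  zero: "\<zero> \<in> lspan G"
| add: "x \<in> G \<Longrightarrow> y \<in> lspan G \<Longrightarrow> c \<odot> x \<oplus> y \<in> lspan G"

lemma lspan_closed: "y \<in> lspan G \<Longrightarrow> G \<subseteq> carrier A \<Longrightarrow> y \<in> carrier A"
  by (induction rule: lspan.induct) auto

lemma lspan_base: "x \<in> G \<Longrightarrow> G \<subseteq> carrier A \<Longrightarrow> x \<in> lspan G"
  using lspan.add[OF _ lspan.zero, of x G 1] by auto

lemma lspan_add: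
  assumes "G \<subseteq> carrier A" "y \<in> lspan G" "z \<in> lspan G"
  shows "y \<oplus> z \<in> lspan G"
  using assms(2)
proof (induction rule: lspan.induct)
  case zero
  then show ?case using assms lspan_closed by simp
next
  case (add x y c)
  have "c \<odot> x \<oplus> y \<oplus> z = c \<odot> x \<oplus> (y \<oplus> z)"
    using add assms lspan_closed by (intro a_assoc) auto
  then show ?case using lspan.add[OF add(1) add.IH] by simp
qed

lemma lspan_smult:
  assumes "G \<subseteq> carrier A" "y \<in> lspan G"
  shows "c \<odot> y \<in> lspan G"
  using assms(2)
proof (induction rule: lspan.induct)
  case (add x y d)
  have "c \<odot> (d \<odot> x \<oplus> y) = (c * d) \<odot> x \<oplus> c \<odot> y"
    using add assms lspan_closed by (subst smult_r_distr) (auto simp: smult_smult)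
  then show ?case using lspan.add[OF add(1) add.IH] by simp
qed (simp add: lspan.zero)

lemma lspan_finsum:
  assumes "G \<subseteq> carrier A" "finite I" "\<And>i. i \<in> I \<Longrightarrow> f i \<in> lspan G"
  shows "(\<Oplus>i\<in>I. f i) \<in> lspan G"
  using assms(2,3)
proof (induction I rule: finite_induct)
  case (insert i I)
  then have "f \<in> insert i I \<rightarrow> carrier A" using lspan_closed assms(1) by blast
  then show ?case using insert by (simp add: lspan_add[OF assms(1)] Pi_iff)
qed (simp add: lspan.zero)

text \<open>The factor \<open>g c\<close> in place of \<open>c\<close> admits antilinear maps, so
  that the star is covered with \<open>g = cnj\<close>.\<close>

lemma lspan_linear:
  assumes "y \<in> lspan G" "G \<subseteq> carrier A" "Z \<subseteq> carrier A"
    and "f \<zero> = \<zero>"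
    and "\<And>c x y. x \<in> carrier A \<Longrightarrow> y \<in> carrier A \<Longrightarrow> f (c \<odot> x \<oplus> y) = g c \<odot> f x \<oplus> f y"
    and "\<And>x. x \<in> G \<Longrightarrow> f x \<in> lspan Z"
  shows "f y \<in> lspan Z"
  using assms(1)
proof (induction rule: lspan.induct)
  case zero
  then show ?case using assms by (simp add: lspan.zero)
next
  case (add x y c)
  have "f (c \<odot> x \<oplus> y) = g c \<odot> f x \<oplus> f y"
    using add lspan_closed assms(2) by (intro assms(5)) auto
  then show ?case using add assms by (simp add: lspan_add lspan_smult)
qed

lemma lspan_lspan:
  assumes "y \<in> lspan G" "G \<subseteq> lspan Z" "Z \<subseteq> carrier A"
  shows "y \<in> lspan Z"
proof (rule lspan_linear[of y G Z "\<lambda>x. x" "\<lambda>c. c"])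
  show "G \<subseteq> carrier A" using assms(2,3) lspan_closed by blast
qed (use assms in auto)

lemma lspan_mono: "y \<in> lspan G \<Longrightarrow> G \<subseteq> Z \<Longrightarrow> y \<in> lspan Z"
  by (induction rule: lspan.induct) (auto intro: lspan.intros)

lemma lspan_mult_right:
  assumes "y \<in> lspan G" "G \<subseteq> carrier A" "Z \<subseteq> carrier A" "z \<in> carrier A"
    and "\<And>x. x \<in> G \<Longrightarrow> x \<otimes> z \<in> lspan Z"
  shows "y \<otimes> z \<in> lspan Z"
  by (rule lspan_linear[of y G Z "\<lambda>x. x \<otimes> z" "\<lambda>c. c"])
    (use assms in \<open>auto simp: l_distr smult_mult_l\<close>)

lemma lspan_mult:
  assumes "y \<in> lspan G" "z \<in> lspan Y" "G \<subseteq> carrier A" "Y \<subseteq> carrier A" "Z \<subseteq> carrier A"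
    and "\<And>x y. x \<in> G \<Longrightarrow> y \<in> Y \<Longrightarrow> x \<otimes> y \<in> lspan Z"
  shows "y \<otimes> z \<in> lspan Z"
proof (rule lspan_mult_right[OF assms(1,3,5)])
  show "z \<in> carrier A" using assms(2,4) lspan_closed by blast
  fix x assume x: "x \<in> G"
  show "x \<otimes> z \<in> lspan Z"
    by (rule lspan_linear[of z Y Z "\<lambda>z. x \<otimes> z" "\<lambda>c. c"])
      (use assms x in \<open>auto simp: r_distr smult_mult_r subset_iff\<close>)
qed

lemma lspan_star:
  assumes "y \<in> lspan G" "G \<subseteq> carrier A" "Z \<subseteq> carrier A"
    and "\<And>x. x \<in> G \<Longrightarrow> star A x \<in> lspan Z"
  shows "star A y \<in> lspan Z"
  by (rule lspan_linear[of y G Z "star A" cnj]) (use assms in \<open>auto simp: star_add star_smult\<close>)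

end

locale linear_functional = star_algebra_ring +
  fixes \<phi> :: "'a \<Rightarrow> complex"
  assumes phi_add: "x \<in> carrier A \<Longrightarrow> y \<in> carrier A \<Longrightarrow> \<phi> (x \<oplus> y) = \<phi> x + \<phi> y"
    and phi_smult: "x \<in> carrier A \<Longrightarrow> \<phi> (c \<odot> x) = c * \<phi> x"
    and phi_one: "\<phi> \<one> = 1"
begin

lemma phi_zero [simp]: "\<phi> \<zero> = 0"
  using phi_smult[of \<zero> 0] by simp

lemma phi_lspan_eq_0:
  assumes "y \<in> lspan G" "G \<subseteq> carrier A" "\<And>x. x \<in> G \<Longrightarrow> \<phi> x = 0"
  shows "\<phi> y = 0"
  using assms(1)
proof (induction rule: lspan.induct)
  case (add x y c)
  have "x \<in> carrier A" "y \<in> carrier A" using add assms(2) lspan_closed by auto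
  then show ?case using add assms(3) by (simp add: phi_add phi_smult)
qed simp

lemma phi_finsum:
  assumes "finite I" "f \<in> I \<rightarrow> carrier A"
  shows "\<phi> (\<Oplus>i\<in>I. f i) = (\<Sum>i\<in>I. \<phi> (f i))"
  using assms
proof (induction I rule: finite_induct)
  case (insert i I)
  then show ?case by (simp add: Pi_iff phi_add finsum_closed)
qed simp

definition center :: "'a \<Rightarrow> 'a" where
  "center m = m \<oplus> (- \<phi> m) \<odot> \<one>"

lemma center_closed [simp]: "m \<in> carrier A \<Longrightarrow> center m \<in> carrier A"
  by (simp add: center_def)

lemma phi_center [simp]: "m \<in> carrier A \<Longrightarrow> \<phi> (center m) = 0"
  by (simp add: center_def phi_add phi_smult phi_one)

lemma decompose: "m \<in> carrier A \<Longrightarrow> m = \<phi> m \<odot> \<one> \<oplus> center m"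
proof -
  assume m: "m \<in> carrier A"
  have "\<phi> m \<odot> \<one> \<oplus> center m = m \<oplus> (\<phi> m \<odot> \<one> \<oplus> (- \<phi> m) \<odot> \<one>)"
    using m by (simp add: center_def a_lcomm)
  then show ?thesis using m by (simp flip: smult_l_distr)
qed

end

section \<open>Words in a subspace and a Haar unitary free from it\<close>

definition sg :: "bool \<Rightarrow> int" where
  "sg e = (if e then -1 else 1)"

lemma sg_neq: "e \<noteq> e' \<Longrightarrow> sg e = - sg e'"
  by (auto simp: sg_def)

locale free_unitary = linear_functional +
  fixes M B :: "'a set" and u :: "int \<Rightarrow> 'a"
  assumes M_closed: "M \<subseteq> carrier A" and M_one: "\<one> \<in> M"
    and M_add: "x \<in> M \<Longrightarrow> y \<in> M \<Longrightarrow> x \<oplus> y \<in> M" and M_smult: "x \<in> M \<Longrightarrow> c \<odot> x \<in> M"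
    and u_in: "u n \<in> B" and u_closed [simp]: "u n \<in> carrier A"
    and u_zero: "u 0 = \<one>" and u_add: "u k \<otimes> u n = u (k + n)" and u_star: "star A (u n) = u (- n)"
    and phi_u: "n \<noteq> 0 \<Longrightarrow> \<phi> (u n) = 0"
    and free_MB: "free A \<phi> UNIV (case_bool M B)"
begin

definition V :: "bool \<Rightarrow> 'a" where "V e = u (sg e)"

lemma V_closed [simp]: "V e \<in> carrier A"
  by (simp add: V_def)

lemma V_cancel: "e \<noteq> e' \<Longrightarrow> V e \<otimes> V e' = \<one>"
  by (simp add: V_def u_add sg_neq u_zero)

lemma center_M: "m \<in> M \<Longrightarrow> center m \<in> M"
  by (simp add: center_def M_add M_smult M_one)

text \<open>The tag \<open>True\<close> marks factors from \<open>M\<close> and \<open>False\<close>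
  factors from \<open>B\<close>, in accordance with \<open>case_bool M B\<close>.\<close>

definition centered :: "(bool \<times> 'a) list \<Rightarrow> bool" where
  "centered ws \<longleftrightarrow> distinct_adj (map fst ws) \<and> (\<forall>(i, a)\<in>set ws. a \<in> case_bool M B i \<and> \<phi> a = 0) \<and>
     set (map snd ws) \<subseteq> carrier A"

lemma phi_centered: "centered ws \<Longrightarrow> ws \<noteq> [] \<Longrightarrow> \<phi> (list_prod A (map snd ws)) = 0"
  using free_MB unfolding free_def centered_def by blast

definition centered_words :: "bool \<Rightarrow> 'a set" where
  "centered_words e = {list_prod A (map snd (ws @ [(False, u n)])) | ws n.
     centered (ws @ [(False, u n)]) \<and> n \<noteq> 0 \<and> (n < 0 \<longleftrightarrow> e)}"

lemma centered_words_closed: "centered_words e \<subseteq> carrier A"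
  unfolding centered_words_def centered_def by blast

text \<open>The words \<open>m\<^sub>0 v\<^bsup>\<plusminus>1\<^esup> m\<^sub>1 \<cdots> m\<^bsub>r-1\<^esub> v\<^bsup>\<plusminus>1\<^esup>\<close>, \<open>m\<^sub>i \<in> M\<close>, with \<open>\<phi>(m\<^sub>i) = 0\<close> at every sign change; the sign
  argument records the last exponent.\<close>

inductive free_prefix :: "bool \<Rightarrow> 'a \<Rightarrow> bool" where
  base: "m \<in> M \<Longrightarrow> free_prefix e (m \<otimes> V e)"
| step: "free_prefix e p \<Longrightarrow> m \<in> M \<Longrightarrow> (e' \<noteq> e \<Longrightarrow> \<phi> m = 0) \<Longrightarrow> free_prefix e' (p \<otimes> m \<otimes> V e')"

lemma free_prefix_closed: "free_prefix e p \<Longrightarrow> p \<in> carrier A"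
  by (induction rule: free_prefix.induct) (use M_closed in auto)

lemma centered_u: "n \<noteq> 0 \<Longrightarrow> centered [(False, u n)]"
  by (simp add: centered_def u_in phi_u)

lemma mult_decompose:
  assumes "p \<in> carrier A" "m \<in> M" "q \<in> carrier A"
  shows "p \<otimes> m \<otimes> q = \<phi> m \<odot> (p \<otimes> q) \<oplus> p \<otimes> center m \<otimes> q"
proof -
  have m: "m \<in> carrier A" using assms M_closed by blast
  have "p \<otimes> m \<otimes> q = p \<otimes> (\<phi> m \<odot> \<one> \<oplus> center m) \<otimes> q"
    using decompose[OF m] by simp
  also have "\<dots> = \<phi> m \<odot> (p \<otimes> q) \<oplus> p \<otimes> center m \<otimes> q"
    using assms m by (simp add: l_distr r_distr smult_mult_r smult_mult_l)
  finally show ?thesis .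
qed

text \<open>Every factor from \<open>M\<close> is split into scalar and centered part. The centered
  part lengthens an alternating word. An inner scalar part survives only between equal signs, where
  it merges two powers of the unitary into one of larger absolute exponent, still nonzero. This is
  why \<open>centered_words\<close> admits all nonzero exponents.\<close>

lemma free_prefix_in_lspan: "free_prefix e p \<Longrightarrow> p \<in> lspan (centered_words e)"
proof (induction rule: free_prefix.induct)
  case (base m e)
  have m: "m \<in> carrier A" using base M_closed by blast
  have sg: "sg e \<noteq> 0" "sg e < 0 \<longleftrightarrow> e" by (simp_all add: sg_def)
  have "V e \<in> centered_words e"
    unfolding centered_words_def V_def using centered_u[OF sg(1)] sg
    by (intro CollectI exI[of _ "[]"] exI[of _ "sg e"]) simp
  moreover have "center m \<otimes> V e \<in> centered_words e"
    unfolding centered_words_def V_def using sg base center_M m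
    by (intro CollectI exI[of _ "[(True, center m)]"] exI[of _ "sg e"])
      (simp add: centered_def u_in phi_u)
  moreover have "m \<otimes> V e = \<phi> m \<odot> V e \<oplus> center m \<otimes> V e"
    using mult_decompose[of \<one> m "V e"] base m by simp
  ultimately show ?case
    by (simp add: lspan_add lspan_smult lspan_base centered_words_closed)
next
  case (step e p m e')
  have m: "m \<in> carrier A" using step M_closed by blast
  have "x \<otimes> (m \<otimes> V e') \<in> lspan (centered_words e')" if x: "x \<in> centered_words e" for x
  proof -
    obtain ws n where ws: "x = list_prod A (map snd (ws @ [(False, u n)]))"
      "centered (ws @ [(False, u n)])" "n \<noteq> 0" "n < 0 \<longleftrightarrow> e"
      using x unfolding centered_words_def by blast
    have xc: "x \<in> carrier A" using x centered_words_closed by blast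
    have sub: "set (map snd ws) \<subseteq> carrier A" using ws(2) by (simp add: centered_def)
    have "x \<otimes> center m \<otimes> V e' = list_prod A (map snd ((ws @ [(False, u n), (True, center m)]) @ [(False, V e')]))"
      unfolding ws(1) using sub m by (simp add: list_prod_append m_assoc)
    moreover have "centered ((ws @ [(False, u n), (True, center m)]) @ [(False, V e')])"
      using ws(2) step(2) center_M m
      by (auto simp: centered_def distinct_adj_append_iff V_def u_in phi_u sg_def)
    ultimately have 1: "x \<otimes> center m \<otimes> V e' \<in> centered_words e'"
      unfolding centered_words_def V_def
      by (intro CollectI exI[of _ "ws @ [(False, u n), (True, center m)]"] exI[of _ "sg e'"])
        (simp add: sg_def)
    have 2: "\<phi> m \<odot> (x \<otimes> V e') \<in> lspan (centered_words e')"
    proof (cases "e' = e")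
      case True
      let ?n = "n + sg e"
      have n: "?n \<noteq> 0" "?n < 0 \<longleftrightarrow> e'" using ws(3,4) True by (auto simp: sg_def)
      have "x \<otimes> V e' = list_prod A (map snd (ws @ [(False, u ?n)]))"
        unfolding ws(1) using sub True by (simp add: list_prod_append m_assoc V_def u_add)
      moreover have "centered (ws @ [(False, u ?n)])"
        using ws(2) n by (auto simp: centered_def distinct_adj_append_iff u_in phi_u)
      ultimately have "x \<otimes> V e' \<in> centered_words e'"
        unfolding centered_words_def using n by blast
      then show ?thesis by (simp add: lspan_base lspan_smult centered_words_closed)
    next
      case False
      then show ?thesis using step(3) xc by (simp add: lspan.zero)
    qed
    have "x \<otimes> (m \<otimes> V e') = \<phi> m \<odot> (x \<otimes> V e') \<oplus> x \<otimes> center m \<otimes> V e'"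
      using mult_decompose[OF xc step(2) V_closed] m xc by (simp add: m_assoc)
    then show ?thesis using 1 2 by (simp add: lspan_add lspan_base centered_words_closed)
  qed
  then have "p \<otimes> (m \<otimes> V e') \<in> lspan (centered_words e')"
    by (intro lspan_mult_right[OF step.IH centered_words_closed centered_words_closed]) (use m in auto)
  then show ?case using step(1) m free_prefix_closed by (simp add: m_assoc)
qed

text \<open>After the same splitting of \<open>m\<close>, both parts are spanned by nonempty
  centered words, on which freeness gives 0.\<close>

lemma phi_free_prefix_mult:
  assumes "free_prefix e p" "m \<in> M"
  shows "\<phi> (p \<otimes> m) = 0"
proof -
  have m: "m \<in> carrier A" using assms M_closed by blast
  have "\<phi> (x \<otimes> m) = 0" if x: "x \<in> centered_words e" for x
  proof -
    obtain ws n where ws: "x = list_prod A (map snd (ws @ [(False, u n)]))"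
      "centered (ws @ [(False, u n)])"
      using x unfolding centered_words_def by blast
    have xc: "x \<in> carrier A" using x centered_words_closed by blast
    have sub: "set (map snd ws) \<subseteq> carrier A" using ws(2) by (simp add: centered_def)
    have "x \<otimes> center m = list_prod A (map snd (ws @ [(False, u n), (True, center m)]))"
      unfolding ws(1) using sub m by (simp add: list_prod_append m_assoc)
    moreover have "centered (ws @ [(False, u n), (True, center m)])"
      using ws(2) assms(2) center_M m
      by (auto simp: centered_def distinct_adj_append_iff)
    ultimately have "\<phi> (x \<otimes> center m) = 0"
      using phi_centered[of "ws @ [(False, u n), (True, center m)]"] by simp
    moreover have "\<phi> x = 0" unfolding ws(1) by (rule phi_centered[OF ws(2)]) simp
    moreover have "x \<otimes> m = \<phi> m \<odot> x \<oplus> x \<otimes> center m"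
      using mult_decompose[OF xc assms(2) one_closed] xc m by simp
    ultimately show ?thesis using xc m by (simp add: phi_add phi_smult)
  qed
  then have "p \<otimes> m \<in> lspan {x \<otimes> m |x. x \<in> centered_words e}"
    by (intro lspan_mult_right[OF free_prefix_in_lspan[OF assms(1)] centered_words_closed])
      (use m centered_words_closed in \<open>auto intro!: lspan_base\<close>)
  then show ?thesis
    by (rule phi_lspan_eq_0) (use m centered_words_closed \<open>\<And>x. x \<in> centered_words e \<Longrightarrow> \<phi> (x \<otimes> m) = 0\<close> in auto)
qed

end

text \<open>The indices are integers, read modulo \<open>b\<close> through \<open>E_cong\<close>, so
  that shifts by \<open>k\<close> and \<open>- k\<close> compose without wrap-around.\<close>

locale matrix_units = free_unitary +
  fixes b :: nat and E :: "int \<Rightarrow> int \<Rightarrow> 'a"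
  assumes b_pos: "b \<ge> 1"
    and E_M: "E i j \<in> M"
    and E_mult: "E i j \<otimes> E k l = (if int b dvd j - k then E i l else \<zero>)"
    and E_cong: "int b dvd i - i' \<Longrightarrow> int b dvd j - j' \<Longrightarrow> E i j = E i' j'"
    and E_star: "star A (E i j) = E j i"
    and E_sum: "(\<Oplus>i\<in>{0..<int b}. E i i) = \<one>"
    and phi_E: "\<phi> (E i j) = (if int b dvd i - j then 1 / of_nat b else 0)"
begin

lemma E_closed [simp]: "E i j \<in> carrier A"
  using E_M M_closed by blast

definition \<Lambda> :: complex where "\<Lambda> = 1 / of_nat b"

lemma E_mult_same: "E i j \<otimes> E j l = E i l"
  by (simp add: E_mult)

lemma E_mult_same_assoc: "x \<in> carrier A \<Longrightarrow> E i j \<otimes> (E j l \<otimes> x) = E i l \<otimes> x"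
  by (simp add: E_mult_same flip: m_assoc)

lemma finsum_residue:
  assumes "f \<in> {0..<int b} \<rightarrow> carrier A" "x \<in> carrier A"
    and "\<And>i. i \<in> {0..<int b} \<Longrightarrow> f i = (if int b dvd j - i then x else \<zero>)"
  shows "(\<Oplus>i\<in>{0..<int b}. f i) = x"
proof -
  have dvd: "int b dvd j - i \<longleftrightarrow> j mod int b = i" if "i \<in> {0..<int b}" for i
    using that by (metis atLeastLessThan_iff mod_eq_dvd_iff mod_pos_pos_trivial)
  have "(\<Oplus>i\<in>{0..<int b}. f i) = (\<Oplus>i\<in>{0..<int b}. if j mod int b = i then x else \<zero>)"
    using assms dvd by (intro finsum_cong') auto
  also have "\<dots> = x"
    using b_pos assms(2) by (intro finsum_singleton) auto
  finally show ?thesis .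
qed

lemma finsum_shift:
  assumes "\<And>i. f i \<in> carrier A" "\<And>i j. int b dvd i - j \<Longrightarrow> f i = f j"
  shows "(\<Oplus>i\<in>{0..<int b}. f (i + k)) = (\<Oplus>i\<in>{0..<int b}. f i)"
proof -
  have inj: "inj_on (\<lambda>i. (i + k) mod int b) {0..<int b}"
  proof (rule inj_onI)
    fix x y assume xy: "x \<in> {0..<int b}" "y \<in> {0..<int b}" "(x + k) mod int b = (y + k) mod int b"
    from xy(3) have "x mod int b = y mod int b" by (simp add: mod_eq_dvd_iff)
    moreover have "x mod int b = x" "y mod int b = y" using xy(1,2) by auto
    ultimately show "x = y" by simp
  qed
  have img: "(\<lambda>i. (i + k) mod int b) ` {0..<int b} = {0..<int b}"
    by (rule endo_inj_surj[OF _ _ inj]) (use b_pos in auto)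
  have "(\<Oplus>i\<in>{0..<int b}. f i) = (\<Oplus>i\<in>(\<lambda>i. (i + k) mod int b) ` {0..<int b}. f i)"
    by (simp only: img)
  also have "\<dots> = (\<Oplus>i\<in>{0..<int b}. f ((i + k) mod int b))"
    using assms(1) by (intro finsum_reindex inj) auto
  also have "\<dots> = (\<Oplus>i\<in>{0..<int b}. f (i + k))"
  proof -
    have "int b dvd (i + k) mod int b - (i + k)" for i
      using mod_eq_dvd_iff[of "(i + k) mod int b" "int b" "i + k"] by simp
    then have "f ((i + k) mod int b) = f (i + k)" for i
      by (rule assms(2))
    then show ?thesis by simp
  qed
  finally show ?thesis by simp
qed

section \<open>Diagonal parts and their expansion over stacks\<close>

definition diag :: "int \<Rightarrow> 'a" where
  "diag k = (\<Oplus>i\<in>{0..<int b}. E i (i + k) \<otimes> V False \<otimes> E i (i + k))"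

definition diag_letter :: "int \<Rightarrow> bool \<Rightarrow> 'a" where
  "diag_letter k e = (if e then star A (diag k) else diag k)"

lemma diag_closed [simp]: "diag k \<in> carrier A"
  unfolding diag_def by (rule finsum_closed) auto

lemma diag_letter_closed [simp]: "diag_letter k e \<in> carrier A"
  by (simp add: diag_letter_def)

lemma star_V: "star A (V e) = V (\<not> e)"
  by (simp add: V_def u_star sg_def)

text \<open>The adjoint of \<open>E i (i + k) \<otimes> V False \<otimes> E i (i + k)\<close> has
  the same shape, with \<open>V True\<close> and with the indices moved by \<open>- k\<close>. Hence
  one formula with \<open>sg e * k\<close> serves for both letters.\<close>

lemma E_diag_letter: "E j j \<otimes> diag_letter k e = E j (j + sg e * k) \<otimes> V e \<otimes> E j (j + sg e * k)"
proof (cases e)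
  case False
  have "E j j \<otimes> diag k = (\<Oplus>i\<in>{0..<int b}. E j j \<otimes> (E i (i + k) \<otimes> V False \<otimes> E i (i + k)))"
    unfolding diag_def by (rule finsum_rdistr) auto
  also have "\<dots> = E j (j + k) \<otimes> V False \<otimes> E j (j + k)"
  proof (rule finsum_residue[of _ _ j])
    fix i assume "i \<in> {0..<int b}"
    have "E i (i + k) = E j (j + k)" "E j (i + k) = E j (j + k)" if "int b dvd j - i"
      using that by (auto intro!: E_cong simp: dvd_diff_commute)
    then show "E j j \<otimes> (E i (i + k) \<otimes> V False \<otimes> E i (i + k)) =
       (if int b dvd j - i then E j (j + k) \<otimes> V False \<otimes> E j (j + k) else \<zero>)"
      by (simp add: E_mult flip: m_assoc)
  qed auto
  finally show ?thesis using False by (simp add: diag_letter_def sg_def)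
next
  case True
  have "star A (diag k) = (\<Oplus>i\<in>{0..<int b}. E (i + k) i \<otimes> V True \<otimes> E (i + k) i)"
    unfolding diag_def by (subst star_finsum) (auto simp: star_mult star_V E_star m_assoc)
  then have "E j j \<otimes> star A (diag k) = (\<Oplus>i\<in>{0..<int b}. E j j \<otimes> (E (i + k) i \<otimes> V True \<otimes> E (i + k) i))"
    by (simp add: finsum_rdistr)
  also have "\<dots> = E j (j - k) \<otimes> V True \<otimes> E j (j - k)"
  proof (rule finsum_residue[of _ _ "j - k"])
    fix i assume "i \<in> {0..<int b}"
    have "E (i + k) i = E j (j - k)" "E j i = E j (j - k)" if "int b dvd j - k - i"
      using that by (auto intro!: E_cong simp: dvd_diff_commute algebra_simps)
    then show "E j j \<otimes> (E (i + k) i \<otimes> V True \<otimes> E (i + k) i) =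
       (if int b dvd j - k - i then E j (j - k) \<otimes> V True \<otimes> E j (j - k) else \<zero>)"
      by (simp add: E_mult algebra_simps flip: m_assoc)
  qed auto
  finally show ?thesis using True by (simp add: diag_letter_def sg_def)
qed

text \<open>Compared with \<open>free_prefix\<close>, the word moreover begins with a matrix unit
  whose indices differ by \<open>sg e * k\<close>, where \<open>e\<close> is its first letter. This
  left boundary matters when a word belonging to another index is multiplied from the left.\<close>

inductive diag_prefix :: "int \<Rightarrow> bool \<Rightarrow> 'a \<Rightarrow> bool" for k where
  base: "diag_prefix k e (E i (i + sg e * k) \<otimes> V e)"
| step: "diag_prefix k e p \<Longrightarrow> m \<in> M \<Longrightarrow> (e' \<noteq> e \<Longrightarrow> \<phi> m = 0) \<Longrightarrow> diag_prefix k e' (p \<otimes> m \<otimes> V e')"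

lemma diag_prefix_free_prefix: "diag_prefix k e p \<Longrightarrow> free_prefix e p"
  by (induction rule: diag_prefix.induct) (auto intro: free_prefix.intros E_M)

text \<open>At a sign change the two inner matrix units multiply to an off-diagonal one, as \<open>k\<close> and \<open>l\<close> are
  distinct modulo \<open>b\<close>.\<close>

lemma free_prefix_mult_diag_prefix:
  assumes "diag_prefix l e' q" "free_prefix e p" "\<not> int b dvd k - l"
  shows "p \<otimes> E (j - sg e * k) j \<otimes> q = \<zero> \<or> free_prefix e' (p \<otimes> E (j - sg e * k) j \<otimes> q)"
  using assms(1)
proof (induction rule: diag_prefix.induct)
  case (base e' i)
  have p: "p \<in> carrier A" using assms(2) free_prefix_closed by blast
  have eq: "p \<otimes> E (j - sg e * k) j \<otimes> (E i (i + sg e' * l) \<otimes> V e') =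
      p \<otimes> (E (j - sg e * k) j \<otimes> E i (i + sg e' * l)) \<otimes> V e'"
    using p by (simp add: m_assoc)
  show ?case
  proof (cases "int b dvd j - i")
    case True
    have "\<phi> (E (j - sg e * k) (i + sg e' * l)) = 0" if "e' \<noteq> e"
    proof -
      have "\<not> int b dvd j - sg e * k - (i + sg e' * l)"
      proof
        assume "int b dvd j - sg e * k - (i + sg e' * l)"
        then have "int b dvd (j - i) - sg e * (k - l)"
          using sg_neq[OF that] by (simp add: algebra_simps)
        then have "int b dvd (j - i) - ((j - i) - sg e * (k - l))" using True dvd_diff by blast
        then have "int b dvd sg e * (k - l)" by simp
        then show False using assms(3) by (cases e) (auto simp: sg_def dvd_diff_commute)
      qed
      then show ?thesis by (simp add: phi_E)
    qed
    then show ?thesis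
      unfolding eq using True free_prefix.step[OF assms(2) E_M] by (simp add: E_mult)
  next
    case False
    then show ?thesis unfolding eq using p by (simp add: E_mult)
  qed
next
  case (step e1 q m e')
  let ?p = "p \<otimes> E (j - sg e * k) j"
  have c: "?p \<in> carrier A" "q \<in> carrier A" "m \<in> carrier A"
    using assms(2) free_prefix_closed free_prefix_closed[OF diag_prefix_free_prefix[OF step(1)]] step(2) M_closed by auto
  have eq: "?p \<otimes> (q \<otimes> m \<otimes> V e') = (?p \<otimes> q) \<otimes> m \<otimes> V e'"
    using c by (simp add: m_assoc)
  show ?case unfolding eq
    using step.IH c free_prefix.step[of e1 "?p \<otimes> q" m e'] step(2,3) by auto
qed

text \<open>The head of the list is the rightmost letter of the word, and \<open>j\<close> is its rightmost index. Adjacent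
  letters \<open>e', e\<close> are separated by the product of their matrix units, centered if \<open>e' \<noteq> e\<close>. Appending
  the last matrix unit gives \<open>stack_word\<close>.\<close>

fun stack_prefix :: "int \<Rightarrow> bool list \<Rightarrow> int \<Rightarrow> 'a" where
  "stack_prefix k [] j = \<one>"
| "stack_prefix k [e] j = E (j - sg e * k) j \<otimes> V e"
| "stack_prefix k (e # e' # s) j = stack_prefix k (e' # s) (j - sg e * k) \<otimes>
     (E (j - sg e * k - sg e' * k) j \<oplus> (if e' = e then 0 else - \<Lambda>) \<odot> \<one>) \<otimes> V e"

definition stack_word :: "int \<Rightarrow> bool list \<Rightarrow> int \<Rightarrow> 'a" where
  "stack_word k s j = (case s of [] \<Rightarrow> E j j | e # s' \<Rightarrow> stack_prefix k s j \<otimes> E (j - sg e * k) j)"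

lemma diag_prefix_stack_prefix: "diag_prefix k e (stack_prefix k (e # s) j)"
proof (induction s arbitrary: e j)
  case Nil
  show ?case using diag_prefix.base[of k e "j - sg e * k"] by simp
next
  case (Cons e' s)
  have "\<phi> (E (j - sg e * k - sg e' * k) j \<oplus> (- \<Lambda>) \<odot> \<one>) = 0" if "e \<noteq> e'"
    using sg_neq[OF that] by (simp add: phi_add phi_smult phi_one phi_E \<Lambda>_def)
  then show ?case
    unfolding stack_prefix.simps using E_M M_add M_smult M_one
    by (intro diag_prefix.step[OF Cons]) auto
qed

lemma stack_prefix_closed [simp]: "stack_prefix k s j \<in> carrier A"
proof (cases s)
  case (Cons e s')
  then show ?thesis using diag_prefix_stack_prefix diag_prefix_free_prefix free_prefix_closed by blast
qed simp

lemma stack_word_closed [simp]: "stack_word k s j \<in> carrier A"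
  by (cases s) (simp_all add: stack_word_def)

lemma stack_prefix_cong: "int b dvd j - j' \<Longrightarrow> stack_prefix k s j = stack_prefix k s j'"
proof (induction k s j arbitrary: j' rule: stack_prefix.induct)
  case (2 k e j)
  then show ?case by (auto intro!: arg_cong2[where f = "(\<otimes>)"] E_cong)
next
  case (3 k e e' s j)
  have "E (j - sg e * k - sg e' * k) j = E (j' - sg e * k - sg e' * k) j'"
    using 3(2) by (intro E_cong) auto
  moreover have "stack_prefix k (e' # s) (j - sg e * k) = stack_prefix k (e' # s) (j' - sg e * k)"
    using 3(2) by (intro 3(1)) auto
  ultimately show ?case by simp
qed simp

lemma stack_word_cong: "int b dvd j - j' \<Longrightarrow> stack_word k s j = stack_word k s j'"
  unfolding stack_word_def using stack_prefix_cong[of j j' k s]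
  by (auto split: list.splits intro!: E_cong arg_cong2[where f = "(\<otimes>)"])

lemma stack_word_diag_letter_Nil: "stack_word k [] j \<otimes> diag_letter k e = stack_word k [e] (j + sg e * k)"
  by (simp add: stack_word_def E_diag_letter)

text \<open>The last matrix unit of the word and the first one of the letter merge to
  \<open>E i J\<close>. For equal signs this is the required separator. For opposite signs
  \<open>i = J\<close>, and the diagonal unit is its centered part, which is the push, plus
  \<open>\<Lambda>\<close> times the unit, after which \<open>V e'\<close> and \<open>V e\<close>
  cancel and expose the stack below.\<close>

lemma stack_word_diag_letter_Cons:
  "stack_word k (e' # s) j \<otimes> diag_letter k e = stack_word k (e # e' # s) (j + sg e * k) \<oplus>
    (if e' = e then 0 else \<Lambda> * pop_weight \<Lambda> s e') \<odot> stack_word k s (j + sg e * k)"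
proof -
  define J where "J = j + sg e * k"
  define i where "i = j - sg e' * k"
  have j: "j = J - sg e * k" by (simp add: J_def)
  have "stack_word k (e' # s) j \<otimes> diag_letter k e = stack_prefix k (e' # s) j \<otimes> E i j \<otimes> (E j j \<otimes> diag_letter k e)"
    by (simp add: stack_word_def i_def E_mult_same E_mult_same_assoc m_assoc)
  also have "\<dots> = stack_prefix k (e' # s) j \<otimes> E i J \<otimes> V e \<otimes> E j J"
    unfolding E_diag_letter J_def[symmetric] by (simp add: E_mult_same_assoc m_assoc)
  finally have 1: "stack_word k (e' # s) j \<otimes> diag_letter k e = stack_prefix k (e' # s) j \<otimes> E i J \<otimes> V e \<otimes> E j J" .
  have 2: "stack_word k (e # e' # s) J = stack_prefix k (e' # s) j \<otimes> (E i J \<oplus> (if e' = e then 0 else - \<Lambda>) \<odot> \<one>) \<otimes> V e \<otimes> E j J"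
    by (simp add: stack_word_def i_def j)
  show ?thesis
  proof (cases "e' = e")
    case True
    then show ?thesis unfolding J_def[symmetric] 1 2 by simp
  next
    case False
    then have iJ: "i = J" using sg_neq[OF False] by (simp add: i_def J_def)
    have pop: "stack_prefix k (e' # s) j \<otimes> V e \<otimes> E j J = pop_weight \<Lambda> s e' \<odot> stack_word k s J"
    proof (cases s)
      case Nil
      have "stack_prefix k (e' # s) j \<otimes> V e \<otimes> E j J = E J j \<otimes> (V e' \<otimes> V e) \<otimes> E j J"
        by (simp add: Nil m_assoc flip: i_def iJ)
      then show ?thesis
        by (simp add: V_cancel[OF False] E_mult_same Nil pop_weight_def stack_word_def)
    next
      case (Cons e2 s')
      let ?m = "E (J - sg e2 * k) j \<oplus> (if e2 = e' then 0 else - \<Lambda>) \<odot> \<one>"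
      have "stack_prefix k (e' # s) j \<otimes> V e \<otimes> E j J = stack_prefix k s J \<otimes> ?m \<otimes> (V e' \<otimes> V e) \<otimes> E j J"
        by (simp add: Cons m_assoc flip: i_def iJ)
      also have "\<dots> = stack_prefix k s J \<otimes> (?m \<otimes> E j J)"
        by (simp add: V_cancel[OF False] m_assoc)
      also have "?m \<otimes> E j J = pop_weight \<Lambda> s e' \<odot> E (J - sg e2 * k) J"
      proof (cases "e2 = e'")
        case True
        then show ?thesis by (simp add: Cons pop_weight_def E_mult_same)
      next
        case ne: False
        \<comment> \<open>There are only two signs. The separator below is thus the centered unit
          \<open>E j j\<close> minus \<open>\<Lambda>\<close>, and its product with
          \<open>E j J\<close> yields the weight \<open>1 - \<Lambda>\<close>.\<close>
        then have "e2 = e" using False by auto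
        then have "E (J - sg e2 * k) j = E j j" "E (J - sg e2 * k) J = E j J" by (simp_all add: j)
        then have "?m \<otimes> E j J = 1 \<odot> E j J \<oplus> (- \<Lambda>) \<odot> E j J"
          using ne by (simp add: l_distr smult_mult_l E_mult_same)
        also have "\<dots> = (1 - \<Lambda>) \<odot> E j J"
          using smult_l_distr[of "E j J" 1 "- \<Lambda>"] by simp
        finally show ?thesis using ne \<open>E (J - sg e2 * k) J = E j J\<close> by (simp add: Cons pop_weight_def)
      qed
      finally show ?thesis by (simp add: smult_mult_r stack_word_def Cons)
    qed
    have "stack_prefix k (e' # s) j \<otimes> E i J \<otimes> V e \<otimes> E j J =
      stack_word k (e # e' # s) J \<oplus> \<Lambda> \<odot> (stack_prefix k (e' # s) j \<otimes> V e \<otimes> E j J)"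
    proof -
      have "stack_prefix k (e' # s) j \<otimes> E i J \<otimes> V e \<otimes> E j J =
         stack_prefix k (e' # s) j \<otimes> ((E i J \<oplus> (- \<Lambda>) \<odot> \<one>) \<oplus> \<Lambda> \<odot> \<one>) \<otimes> V e \<otimes> E j J"
        by (simp add: a_assoc flip: smult_l_distr)
      also have "\<dots> = stack_prefix k (e' # s) j \<otimes> (E i J \<oplus> (- \<Lambda>) \<odot> \<one>) \<otimes> V e \<otimes> E j J \<oplus>
          \<Lambda> \<odot> (stack_prefix k (e' # s) j \<otimes> V e \<otimes> E j J)"
        by (simp add: l_distr r_distr smult_mult_l smult_mult_r m_closed smult_closed del: stack_prefix.simps)
      finally show ?thesis unfolding 2 using False by simp
    qed
    then show ?thesis unfolding J_def[symmetric] 1 pop using False by (simp add: smult_smult)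
  qed
qed

definition stack_sum :: "int \<Rightarrow> bool list \<Rightarrow> 'a" where
  "stack_sum k s = (\<Oplus>j\<in>{0..<int b}. stack_word k s j)"

lemma stack_sum_closed [simp]: "stack_sum k s \<in> carrier A"
  unfolding stack_sum_def by (rule finsum_closed) auto

lemma stack_sum_shift: "(\<Oplus>j\<in>{0..<int b}. stack_word k s (j + l)) = stack_sum k s"
  unfolding stack_sum_def by (rule finsum_shift) (auto intro: stack_word_cong)

lemma stack_sum_Nil: "stack_sum k [] = \<one>"
  by (simp add: stack_sum_def stack_word_def E_sum)

lemma finsum_smult: "finite I \<Longrightarrow> f \<in> I \<rightarrow> carrier A \<Longrightarrow> (\<Oplus>i\<in>I. c \<odot> f i) = c \<odot> (\<Oplus>i\<in>I. f i)"
  by (induction I rule: finite_induct) (simp_all add: Pi_iff smult_r_distr finsum_closed)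

text \<open>Summation over all residues absorbs the shift of the index by \<open>sg e * k\<close>;
  what remains is, for every \<open>k\<close>, the recursion of \<open>stack_moment\<close>.\<close>

lemma stack_sum_diag_letter:
  "stack_sum k s \<otimes> diag_letter k e = stack_sum k (e # s) \<oplus>
    (case s of [] \<Rightarrow> \<zero> | e' # s' \<Rightarrow> (if e' = e then 0 else \<Lambda> * pop_weight \<Lambda> s' e') \<odot> stack_sum k s')"
proof -
  have "stack_sum k s \<otimes> diag_letter k e = (\<Oplus>j\<in>{0..<int b}. stack_word k s j \<otimes> diag_letter k e)"
    unfolding stack_sum_def by (rule finsum_ldistr) auto
  then show ?thesis
    by (cases s)
      (simp_all add: stack_word_diag_letter_Nil stack_word_diag_letter_Cons stack_sum_shift finsum_addf finsum_smult Pi_iff)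
qed

lemma phi_stack_sum: "\<phi> (stack_sum k s) = of_bool (s = [])"
proof (cases s)
  case Nil
  then show ?thesis by (simp add: stack_sum_Nil phi_one)
next
  case (Cons e s')
  have "\<phi> (stack_word k s j) = 0" for j
    using phi_free_prefix_mult[OF diag_prefix_free_prefix[OF diag_prefix_stack_prefix] E_M] by (simp add: stack_word_def Cons)
  then show ?thesis by (simp add: stack_sum_def phi_finsum Pi_iff Cons)
qed

definition word :: "int \<Rightarrow> bool list \<Rightarrow> 'a" where
  "word k w = list_prod A (map (diag_letter k) w)"

lemma word_closed [simp]: "word k w \<in> carrier A"
  unfolding word_def by (rule list_prod_closed) auto

lemma word_append: "word k (v @ w) = word k v \<otimes> word k w"
  unfolding word_def map_append by (rule list_prod_append) auto

lemma phi_stack_sum_word: "\<phi> (stack_sum k s \<otimes> word k w) = stack_moment \<Lambda> s w"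
proof (induction w arbitrary: s)
  case Nil
  then show ?case by (simp add: word_def phi_stack_sum)
next
  case (Cons e w)
  have "stack_sum k s \<otimes> word k (e # w) = stack_sum k s \<otimes> diag_letter k e \<otimes> word k w"
    using word_closed[of k w] by (simp add: word_def m_assoc)
  then show ?case
    by (cases s) (simp_all add: stack_sum_diag_letter l_distr smult_mult_l phi_add phi_smult Cons)
qed

lemma phi_word: "\<phi> (word k w) = stack_moment \<Lambda> [] w"
  using phi_stack_sum_word[of k "[]" w] by (simp add: stack_sum_Nil)

section \<open>The generated star-algebras and their freeness\<close>

lemma word_in_lspan: "word k w \<in> lspan (range (stack_sum k))"
proof (induction w rule: rev_induct)
  case Nil
  have "\<one> \<in> range (stack_sum k)" using stack_sum_Nil by (metis rangeI)
  then show ?case by (auto simp: word_def intro: lspan_base)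
next
  case (snoc e w)
  have r: "range (stack_sum k) \<subseteq> carrier A" by auto
  have "x \<otimes> diag_letter k e \<in> lspan (range (stack_sum k))" if x: "x \<in> range (stack_sum k)" for x
  proof -
    have base: "c \<odot> stack_sum k s \<in> lspan (range (stack_sum k))" for c s
      by (intro lspan_smult lspan_base r rangeI)
    obtain s where s: "x = stack_sum k s" using x by blast
    have 1: "stack_sum k (e # s) \<in> lspan (range (stack_sum k))" by (intro lspan_base r rangeI)
    show ?thesis
      unfolding s stack_sum_diag_letter
      by (rule lspan_add[OF r 1]) (cases s, simp_all only: list.case lspan.zero base)
  qed
  then have "word k w \<otimes> diag_letter k e \<in> lspan (range (stack_sum k))"
    by (intro lspan_mult_right[OF snoc r r]) auto
  then show ?case by (simp add: word_append) (simp add: word_def)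
qed

lemma star_word: "star A (word k w) = word k (rev (map Not w))"
proof (induction w)
  case Nil
  then show ?case by (simp add: word_def)
next
  case (Cons e w)
  have "star A (diag_letter k e) = diag_letter k (\<not> e)" by (simp add: diag_letter_def)
  moreover have "word k (e # w) = diag_letter k e \<otimes> word k w" by (simp add: word_def)
  moreover have "word k [\<not> e] = diag_letter k (\<not> e)" by (simp add: word_def)
  ultimately show ?case by (simp add: star_mult Cons word_append)
qed

lemma star_subalgebra_words: "star_subalgebra A (lspan (range (word k)))"
proof -
  have r: "range (word k) \<subseteq> carrier A" by auto
  have one: "\<one> \<in> lspan (range (word k))"
    by (rule lspan_base[OF _ r], rule range_eqI[of _ _ "[]"]) (simp add: word_def)
  have star: "star A x \<in> lspan (range (word k))" if "x \<in> lspan (range (word k))" for x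
    by (rule lspan_star[OF that r r]) (auto simp: star_word intro!: lspan_base)
  have mult: "x \<otimes> y \<in> lspan (range (word k))"
    if "x \<in> lspan (range (word k))" "y \<in> lspan (range (word k))" for x y
    by (rule lspan_mult[OF that r r r]) (auto simp: word_append[symmetric] intro!: lspan_base)
  show ?thesis
    unfolding star_subalgebra_def
    using r lspan_closed one star mult lspan_add[OF r] lspan_smult[OF r] by auto
qed

lemma diag_in_words: "diag k \<in> lspan (range (word k))"
  by (rule lspan_base, rule range_eqI[of _ _ "[False]"]) (auto simp: word_def diag_letter_def simp del: word_closed intro!: list_prod_closed)

text \<open>Here both ends of the word are controlled, in \<open>generic\<close> only the right end.
  A product of factors with different indices need not be \<open>reduced\<close>, but its right end
  still belongs to the last factor, and that is all the next multiplication needs.\<close>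

definition reduced :: "int \<Rightarrow> 'a set" where
  "reduced k = {p \<otimes> E (j - sg e * k) j |p e j. diag_prefix k e p}"

definition generic :: "int \<Rightarrow> 'a set" where
  "generic k = {p \<otimes> E (j - sg e * k) j |p e j. free_prefix e p}"

lemma reduced_generic: "reduced k \<subseteq> generic k"
  unfolding reduced_def generic_def using diag_prefix_free_prefix by blast

lemma generic_closed: "generic k \<subseteq> carrier A"
  unfolding generic_def using free_prefix_closed by auto

lemma reduced_closed: "reduced k \<subseteq> carrier A"
  using reduced_generic generic_closed by blast

lemma phi_generic: "x \<in> lspan (generic k) \<Longrightarrow> \<phi> x = 0"
  by (rule phi_lspan_eq_0[OF _ generic_closed]) (auto simp: generic_def phi_free_prefix_mult E_M)

lemma generic_mult_reduced:
  assumes "x \<in> generic k" "y \<in> reduced l" "\<not> int b dvd k - l"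
  shows "x \<otimes> y \<in> lspan (generic l)"
proof -
  obtain p e j where x: "x = p \<otimes> E (j - sg e * k) j" "free_prefix e p"
    using assms(1) unfolding generic_def by blast
  obtain q e' i where y: "y = q \<otimes> E (i - sg e' * l) i" "diag_prefix l e' q"
    using assms(2) unfolding reduced_def by blast
  have c: "p \<in> carrier A" "q \<in> carrier A" using free_prefix_closed[OF x(2)] free_prefix_closed[OF diag_prefix_free_prefix[OF y(2)]] by auto
  have "x \<otimes> y = (p \<otimes> E (j - sg e * k) j \<otimes> q) \<otimes> E (i - sg e' * l) i"
    unfolding x y using c by (simp add: m_assoc)
  moreover have "q' \<otimes> E (i - sg e' * l) i \<in> generic l" if "free_prefix e' q'" for q'
    unfolding generic_def using that by blast
  ultimately have "x \<otimes> y = \<zero> \<or> x \<otimes> y \<in> generic l"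
    using free_prefix_mult_diag_prefix[OF y(2) x(2) assms(3), of j] l_null[OF E_closed] by metis
  then show ?thesis
  proof
    assume "x \<otimes> y \<in> generic l"
    then show ?thesis by (rule lspan_base[OF _ generic_closed])
  qed (simp add: lspan.zero)
qed

lemma stack_sum_reduced: "stack_sum k (e # s) \<in> lspan (reduced k)"
  unfolding stack_sum_def
proof (rule lspan_finsum[OF reduced_closed])
  fix j
  have "stack_word k (e # s) j \<in> reduced k"
    unfolding reduced_def stack_word_def using diag_prefix_stack_prefix[of k e s j]
    by (intro CollectI exI[of _ "stack_prefix k (e # s) j"] exI[of _ e] exI[of _ j]) simp
  then show "stack_word k (e # s) j \<in> lspan (reduced k)" by (rule lspan_base[OF _ reduced_closed])
qed simp

text \<open>The words are spanned by the \<open>stack_sum k s\<close>. The one of the empty stack is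
  the unit, the others lie in the span of \<open>reduced k\<close>, where \<open>\<phi>\<close>
  vanishes. So \<open>\<phi> a\<close> is the coefficient of the unit.\<close>

lemma centered_words_reduced:
  assumes "a \<in> lspan (range (word k))" "\<phi> a = 0"
  shows "a \<in> lspan (reduced k)"
proof -
  have r: "range (stack_sum k) \<subseteq> carrier A" by auto
  have "a \<in> lspan (range (stack_sum k))"
    by (rule lspan_lspan[OF assms(1) _ r]) (auto intro: word_in_lspan)
  then have "\<exists>c. \<exists>y\<in>lspan (reduced k). a = c \<odot> \<one> \<oplus> y"
  proof (induction rule: lspan.induct)
    case zero
    show ?case using lspan.zero by (intro exI[of _ 0] bexI[of _ \<zero>]) auto
  next
    case (add x y c)
    obtain d z where z: "z \<in> lspan (reduced k)" "y = d \<odot> \<one> \<oplus> z" using add by blast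
    have zc: "z \<in> carrier A" using z(1) lspan_closed reduced_closed by blast
    obtain s where s: "x = stack_sum k s" using add by blast
    show ?case
    proof (cases s)
      case Nil
      have "c \<odot> x \<oplus> y = (c + d) \<odot> \<one> \<oplus> z"
        using zc by (simp add: s Nil stack_sum_Nil z smult_l_distr a_assoc)
      then show ?thesis using z by blast
    next
      case (Cons e s')
      have "c \<odot> x \<oplus> y = d \<odot> \<one> \<oplus> (c \<odot> x \<oplus> z)"
        using zc by (simp add: s z a_lcomm)
      moreover have "c \<odot> x \<oplus> z \<in> lspan (reduced k)"
        using stack_sum_reduced z(1) by (simp add: s Cons lspan_add lspan_smult reduced_closed)
      ultimately show ?thesis by blast
    qed
  qed
  then obtain c y where y: "y \<in> lspan (reduced k)" "a = c \<odot> \<one> \<oplus> y" by blast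
  have yc: "y \<in> carrier A" using y(1) lspan_closed reduced_closed by blast
  have "\<phi> y = 0" using phi_generic lspan_mono[OF y(1) reduced_generic] by blast
  then have "c = 0" using assms(2) yc by (simp add: y(2) phi_add phi_smult phi_one)
  then show ?thesis using y yc by simp
qed

text \<open>Factors are appended on the right. At each seam the two indices are distinct numbers
  below \<open>b\<close>, hence incongruent, and \<open>generic_mult_reduced\<close>
  applies.\<close>

lemma list_prod_reduced:
  assumes "ws \<noteq> []" "distinct_adj (map fst ws)"
    and "\<And>k a. (k, a) \<in> set ws \<Longrightarrow> k < b \<and> a \<in> lspan (reduced (int k))"
  shows "list_prod A (map snd ws) \<in> lspan (generic (int (fst (last ws))))"
  using assms
proof (induction ws rule: rev_induct)
  case (snoc w ws)
  obtain k a where w: "w = (k, a)" by (cases w)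
  have a: "k < b" "a \<in> lspan (reduced (int k))" using snoc.prems(3)[of k a] by (auto simp: w)
  have ac: "a \<in> carrier A" using a lspan_closed reduced_closed by blast
  show ?case
  proof (cases "ws = []")
    case True
    then show ?thesis using lspan_mono[OF a(2) reduced_generic] ac by (simp add: w)
  next
    case False
    obtain l where l: "l = fst (last ws)" by simp
    have ne: "l \<noteq> k" "distinct_adj (map fst ws)"
      using snoc.prems(2) False by (auto simp: w l distinct_adj_append_iff last_map)
    have lb: "l < b"
      using snoc.prems(3)[of "fst (last ws)" "snd (last ws)"] last_in_set[OF False] by (simp add: l)
    have nd: "\<not> int b dvd int l - int k"
    proof
      assume "int b dvd int l - int k"
      then have "int l mod int b = int k mod int b" by (simp add: mod_eq_dvd_iff)
      then show False using lb a(1) ne(1) by simp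
    qed
    have IH: "list_prod A (map snd ws) \<in> lspan (generic (int l))"
      unfolding l using snoc.prems(3) ne(2) by (intro snoc.IH False) auto
    have sub: "set (map snd ws) \<subseteq> carrier A"
      using snoc.prems(3) lspan_closed reduced_closed by fastforce
    have "list_prod A (map snd ws) \<otimes> a \<in> lspan (generic (int k))"
      by (rule lspan_mult[OF IH a(2) generic_closed reduced_closed generic_closed])
        (rule generic_mult_reduced[OF _ _ nd])
    then show ?thesis using sub ac by (simp add: w list_prod_append)
  qed
qed simp

lemma phi_list_prod_words:
  assumes "ws \<noteq> []" "distinct_adj (map fst ws)"
    and "\<And>k a. (k, a) \<in> set ws \<Longrightarrow> k < b \<and> a \<in> lspan (range (word (int k))) \<and> \<phi> a = 0"
  shows "\<phi> (list_prod A (map snd ws)) = 0"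
  using list_prod_reduced[OF assms(1,2)] assms(3) centered_words_reduced phi_generic by blast

end

section \<open>The Brown algebra\<close>

lemma finsum_complex_algebra: "finite K \<Longrightarrow> (\<Oplus>\<^bsub>complex_algebra\<^esub>k\<in>K. f k) = sum f K"
proof -
  interpret abelian_monoid complex_algebra
    by (rule abelian_monoidI) (auto simp: complex_algebra_def algebra_simps)
  assume "finite K"
  then show ?thesis
  proof (induction K rule: finite_induct)
    case empty
    show ?case unfolding finsum_empty by (simp add: complex_algebra_def)
  next
    case (insert k K)
    have "(\<Oplus>\<^bsub>complex_algebra\<^esub>k\<in>insert k K. f k) = f k \<oplus>\<^bsub>complex_algebra\<^esub> (\<Oplus>\<^bsub>complex_algebra\<^esub>k\<in>K. f k)"
      using insert by (intro finsum_insert) (auto simp: complex_algebra_def)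
    then show ?case using insert by (simp add: complex_algebra_def)
  qed
qed

lemma haar_state_powi:
  assumes "n \<noteq> 0"
  shows "haar_state (\<lambda>z\<in>sphere 0 1. z powi n) = 0"
proof -
  let ?c = "2 * of_real pi * of_int n * \<i>"
  have c: "?c \<noteq> 0" using assms by simp
  have "((\<lambda>t. exp (?c * of_real t)) has_integral
      exp (?c * of_real 1) / ?c - exp (?c * of_real 0) / ?c) {0..1}"
  proof (rule fundamental_theorem_of_calculus)
    fix t :: real
    have "((\<lambda>z. exp (?c * z) / ?c) has_field_derivative exp (?c * of_real t)) (at (of_real t))"
      using c by (auto intro!: derivative_eq_intros)
    from has_vector_derivative_real_field[OF this]
    show "((\<lambda>t. exp (?c * of_real t) / ?c) has_vector_derivative exp (?c * of_real t)) (at t within {0..1})"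
      by (simp add: o_def has_vector_derivative_at_within)
  qed simp
  moreover have "exp (?c * of_real 1) = 1"
    using exp_integer_2pi[of "of_int n"] by (simp add: mult_ac)
  ultimately have "((\<lambda>t. exp (?c * of_real t)) has_integral 0) {0..1}"
    by simp
  moreover have "(\<lambda>z\<in>sphere 0 1. z powi n) (cis (2 * pi * t)) = exp (?c * of_real t)" for t
    by (simp add: cis_power_int) (simp add: cis_conv_exp mult_ac)
  ultimately show ?thesis
    unfolding haar_state_def by (simp add: integral_unique)
qed

definition cyci :: "nat \<Rightarrow> int \<Rightarrow> nat" where
  "cyci b i = cyc b (nat (i mod int b))"

lemma cyci_in: "b \<ge> 1 \<Longrightarrow> cyci b i \<in> {1..b}"
  unfolding cyci_def by (rule cyc_in)

lemma cyci_eq_iff: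
  assumes "b \<ge> 1"
  shows "cyci b i = cyci b j \<longleftrightarrow> int b dvd i - j"
proof -
  have m: "cyci b i mod b = nat (i mod int b)" for i
    using assms by (simp add: cyci_def cyc_mod nat_less_iff)
  have "cyci b i = cyci b j \<longleftrightarrow> nat (i mod int b) = nat (j mod int b)"
    using m by (metis cyci_def)
  also have "\<dots> \<longleftrightarrow> i mod int b = j mod int b"
    using assms by (auto simp: nat_eq_iff2)
  finally show ?thesis by (simp add: mod_eq_dvd_iff)
qed

lemma cyci_int: "cyci b (int n) = cyc b n"
  by (simp add: cyci_def cyc_def flip: zmod_int)

lemma cyc_self: "b \<ge> 1 \<Longrightarrow> i \<in> {1..b} \<Longrightarrow> cyc b i = i"
  using cyc_eq_iff[of b i i] by simp

locale brown =
  fixes b :: nat and A :: "'a star_alg" (structure)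
    and \<iota> :: "(nat \<times> nat \<Rightarrow> complex) \<Rightarrow> 'a" and \<kappa> :: "(complex \<Rightarrow> complex) \<Rightarrow> 'a"
    and \<phi> :: "'a \<Rightarrow> complex"
  assumes b_pos: "b \<ge> 1"
    and star_algebra_A: "star_algebra A"
    and \<iota>_hom: "\<iota> \<in> star_hom (matrix_algebra b complex_algebra) A"
    and \<kappa>_hom: "\<kappa> \<in> star_hom circle_algebra A"
    and tracial: "tracial_state A \<phi>"
    and free_state: "is_free_product_state (matrix_algebra b complex_algebra) (matrix_state b (\<lambda>z. z))
       circle_algebra haar_state A \<iota> \<kappa> \<phi>"
begin

abbreviation Mb :: "(nat \<times> nat \<Rightarrow> complex) star_alg" where
  "Mb \<equiv> matrix_algebra b complex_algebra"

sublocale linear_functional A \<phi>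
  using star_algebra_ring[OF star_algebra_A] tracial
  unfolding linear_functional_def linear_functional_axioms_def tracial_state_def state_def by blast

lemma trace: "x \<in> carrier A \<Longrightarrow> y \<in> carrier A \<Longrightarrow> \<phi> (x \<otimes> y) = \<phi> (y \<otimes> x)"
  using tracial by (simp add: tracial_state_def)

lemma \<iota>_closed: "x \<in> carrier Mb \<Longrightarrow> \<iota> x \<in> carrier A"
  and \<iota>_mult: "x \<in> carrier Mb \<Longrightarrow> y \<in> carrier Mb \<Longrightarrow> \<iota> (x \<otimes>\<^bsub>Mb\<^esub> y) = \<iota> x \<otimes> \<iota> y"
  and \<iota>_add: "x \<in> carrier Mb \<Longrightarrow> y \<in> carrier Mb \<Longrightarrow> \<iota> (x \<oplus>\<^bsub>Mb\<^esub> y) = \<iota> x \<oplus> \<iota> y"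
  and \<iota>_one: "\<iota> \<one>\<^bsub>Mb\<^esub> = \<one>"
  and \<iota>_smult: "x \<in> carrier Mb \<Longrightarrow> \<iota> (c \<odot>\<^bsub>Mb\<^esub> x) = c \<odot> \<iota> x"
  and \<iota>_star: "x \<in> carrier Mb \<Longrightarrow> \<iota> (star Mb x) = star A (\<iota> x)"
  using \<iota>_hom by (auto simp: star_hom_def ring_hom_def)

lemma \<kappa>_closed: "f \<in> carrier circle_algebra \<Longrightarrow> \<kappa> f \<in> carrier A"
  and \<kappa>_mult: "f \<in> carrier circle_algebra \<Longrightarrow> g \<in> carrier circle_algebra \<Longrightarrow>
     \<kappa> (f \<otimes>\<^bsub>circle_algebra\<^esub> g) = \<kappa> f \<otimes> \<kappa> g"
  and \<kappa>_one: "\<kappa> \<one>\<^bsub>circle_algebra\<^esub> = \<one>"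
  and \<kappa>_star: "f \<in> carrier circle_algebra \<Longrightarrow> \<kappa> (star circle_algebra f) = star A (\<kappa> f)"
  using \<kappa>_hom by (auto simp: star_hom_def ring_hom_def)

definition u :: "int \<Rightarrow> 'a" where
  "u n = \<kappa> (\<lambda>z\<in>sphere 0 1. z powi n)"

lemma powi_carrier: "(\<lambda>z\<in>sphere 0 1. z powi n) \<in> carrier circle_algebra"
proof -
  have "continuous_on (sphere 0 1) (\<lambda>z::complex. z powi n)"
    by (intro continuous_intros) auto
  then have "continuous_on (sphere 0 1) (\<lambda>z\<in>sphere 0 1. z powi n :: complex)"
    by (rule continuous_on_eq) simp
  then show ?thesis by (simp add: circle_algebra_def)
qed

lemma u_closed: "u n \<in> carrier A"
  unfolding u_def by (rule \<kappa>_closed[OF powi_carrier])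

lemma u_add: "u k \<otimes> u n = u (k + n)"
proof -
  have "z powi k * z powi n = z powi (k + n)" if "cmod z = 1" for z
    using that by (subst power_int_add) auto
  then have "(\<lambda>z\<in>sphere 0 1. z powi k) \<otimes>\<^bsub>circle_algebra\<^esub> (\<lambda>z\<in>sphere 0 1. z powi n)
      = (\<lambda>z\<in>sphere 0 1. z powi (k + n))"
    by (auto simp: circle_algebra_def intro!: restrict_ext)
  then show ?thesis unfolding u_def by (simp add: powi_carrier flip: \<kappa>_mult)
qed

lemma u_zero: "u 0 = \<one>"
  using \<kappa>_one by (simp add: u_def circle_algebra_def)

lemma u_star: "star A (u n) = u (- n)"
proof -
  have "cnj z powi n = z powi (- n)" if "cmod z = 1" for z
  proof -
    have "z * cnj z = 1" using that by (simp flip: complex_norm_square)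
    then have "cnj z = inverse z" by (simp add: inverse_unique)
    then show ?thesis by (simp add: power_int_minus power_int_inverse)
  qed
  then have "star circle_algebra (\<lambda>z\<in>sphere 0 1. z powi n) = (\<lambda>z\<in>sphere 0 1. z powi (- n))"
    by (auto simp: circle_algebra_def intro!: restrict_ext)
  then show ?thesis unfolding u_def by (simp add: powi_carrier flip: \<kappa>_star)
qed

lemma phi_u: "n \<noteq> 0 \<Longrightarrow> \<phi> (u n) = 0"
  using free_state powi_carrier haar_state_powi[of n] unfolding is_free_product_state_def u_def by simp

lemma matrix_unit_carrier: "matrix_unit b i j \<in> carrier Mb"
  by (simp add: matrix_unit_def matrix_algebra_def complex_algebra_def)

lemma matrix_unit_mult:
  assumes "i \<in> {1..b}" "j \<in> {1..b}" "k \<in> {1..b}" "l \<in> {1..b}"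
  shows "matrix_unit b i j \<otimes>\<^bsub>Mb\<^esub> matrix_unit b k l = (of_bool (j = k) \<odot>\<^bsub>Mb\<^esub> matrix_unit b i l)"
proof -
  have "(\<Oplus>\<^bsub>complex_algebra\<^esub>r\<in>{1..b}. matrix_unit b i j (p, r) \<otimes>\<^bsub>complex_algebra\<^esub> matrix_unit b k l (r, q))
      = of_bool (j = k) * matrix_unit b i l (p, q)" if "p \<in> {1..b}" "q \<in> {1..b}" for p q
  proof -
    have "(\<Oplus>\<^bsub>complex_algebra\<^esub>r\<in>{1..b}. matrix_unit b i j (p, r) \<otimes>\<^bsub>complex_algebra\<^esub> matrix_unit b k l (r, q))
        = (\<Sum>r\<in>{1..b}. matrix_unit b i j (p, r) * matrix_unit b k l (r, q))"
      by (simp add: finsum_complex_algebra) (simp add: complex_algebra_def)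
    also have "\<dots> = (\<Sum>r\<in>{1..b}. if r = j then of_bool (p = i \<and> q = l \<and> j = k) else 0)"
      using that by (intro sum.cong) (auto simp: matrix_unit_def)
    also have "\<dots> = of_bool (j = k) * matrix_unit b i l (p, q)"
      using that assms by (auto simp: matrix_unit_def)
    finally show ?thesis .
  qed
  then show ?thesis
    unfolding matrix_algebra_def by (auto simp: complex_algebra_def intro!: restrict_ext)
qed

definition E :: "int \<Rightarrow> int \<Rightarrow> 'a" where
  "E i j = \<iota> (matrix_unit b (cyci b i) (cyci b j))"

lemma E_closed: "E i j \<in> carrier A"
  unfolding E_def by (rule \<iota>_closed[OF matrix_unit_carrier])

lemma E_mult: "E i j \<otimes> E k l = (if int b dvd j - k then E i l else \<zero>)"
proof -
  have "E i j \<otimes> E k l =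
      \<iota> (matrix_unit b (cyci b i) (cyci b j) \<otimes>\<^bsub>Mb\<^esub> matrix_unit b (cyci b k) (cyci b l))"
    unfolding E_def by (rule \<iota>_mult[OF matrix_unit_carrier matrix_unit_carrier, symmetric])
  also have "\<dots> = of_bool (cyci b j = cyci b k) \<odot> E i l"
    unfolding matrix_unit_mult[OF cyci_in[OF b_pos] cyci_in[OF b_pos] cyci_in[OF b_pos] cyci_in[OF b_pos]] E_def
    by (rule \<iota>_smult[OF matrix_unit_carrier])
  finally have "E i j \<otimes> E k l = of_bool (int b dvd j - k) \<odot> E i l"
    by (simp only: cyci_eq_iff[OF b_pos])
  then show ?thesis using E_closed by simp
qed

lemma E_cong: "int b dvd i - i' \<Longrightarrow> int b dvd j - j' \<Longrightarrow> E i j = E i' j'"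
  unfolding E_def using cyci_eq_iff[OF b_pos, of i i'] cyci_eq_iff[OF b_pos, of j j'] by simp

lemma E_star: "star A (E i j) = E j i"
proof -
  have "star Mb (matrix_unit b k l) = matrix_unit b l k" for k l
    by (auto simp: matrix_algebra_def complex_algebra_def matrix_unit_def intro!: restrict_ext)
  then show ?thesis unfolding E_def by (simp add: matrix_unit_carrier flip: \<iota>_star)
qed

lemma phi_E: "\<phi> (E i j) = (if int b dvd i - j then 1 / of_nat b else 0)"
proof -
  have "\<phi> (E i j) = matrix_state b (\<lambda>z. z) (matrix_unit b (cyci b i) (cyci b j))"
    using free_state matrix_unit_carrier unfolding is_free_product_state_def E_def by blast
  also have "(\<Sum>k=1..b. matrix_unit b (cyci b i) (cyci b j) (k, k)) =
      (\<Sum>k=1..b. if k = cyci b i then of_bool (cyci b i = cyci b j) else 0)"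
    by (intro sum.cong) (auto simp: matrix_unit_def)
  then have "matrix_state b (\<lambda>z. z) (matrix_unit b (cyci b i) (cyci b j)) =
      of_bool (cyci b i = cyci b j) / of_nat b"
    using cyci_in[OF b_pos, of i] by (simp add: matrix_state_def)
  finally show ?thesis by (simp add: cyci_eq_iff[OF b_pos])
qed

lemma E_sum_nat: "(\<Oplus>l\<in>{1..b}. E (int l) (int l)) = \<one>"
proof -
  have E: "E (int l) (int l) = \<iota> (matrix_unit b l l)" if "l \<in> {1..b}" for l
    using cyc_self[OF b_pos that] by (simp add: E_def cyci_int)
  \<comment> \<open>Partial sums of the diagonal units, since additivity of \<open>\<iota>\<close>
    is available for two summands at a time.\<close>
  define D where "D K = (\<lambda>(i, j)\<in>{1..b} \<times> {1..b}. if i = j \<and> i \<in> K then 1 else 0 :: complex)" for K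
  have D: "D K \<in> carrier Mb" for K
    by (simp add: D_def matrix_algebra_def complex_algebra_def)
  have "\<iota> (D K) = (\<Oplus>l\<in>K. \<iota> (matrix_unit b l l))" if "finite K" "K \<subseteq> {1..b}" for K
    using that
  proof (induction K rule: finite_induct)
    case empty
    have "D {} = 0 \<odot>\<^bsub>Mb\<^esub> D {}"
      by (auto simp: D_def matrix_algebra_def complex_algebra_def intro!: restrict_ext)
    then have "\<iota> (D {}) = 0 \<odot> \<iota> (D {})" using \<iota>_smult[OF D] by metis
    then show ?case using \<iota>_closed[OF D] by simp
  next
    case (insert k K)
    have "D (insert k K) = matrix_unit b k k \<oplus>\<^bsub>Mb\<^esub> D K"
      using insert(2,4) by (auto simp: D_def matrix_algebra_def complex_algebra_def matrix_unit_def intro!: restrict_ext)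
    then have "\<iota> (D (insert k K)) = \<iota> (matrix_unit b k k) \<oplus> \<iota> (D K)"
      using D matrix_unit_carrier by (simp add: \<iota>_add)
    then show ?case using insert \<iota>_closed[OF matrix_unit_carrier] by (simp add: Pi_iff)
  qed
  from this[of "{1..b}"] have "\<iota> (D {1..b}) = (\<Oplus>l\<in>{1..b}. \<iota> (matrix_unit b l l))" by simp
  moreover have "D {1..b} = \<one>\<^bsub>Mb\<^esub>"
    by (auto simp: D_def matrix_algebra_def complex_algebra_def intro!: restrict_ext)
  moreover have "(\<Oplus>l\<in>{1..b}. E (int l) (int l)) = (\<Oplus>l\<in>{1..b}. \<iota> (matrix_unit b l l))"
    using \<iota>_closed[OF matrix_unit_carrier] E by (intro finsum_cong') auto
  ultimately show ?thesis by (simp add: \<iota>_one)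
qed

lemma E_sum: "(\<Oplus>i\<in>{0..<int b}. E i i) = \<one>"
proof -
  have inj: "inj_on (\<lambda>l. int l mod int b) {1..b}"
  proof (rule inj_onI)
    fix x y assume xy: "x \<in> {1..b}" "y \<in> {1..b}" "int x mod int b = int y mod int b"
    then have "cyci b (int x) = cyci b (int y)" by (simp add: cyci_def)
    then show "x = y" using xy by (simp add: cyci_int cyc_self b_pos)
  qed
  have img: "(\<lambda>l. int l mod int b) ` {1..b} = {0..<int b}"
  proof (rule card_subset_eq)
    show "card ((\<lambda>l. int l mod int b) ` {1..b}) = card {0..<int b}"
      using card_image[OF inj] by simp
  qed (use b_pos in auto)
  have "(\<Oplus>i\<in>{0..<int b}. E i i) = (\<Oplus>i\<in>(\<lambda>l. int l mod int b) ` {1..b}. E i i)"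
    by (simp only: img)
  also have "\<dots> = (\<Oplus>l\<in>{1..b}. E (int l mod int b) (int l mod int b))"
    using E_closed by (intro finsum_reindex inj) auto
  also have "\<dots> = (\<Oplus>l\<in>{1..b}. E (int l) (int l))"
  proof -
    have "int b dvd int l mod int b - int l" for l
      using mod_eq_dvd_iff[of "int l mod int b" "int b" "int l"] by simp
    then have "E (int l mod int b) (int l mod int b) = E (int l) (int l)" for l
      by (intro E_cong)
    then show ?thesis by simp
  qed
  finally show ?thesis using E_sum_nat by simp
qed

sublocale matrix_units A \<phi> "\<iota> ` carrier Mb" "\<kappa> ` carrier circle_algebra" u b E
proof unfold_locales
  show "\<iota> ` carrier Mb \<subseteq> carrier A" using \<iota>_closed by blast
  have "\<one>\<^bsub>Mb\<^esub> \<in> carrier Mb" by (auto simp: matrix_algebra_def complex_algebra_def)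
  then show "\<one> \<in> \<iota> ` carrier Mb" by (metis \<iota>_one imageI)
  fix x y c
  assume x: "x \<in> \<iota> ` carrier Mb"
  then obtain m where m: "x = \<iota> m" "m \<in> carrier Mb" by blast
  have "c \<odot>\<^bsub>Mb\<^esub> m \<in> carrier Mb" using m(2) by (auto simp: matrix_algebra_def complex_algebra_def)
  then show "c \<odot> x \<in> \<iota> ` carrier Mb" using \<iota>_smult[OF m(2), of c] m(1) by (metis imageI)
  assume "y \<in> \<iota> ` carrier Mb"
  then obtain n where n: "y = \<iota> n" "n \<in> carrier Mb" by blast
  have "m \<oplus>\<^bsub>Mb\<^esub> n \<in> carrier Mb" using m(2) n(2) by (auto simp: matrix_algebra_def complex_algebra_def)
  then show "x \<oplus> y \<in> \<iota> ` carrier Mb" using \<iota>_add[OF m(2) n(2)] m(1) n(1) by (metis imageI)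
next
  show "u n \<in> \<kappa> ` carrier circle_algebra" for n
    unfolding u_def using powi_carrier by blast
  show "free A \<phi> UNIV (case_bool (\<iota> ` carrier Mb) (\<kappa> ` carrier circle_algebra))"
    using free_state by (simp add: is_free_product_state_def)
  show "E i j \<in> \<iota> ` carrier Mb" for i j
    unfolding E_def using matrix_unit_carrier by blast
qed (fact u_closed u_zero u_add u_star phi_u b_pos E_mult E_cong E_star E_sum phi_E | assumption)+

section \<open>The corner algebra and the matrices over it\<close>

abbreviation U :: "'a star_alg" where "U \<equiv> brown_algebra b A \<iota>"
abbreviation MU :: "(nat \<times> nat \<Rightarrow> 'a) star_alg" where "MU \<equiv> matrix_algebra b U"

lemma U_eq: "U = corner A (E 1 1)"
proof -
  have "cyci b 1 = 1" using cyci_int[of b 1] cyc_self[OF b_pos, of 1] b_pos by simp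
  then show ?thesis by (simp add: brown_algebra_def E_def)
qed

lemma U_simps:
  "mult U = mult A" "\<one>\<^bsub>U\<^esub> = E 1 1" "\<zero>\<^bsub>U\<^esub> = \<zero>" "add U = add A" "smult U = smult A" "star U = star A"
  by (simp_all add: U_eq corner_def)

lemma carrier_U: "carrier U = {x \<in> carrier A. E 1 1 \<otimes> x = x \<and> x \<otimes> E 1 1 = x}"
proof (intro equalityI subsetI)
  fix x assume "x \<in> carrier U"
  then obtain y where y: "y \<in> carrier A" "x = E 1 1 \<otimes> y \<otimes> E 1 1"
    by (auto simp: U_eq corner_def)
  then show "x \<in> {x \<in> carrier A. E 1 1 \<otimes> x = x \<and> x \<otimes> E 1 1 = x}"
    by (simp add: m_assoc E_mult_same E_mult_same_assoc)
next
  fix x assume x: "x \<in> {x \<in> carrier A. E 1 1 \<otimes> x = x \<and> x \<otimes> E 1 1 = x}"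
  then have "x = E 1 1 \<otimes> x \<otimes> E 1 1" by simp
  moreover have "x \<in> carrier A" using x by simp
  ultimately show "x \<in> carrier U" unfolding U_eq corner_def by (simp, blast)
qed

lemma ring_U: "Ring.ring U"
proof (rule ringI)
  show "abelian_group U"
  proof (rule abelian_groupI)
    fix x assume x: "x \<in> carrier U"
    then have "\<ominus> x \<in> carrier U" by (auto simp: carrier_U l_minus r_minus)
    moreover have "\<ominus> x \<oplus> x = \<zero>" using x by (simp add: carrier_U l_neg)
    ultimately show "\<exists>y\<in>carrier U. y \<oplus>\<^bsub>U\<^esub> x = \<zero>\<^bsub>U\<^esub>"
      unfolding U_simps by blast
  qed (auto simp: U_simps carrier_U a_ac l_distr r_distr)
  show "Group.monoid U"
  proof (rule monoidI)
    fix x y assume "x \<in> carrier U" "y \<in> carrier U"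
    then have x: "x \<in> carrier A" "E 1 1 \<otimes> x = x" and y: "y \<in> carrier A" "y \<otimes> E 1 1 = y"
      by (auto simp: carrier_U)
    have "E 1 1 \<otimes> (x \<otimes> y) = x \<otimes> y" using m_assoc[of "E 1 1" x y] x y by simp
    moreover have "x \<otimes> y \<otimes> E 1 1 = x \<otimes> y" using m_assoc[of x y "E 1 1"] x y by simp
    ultimately show "x \<otimes>\<^bsub>U\<^esub> y \<in> carrier U" using x y by (simp add: carrier_U U_simps)
  qed (auto simp: U_simps carrier_U m_assoc E_mult_same)
qed (auto simp: U_simps carrier_U l_distr r_distr)

lemma finsum_U:
  assumes "finite I" "f \<in> I \<rightarrow> carrier U"
  shows "(\<Oplus>\<^bsub>U\<^esub>i\<in>I. f i) = (\<Oplus>i\<in>I. f i)"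
proof -
  interpret U: Ring.ring U by (rule ring_U)
  show ?thesis
    using assms
  proof (induction I rule: finite_induct)
    case empty
    show ?case unfolding U.finsum_empty by (simp add: U_simps)
  next
    case (insert i I)
    have f: "f i \<in> carrier U" "f \<in> I \<rightarrow> carrier U" using insert(4) by auto
    then have fA: "f i \<in> carrier A" "f \<in> I \<rightarrow> carrier A" by (auto simp: carrier_U)
    show ?case
      unfolding U.finsum_insert[OF insert(1,2) f(2,1)] finsum_insert[OF insert(1,2) fA(2,1)]
      by (simp add: insert.IH[OF f(2)] U_simps)
  qed
qed

text \<open>The identification of \<open>A\<close> with \<open>M\<^sub>b(U)\<close>.\<close>

definition corner_matrix :: "'a \<Rightarrow> nat \<times> nat \<Rightarrow> 'a" where
  "corner_matrix x = (\<lambda>(i, j)\<in>{1..b} \<times> {1..b}. E 1 (int i) \<otimes> x \<otimes> E (int j) 1)"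

lemma corner_entry: "x \<in> carrier A \<Longrightarrow> E 1 i \<otimes> x \<otimes> E j 1 \<in> carrier U"
  by (simp add: carrier_U m_assoc E_mult_same E_mult_same_assoc)

lemma corner_matrix_closed: "x \<in> carrier A \<Longrightarrow> corner_matrix x \<in> carrier MU"
  unfolding corner_matrix_def matrix_algebra_def by (auto intro!: corner_entry)

text \<open>In the sum over the middle index, \<open>E l 1\<close> and \<open>E 1 l\<close> multiply
  to the diagonal unit \<open>E l l\<close>, and these units add up to one.\<close>

lemma corner_matrix_mult:
  assumes "x \<in> carrier A" "y \<in> carrier A"
  shows "corner_matrix (x \<otimes> y) = corner_matrix x \<otimes>\<^bsub>MU\<^esub> corner_matrix y"
proof -
  have "E 1 (int i) \<otimes> (x \<otimes> y) \<otimes> E (int j) 1 =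
      (\<Oplus>\<^bsub>U\<^esub>l\<in>{1..b}. corner_matrix x (i, l) \<otimes>\<^bsub>U\<^esub> corner_matrix y (l, j))"
    if ij: "i \<in> {1..b}" "j \<in> {1..b}" for i j
  proof -
    have "(\<Oplus>\<^bsub>U\<^esub>l\<in>{1..b}. corner_matrix x (i, l) \<otimes>\<^bsub>U\<^esub> corner_matrix y (l, j)) =
        (\<Oplus>l\<in>{1..b}. corner_matrix x (i, l) \<otimes>\<^bsub>U\<^esub> corner_matrix y (l, j))"
    proof (rule finsum_U)
      interpret U: Ring.ring U by (rule ring_U)
      show "(\<lambda>l. corner_matrix x (i, l) \<otimes>\<^bsub>U\<^esub> corner_matrix y (l, j)) \<in> {1..b} \<rightarrow> carrier U"
        using assms ij corner_entry by (intro funcsetI U.m_closed) (auto simp: corner_matrix_def)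
    qed simp
    also have "\<dots> = (\<Oplus>l\<in>{1..b}. (E 1 (int i) \<otimes> x) \<otimes> E (int l) (int l) \<otimes> (y \<otimes> E (int j) 1))"
      using assms ij
      by (intro finsum_cong') (auto simp: corner_matrix_def U_simps m_assoc E_mult_same_assoc)
    also have "\<dots> = (\<Oplus>l\<in>{1..b}. (E 1 (int i) \<otimes> x) \<otimes> E (int l) (int l)) \<otimes> (y \<otimes> E (int j) 1)"
      using assms by (intro finsum_ldistr[symmetric]) auto
    also have "(\<Oplus>l\<in>{1..b}. (E 1 (int i) \<otimes> x) \<otimes> E (int l) (int l)) = (E 1 (int i) \<otimes> x) \<otimes> (\<Oplus>l\<in>{1..b}. E (int l) (int l))"
      using assms by (intro finsum_rdistr[symmetric]) auto
    finally show ?thesis using assms by (simp add: E_sum_nat m_assoc del: One_nat_def)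
  qed
  then show ?thesis
    unfolding corner_matrix_def[of "x \<otimes> y"] matrix_algebra_def
    by (auto intro!: restrict_ext)
qed

lemma corner_matrix_one: "corner_matrix \<one> = \<one>\<^bsub>MU\<^esub>"
proof -
  have "int b dvd int i - int j \<longleftrightarrow> i = j" if "i \<in> {1..b}" "j \<in> {1..b}" for i j
    using cyci_eq_iff[OF b_pos, of "int i" "int j"] that by (simp add: cyci_int cyc_self b_pos)
  then show ?thesis
    unfolding corner_matrix_def matrix_algebra_def
    by (auto simp: U_simps E_mult intro!: restrict_ext)
qed

lemma corner_matrix_add:
  assumes "x \<in> carrier A" "y \<in> carrier A"
  shows "corner_matrix (x \<oplus> y) = corner_matrix x \<oplus>\<^bsub>MU\<^esub> corner_matrix y"
  unfolding corner_matrix_def matrix_algebra_def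
  using assms by (auto simp: U_simps l_distr r_distr intro!: restrict_ext)

lemma corner_matrix_smult:
  assumes "x \<in> carrier A"
  shows "corner_matrix (c \<odot> x) = c \<odot>\<^bsub>MU\<^esub> corner_matrix x"
  unfolding corner_matrix_def matrix_algebra_def
  using assms by (auto simp: U_simps smult_mult_l smult_mult_r intro!: restrict_ext)

lemma corner_matrix_star:
  assumes "x \<in> carrier A"
  shows "corner_matrix (star A x) = star MU (corner_matrix x)"
  unfolding corner_matrix_def matrix_algebra_def
  using assms by (auto simp: U_simps star_mult E_star m_assoc intro!: restrict_ext)

lemma corner_matrix_list_prod:
  "set xs \<subseteq> carrier A \<Longrightarrow> list_prod MU (map corner_matrix xs) = corner_matrix (list_prod A xs)"
proof (induction xs)
  case Nil
  then show ?case using corner_matrix_one by (simp add: Defs.list_prod_def)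
next
  case (Cons x xs)
  have "list_prod MU (map corner_matrix (x # xs)) = corner_matrix x \<otimes>\<^bsub>MU\<^esub> list_prod MU (map corner_matrix xs)"
    by (simp add: Defs.list_prod_def)
  then show ?case using Cons by (simp add: corner_matrix_mult)
qed

text \<open>Traciality brings \<open>E i 1\<close> to the front, where it makes \<open>E i i\<close>
  with \<open>E 1 i\<close>; these units add up to one. The factor \<open>b\<close> of the state on
  the corner cancels the \<open>1 / b\<close> of the normalized trace.\<close>

lemma matrix_state_corner_matrix:
  assumes x: "x \<in> carrier A"
  shows "matrix_state b (\<lambda>x. of_nat b * \<phi> x) (corner_matrix x) = \<phi> x"
proof -
  have "\<phi> (E 1 (int i) \<otimes> x \<otimes> E (int i) 1) = \<phi> (E (int i) (int i) \<otimes> x)" for i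
    using trace[of "E 1 (int i) \<otimes> x" "E (int i) 1"] x by (simp add: E_mult_same_assoc)
  then have "(\<Sum>i=1..b. \<phi> (E 1 (int i) \<otimes> x \<otimes> E (int i) 1)) = \<phi> (\<Oplus>i\<in>{1..b}. E (int i) (int i) \<otimes> x)"
    using x by (subst phi_finsum) auto
  also have "(\<Oplus>i\<in>{1..b}. E (int i) (int i) \<otimes> x) = x"
    using x finsum_ldistr[of "{1..b}" x "\<lambda>i. E (int i) (int i)"] by (simp add: E_sum_nat del: One_nat_def)
  finally show ?thesis
    using b_pos by (simp add: matrix_state_def corner_matrix_def flip: sum_distrib_left)
qed

lemma brown_matrix_eq: "brown_matrix b A \<iota> (\<kappa> (\<lambda>z\<in>sphere 0 1. z)) = corner_matrix (V False)"
proof -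
  have "\<kappa> (\<lambda>z\<in>sphere 0 1. z) = V False"
    by (simp add: V_def u_def sg_def cong: restrict_cong)
  moreover have "cyci b 1 = 1" using cyci_int[of b 1] cyc_self[OF b_pos, of 1] b_pos by simp
  moreover have "cyci b (int i) = i" if "i \<in> {1..b}" for i
    using that by (simp add: cyci_int cyc_self b_pos)
  ultimately show ?thesis
    unfolding brown_matrix_def corner_matrix_def E_def by (auto intro!: restrict_ext)
qed

text \<open>In row \<open>i\<close> of the matrix of \<open>diag k\<close>, the unit left of
  \<open>v\<close> becomes \<open>E 1 (i + k)\<close> and the one right of it \<open>E i 1\<close>.
  So the entry at \<open>(i, i + k)\<close> is that of \<open>v\<close> at
  \<open>(i + k, i)\<close>: the repeated unit \<open>E i (i + k)\<close> on both sides of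
  \<open>v\<close> is what produces the transpose.\<close>

lemma diagonal_part_eq_corner_matrix:
  "diagonal_part b U (corner_matrix (V False)) k = corner_matrix (diag (int k))"
proof -
  have "E 1 (int i) \<otimes> diag (int k) \<otimes> E (int j) 1 =
     (if j = cyc b (i + k) then corner_matrix (V False) (j, i) else \<zero>)"
    if i: "i \<in> {1..b}" and j: "j \<in> {1..b}" for i j
  proof -
    have "E 1 (int i) \<otimes> diag (int k) = E 1 (int i) \<otimes> (E (int i) (int i) \<otimes> diag_letter (int k) False)"
      by (simp add: E_mult_same_assoc diag_letter_def)
    also have "\<dots> = E 1 (int i + int k) \<otimes> V False \<otimes> E (int i) (int i + int k)"
      unfolding E_diag_letter by (simp add: sg_def E_mult_same_assoc m_assoc)
    finally have 1: "E 1 (int i) \<otimes> diag (int k) \<otimes> E (int j) 1 =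
       E 1 (int i + int k) \<otimes> V False \<otimes> (E (int i) (int i + int k) \<otimes> E (int j) 1)"
      by (simp add: m_assoc)
    have eq: "j = cyc b (i + k) \<longleftrightarrow> int b dvd int i + int k - int j"
      using cyci_eq_iff[OF b_pos, of "int (i + k)" "int j"] cyc_self[OF b_pos j]
      unfolding cyci_int by auto
    show ?thesis
    proof (cases "j = cyc b (i + k)")
      case True
      then have "E 1 (int i + int k) = E 1 (int j)" using eq by (intro E_cong) auto
      then show ?thesis unfolding 1 using True eq i j by (simp add: E_mult corner_matrix_def)
    next
      case False
      then show ?thesis unfolding 1 using eq by (simp add: E_mult)
    qed
  qed
  then have "corner_matrix (diag (int k)) = (\<lambda>(i, j)\<in>{1..b} \<times> {1..b}.
      if j = cyc b (i + k) then corner_matrix (V False) (j, i) else \<zero>\<^bsub>U\<^esub>)"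
    unfolding corner_matrix_def[of "diag _"] U_simps by (auto intro!: restrict_ext)
  then show ?thesis
    by (simp add: diagonal_part_eq[OF ring_U b_pos corner_matrix_closed])
qed

text \<open>The moments of all words in the matrix and its adjoint are given by
  \<open>stack_moment\<close>, so every cumulant is a \<open>word_cumulant\<close>, which is 0 off
  the alternating words of even length.\<close>

lemma R_diagonal_corner_matrix:
  "R_diagonal MU (matrix_state b (\<lambda>x. of_nat b * \<phi> x)) (corner_matrix (diag k))"
proof -
  let ?f = "\<lambda>e. corner_matrix (diag_letter k e)"
  have f: "(\<lambda>e. if e then star MU (corner_matrix (diag k)) else corner_matrix (diag k)) = ?f"
    by (auto simp: diag_letter_def corner_matrix_star)
  have "matrix_state b (\<lambda>x. of_nat b * \<phi> x) (list_prod MU (map ?f w)) = stack_moment \<Lambda> [] w" for w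
  proof -
    have "list_prod MU (map ?f w) = corner_matrix (word k w)"
    proof -
      have "set (map (diag_letter k) w) \<subseteq> carrier A" by auto
      from corner_matrix_list_prod[OF this] show ?thesis by (simp add: word_def comp_def)
    qed
    then show ?thesis by (simp add: matrix_state_corner_matrix phi_word)
  qed
  then have "free_cumulant MU (matrix_state b (\<lambda>x. of_nat b * \<phi> x)) (map ?f w) = word_cumulant \<Lambda> w" if "w \<noteq> []" for w
    using that by (intro free_cumulant_eq_word_cumulant[where \<phi> = "matrix_state b (\<lambda>x. of_nat b * \<phi> x)" and A = MU and f = ?f and c = \<Lambda>])
  then show ?thesis
    unfolding R_diagonal_def f by (auto simp: word_cumulant_def)
qed

text \<open>An inclusion suffices for freeness, which is a condition on each choice of elements and
  so passes to smaller sets.\<close>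

lemma hull_corner_matrix:
  "star_subalgebra MU hull {corner_matrix (diag k)} \<subseteq> corner_matrix ` lspan (range (word k))"
proof (rule hull_minimal)
  let ?W = "lspan (range (word k))"
  have W: "x \<in> carrier A" if "x \<in> ?W" for x
    by (rule lspan_closed[OF that]) auto
  note sub = star_subalgebra_words[of k, unfolded star_subalgebra_def]
  show "star_subalgebra MU (corner_matrix ` ?W)"
    unfolding star_subalgebra_def
  proof (intro conjI allI ballI)
    show "corner_matrix ` ?W \<subseteq> carrier MU" using W corner_matrix_closed by blast
    show "\<one>\<^bsub>MU\<^esub> \<in> corner_matrix ` ?W"
      using sub corner_matrix_one by (metis imageI)
    fix x assume "x \<in> corner_matrix ` ?W"
    then obtain x' where x: "x = corner_matrix x'" "x' \<in> ?W" by blast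
    show "c \<odot>\<^bsub>MU\<^esub> x \<in> corner_matrix ` ?W" for c
      unfolding x(1) corner_matrix_smult[OF W[OF x(2)], symmetric] using sub x(2) by blast
    show "star MU x \<in> corner_matrix ` ?W"
      unfolding x(1) corner_matrix_star[OF W[OF x(2)], symmetric] using sub x(2) by blast
    fix y assume "y \<in> corner_matrix ` ?W"
    then obtain y' where y: "y = corner_matrix y'" "y' \<in> ?W" by blast
    show "x \<oplus>\<^bsub>MU\<^esub> y \<in> corner_matrix ` ?W"
      unfolding x(1) y(1) corner_matrix_add[OF W[OF x(2)] W[OF y(2)], symmetric] using sub x(2) y(2) by blast
    show "x \<otimes>\<^bsub>MU\<^esub> y \<in> corner_matrix ` ?W"
      unfolding x(1) y(1) corner_matrix_mult[OF W[OF x(2)] W[OF y(2)], symmetric] using sub x(2) y(2) by blast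
  qed
qed (use diag_in_words in blast)

lemma star_free_corner_matrix:
  "star_free MU (matrix_state b (\<lambda>x. of_nat b * \<phi> x)) {..<b} (\<lambda>k. corner_matrix (diag (int k)))"
  unfolding star_free_def free_def
proof (intro allI impI, elim conjE)
  let ?S = "matrix_state b (\<lambda>x. of_nat b * \<phi> x)"
  fix ws :: "(nat \<times> (nat \<times> nat \<Rightarrow> 'a)) list"
  assume ne: "ws \<noteq> []" and dist: "distinct_adj (map fst ws)"
    and ws: "\<forall>(k, a)\<in>set ws. k \<in> {..<b} \<and>
      a \<in> star_subalgebra MU hull {corner_matrix (diag (int k))} \<and> ?S a = 0"
  have "\<exists>y. y \<in> lspan (range (word (int k))) \<and> corner_matrix y = a" if "(k, a) \<in> set ws" for k a
    using that ws hull_corner_matrix by blast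
  \<comment> \<open>The factors are pulled back to \<open>A\<close>, where having trace 0 is the
    same condition by \<open>matrix_state_corner_matrix\<close>.\<close>
  then obtain g where g: "\<And>k a. (k, a) \<in> set ws \<Longrightarrow>
      g k a \<in> lspan (range (word (int k))) \<and> corner_matrix (g k a) = a"
    by metis
  have gA: "g k a \<in> carrier A" if "(k, a) \<in> set ws" for k a
    by (rule lspan_closed[of _ "range (word (int k))"]) (use g[OF that] in auto)
  define vs where "vs = map (\<lambda>(k, a). (k, g k a)) ws"
  have "map snd ws = map corner_matrix (map snd vs)"
    using g by (auto simp: vs_def case_prod_unfold)
  moreover have sub: "set (map snd vs) \<subseteq> carrier A"
    using gA by (auto simp: vs_def)
  ultimately have "?S (list_prod MU (map snd ws)) = \<phi> (list_prod A (map snd vs))"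
    by (simp only: corner_matrix_list_prod matrix_state_corner_matrix list_prod_closed)
  also have "\<dots> = 0"
  proof (rule phi_list_prod_words)
    show "vs \<noteq> []" using ne by (simp add: vs_def)
    show "distinct_adj (map fst vs)" using dist by (simp add: vs_def comp_def case_prod_unfold)
    fix k a assume "(k, a) \<in> set vs"
    then obtain x where x: "(k, x) \<in> set ws" "a = g k x" by (auto simp: vs_def)
    have "\<phi> a = ?S x" using matrix_state_corner_matrix[OF gA[OF x(1)]] g[OF x(1)] x(2) by simp
    then show "k < b \<and> a \<in> lspan (range (word (int k))) \<and> \<phi> a = 0"
      using ws x g[OF x(1)] by auto
  qed
  finally show "?S (list_prod MU (map snd ws)) = 0" .
qed

end

theorem theorem15:
  fixes b :: nat
    and A U :: "'a star_alg"
    and \<iota> :: "(nat \<times> nat \<Rightarrow> complex) \<Rightarrow> 'a"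
    and \<kappa> :: "(complex \<Rightarrow> complex) \<Rightarrow> 'a"
    and \<phi>\<^sub>b \<phi> :: "'a \<Rightarrow> complex"
    and v :: "nat \<times> nat \<Rightarrow> 'a"
    and \<Phi> :: "(nat \<times> nat \<Rightarrow> 'a) \<Rightarrow> complex"
  assumes "b \<ge> 1"
    and "is_free_product (matrix_algebra b complex_algebra) circle_algebra A \<iota> \<kappa>"
    and "tracial_state A \<phi>\<^sub>b"
    and "is_free_product_state (matrix_algebra b complex_algebra) (matrix_state b (\<lambda>z. z))
           circle_algebra haar_state A \<iota> \<kappa> \<phi>\<^sub>b"
    and "U = brown_algebra b A \<iota>"
    and "\<phi> = (\<lambda>x. of_nat b * \<phi>\<^sub>b x)"
    and "v = brown_matrix b A \<iota> (\<kappa> (\<lambda>z\<in>sphere 0 1. z))"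
    and "\<Phi> = matrix_state b \<phi>"
  shows "(\<forall>k<b. R_diagonal (matrix_algebra b U) \<Phi> (diagonal_part b U v k)) \<and>
         star_free (matrix_algebra b U) \<Phi> {..<b} (diagonal_part b U v)"
proof -
  interpret brown b A \<iota> \<kappa> \<phi>\<^sub>b
    using assms(1-4) by (simp add: brown_def is_free_product_def cstar_algebra_def)
  have "diagonal_part b U v = (\<lambda>k. corner_matrix (diag (int k)))"
    unfolding assms(5,7) brown_matrix_eq diagonal_part_eq_corner_matrix by simp
  then show ?thesis
    unfolding assms(5,6,8) using R_diagonal_corner_matrix star_free_corner_matrix by simp
qed

end
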